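(* Let $\Phi$ be a hidden point process and $\Xi$ the measurement point process obtained from it by independent detection with constant probability $p_d\in(0,1]$, independent displacement with density $l_d(\cdot\mid x)$, and superposition with an independent Poisson clutter process with intensity function $l_c$, as described in the context; put $q_d=1-p_d$ and $\tilde l_d(z\mid x)=p_d\,l_d(z\mid x)$. Let $m\ge0$. For $\nu^{\otimes m}$-almost every $z_{1:m}=(z_1,\dots,z_m)\in\Lambda^m$ with $j^{(m)}_\Xi(z_{1:m})>0$, the first-order conditional moment measure of $\Phi$ given $\Xi=z_{1:m}$ has density with respect to $\nu(dx)$ given by $$\mu^{(1)}_{\Phi\mid\Xi=z_{1:m}}(x)=q_d\,l^{(1)}_{z_{1:m}}(x)+\sum_{r=1}^m\tilde l_d(z_r\mid x)\,l^{(1)}_{z_{1:m}}(x;z_r),$$ where $$l^{(1)}_{z_{1:m}}(x):=\frac{\Upsilon^{(1)}_{z_{1:m}}(x)}{j^{(m)}_\Xi(z_{1:m})},\qquad l^{(1)}_{z_{1:m}}(x;z_r):=\frac{\Upsilon^{(1)}_{z_{1:m}\setminus z_r}(x)}{j^{(m)}_\Xi(z_{1:m})},$$ and, for any $k\ge0$ and any $w_{1:k}=(w_1,\dots,w_k)\in\Lambda^k$, $$\Upsilon^{(1)}_{w_{1:k}}(x):=\sum_{p\ge0}\ \sum_{\substack{S\subset\{1,\dots,k\}\\|S|\le p}}\frac{q_d^{\,p-|S|}}{(p-|S|)!}\prod_{j\in\{1,\dots,k\}\setminus S}l_c(w_j)\int_{\Lambda^p}j^{(p+1)}_\Phi(x_1,\dots,x_p,x)\prod_{i=1}^{|S|}\tilde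 l_d(w_{s_i}\mid x_i)\,\nu(dx_1)\cdots\nu(dx_p),$$ with $s_1<\dots<s_{|S|}$ the elements of $S$.
   Context: Setting. $\Lambda$ is a relatively compact (Borel) subset of $\mathbb R^d$ and $\nu$ is a Radon reference measure. $\Phi$ is a simple finite point process on $\Lambda$ having Janossy densities $j^{(n)}_\Phi:\Lambda^n\to[0,\infty)$, $n\ge 0$, with respect to $\nu$: symmetric measurable functions such that for all measurable $F\ge 0$ on finite configurations, $E[F(\Phi)]=F(\emptyset)j^{(0)}_\Phi+\sum_{n\ge1}\frac1{n!}\int_{\Lambda^n}F(\{x_1,\dots,x_n\})j^{(n)}_\Phi(x_1,\dots,x_n)\,\nu(dx_1)\cdots\nu(dx_n)$. Measurement process. For each $x\in\Lambda$, $l_d(\cdot\mid x)$ is a probability density on $\Lambda$ with respect to $\nu$, jointly measurable in $(z,x)$. Given $\Phi$, each point $x\in\Phi$ is, independently of the other points, kept with probability $p_d$ and then moved to a random location with density $l_d(\cdot\mid x)$, or deleted with probability $q_d=1-p_d$. $\Xi$ is the superposition of the resulting points and of a Poisson point process on $\Lambda$ (clutter), independent of everything else, with intensity function $l_c\ge0$ with respect to $\nu$, $\int_\Lambda l_c\,d\nu<\infty$. Notation. $j^{(m)}_\Xi$ denotes the function $$j^{(m)}_\Xi(z_{1:m})=\sum_{n\ge0}\ \sum_{\substack{S\subset\{1,\dots,m\}\\|S|\le n}}\prod_{j\in\{1,\dots,m\}\setminus S}l_c(z_j)\frac{q_d^{\,n-|S|}}{(n-|S|)!}\int_{\Lambda^n}j^{(n)}_\Phi(x_1,\dots,x_n)\prod_{i=1}^{|S|}\tilde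 l_d(z_{s_i}\mid x_i)\,\nu(dx_1)\cdots\nu(dx_n),$$ with $s_1<\dots<s_{|S|}$ the elements of $S$ (up to the constant factor $e^{-\int_\Lambda l_c d\nu}$ this is the $m$-th Janossy density of $\Xi$ with respect to $\nu^{\otimes m}$). $z_{1:m}\setminus z_r$ is the sequence $(z_1,\dots,z_m)$ with the entry $z_r$ omitted. The first-order conditional moment density $\mu^{(1)}_{\Phi\mid\Xi=z_{1:m}}$ is defined by $E[\Phi(B)\mid\Xi=z_{1:m}]=\int_B\mu^{(1)}_{\Phi\mid\Xi=z_{1:m}}(x)\,\nu(dx)$ for measurable $B\subset\Lambda$, with the conditional expectation taken under a regular conditional distribution of $\Phi$ given $\Xi$; $\Phi(B)$ is the number of points of $\Phi$ in $B$. Values in $[0,\infty]$ are allowed. Empty products equal $1$, empty sums $0$, and $0^0=1$. *)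

theory Defs
  imports "HOL-Probability.Probability"
begin

section \<open>Finite point configurations and point processes\<close>

text \<open>
  Finite configurations (finite counting measures) are finite multisets. Multiplicities are
  needed because the reference measure may have atoms, so that displaced points and clutter
  points may coincide. Throughout, \<open>N\<close> is the reference measure regarded as a measure on the
  observation window, i.e. \<open>space N\<close> is the window.
\<close>

definition num_points :: "'a set \<Rightarrow> 'a multiset \<Rightarrow> nat" where
  "num_points B \<phi> = size (filter_mset (\<lambda>x. x \<in> B) \<phi>)"

definition conf :: "'a measure \<Rightarrow> 'a multiset measure" where
  "conf N = sigma {\<phi>. set_mset \<phi> \<subseteq> space N}
     {{\<phi>. set_mset \<phi> \<subseteq> space N \<and> num_points B \<phi> = k} | B k. B \<in> sets N}"

text \<open>Tuples \<open>x\<^sub>1, \<dots>, x\<^sub>n\<close> are represented as a function on \<open>{..<n}\<close>, so indices start at 0.\<close>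

definition config_of :: "nat \<Rightarrow> (nat \<Rightarrow> 'a) \<Rightarrow> 'a multiset" where
  "config_of n x = image_mset x (mset_set {..<n})"

definition radon_measure :: "'a::euclidean_space measure \<Rightarrow> bool" where
  "radon_measure \<nu> \<longleftrightarrow> sets \<nu> = sets borel \<and> (\<forall>K. compact K \<longrightarrow> emeasure \<nu> K < \<infinity>)"

definition simple_point_process :: "'w measure \<Rightarrow> 'a measure \<Rightarrow> ('w \<Rightarrow> 'a multiset) \<Rightarrow> bool" where
  "simple_point_process M N \<Phi> \<longleftrightarrow>
     \<Phi> \<in> M \<rightarrow>\<^sub>M conf N \<and> (AE \<omega> in M. \<forall>x. count (\<Phi> \<omega>) x \<le> 1)"

text \<open>
  In the expectation formula the term \<open>n = 0\<close> is \<open>F {#} * j 0 (\<lambda>_. undefined)\<close>, since the empty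
  product measure is the point mass at the empty tuple.
\<close>

definition janossy_densities ::
    "'w measure \<Rightarrow> 'a measure \<Rightarrow> ('w \<Rightarrow> 'a multiset) \<Rightarrow> (nat \<Rightarrow> (nat \<Rightarrow> 'a) \<Rightarrow> real) \<Rightarrow> bool" where
  "janossy_densities M N \<Phi> j \<longleftrightarrow>
     (\<forall>n. j n \<in> borel_measurable (Pi\<^sub>M {..<n} (\<lambda>_. N))) \<and>
     (\<forall>n. \<forall>x \<in> space (Pi\<^sub>M {..<n} (\<lambda>_. N)). 0 \<le> j n x) \<and>
     (\<forall>n. \<forall>x \<in> space (Pi\<^sub>M {..<n} (\<lambda>_. N)). \<forall>\<pi>. \<pi> permutes {..<n} \<longrightarrow> j n (x \<circ> \<pi>) = j n x) \<and>
     (\<forall>F \<in> borel_measurable (conf N).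
        (\<integral>\<^sup>+ \<omega>. F (\<Phi> \<omega>) \<partial>M) =
        (\<Sum>n. ennreal (1 / fact n) *
           (\<integral>\<^sup>+ x. F (config_of n x) * ennreal (j n x) \<partial>Pi\<^sub>M {..<n} (\<lambda>_. N))))"

text \<open>
  The counting probabilities are written out because \<open>poisson_pmf\<close> requires a positive rate,
  whereas sets of zero intensity are allowed here.
\<close>

definition poisson_point_process ::
    "'w measure \<Rightarrow> 'a measure \<Rightarrow> ('a \<Rightarrow> real) \<Rightarrow> ('w \<Rightarrow> 'a multiset) \<Rightarrow> bool" where
  "poisson_point_process M N l_c C \<longleftrightarrow>
     C \<in> M \<rightarrow>\<^sub>M conf N \<and>
     (\<forall>B \<in> sets N. \<forall>k. measure M {\<omega> \<in> space M. num_points B (C \<omega>) = k} =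
        (LINT z:B|N. l_c z) ^ k / fact k * exp (- (LINT z:B|N. l_c z))) \<and>
     (\<forall>(I :: nat set) B. finite I \<longrightarrow> (\<forall>i\<in>I. B i \<in> sets N) \<longrightarrow> disjoint_family_on B I \<longrightarrow>
        prob_space.indep_vars M (\<lambda>_. count_space UNIV) (\<lambda>i \<omega>. num_points (B i) (C \<omega>)) I)"

section \<open>Conditional laws\<close>

text \<open>\<open>\<kappa>\<close> is (a version of) the regular conditional distribution of \<open>Y\<close> given \<open>X\<close>.\<close>

definition regular_cond_distr ::
    "'w measure \<Rightarrow> ('w \<Rightarrow> 'b) \<Rightarrow> 'b measure \<Rightarrow> ('w \<Rightarrow> 'c) \<Rightarrow> 'c measure \<Rightarrow> ('b \<Rightarrow> 'c measure) \<Rightarrow> bool" where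
  "regular_cond_distr M X S Y T \<kappa> \<longleftrightarrow>
     X \<in> M \<rightarrow>\<^sub>M S \<and> Y \<in> M \<rightarrow>\<^sub>M T \<and> \<kappa> \<in> S \<rightarrow>\<^sub>M prob_algebra T \<and>
     (\<forall>A \<in> sets S. \<forall>B \<in> sets T.
        emeasure M {\<omega> \<in> space M. X \<omega> \<in> A \<and> Y \<omega> \<in> B} =
        (\<integral>\<^sup>+ \<omega>. indicator A (X \<omega>) * emeasure (\<kappa> (X \<omega>)) B \<partial>M))"

definition has_first_moment_density ::
    "'a multiset measure \<Rightarrow> 'a measure \<Rightarrow> ('a \<Rightarrow> ennreal) \<Rightarrow> bool" where
  "has_first_moment_density P N f \<longleftrightarrow>
     f \<in> borel_measurable N \<and>
     (\<forall>B \<in> sets N. (\<integral>\<^sup>+ \<phi>. of_nat (num_points B \<phi>) \<partial>P) = (\<integral>\<^sup>+ x\<in>B. f x \<partial>N))"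

section \<open>The measurement process\<close>

text \<open>
  \<open>l_d z x\<close> stands for the displacement density at \<open>z\<close> given \<open>x\<close>. A point \<open>x\<close> yields the
  configuration \<open>{#z#}\<close> with \<open>z\<close> drawn from this density, or no point at all.
\<close>

definition detection_law :: "'a measure \<Rightarrow> real \<Rightarrow> ('a \<Rightarrow> 'a \<Rightarrow> real) \<Rightarrow> 'a \<Rightarrow> 'a multiset measure" where
  "detection_law N p_d l_d x =
     distr (measure_pmf (bernoulli_pmf p_d) \<Otimes>\<^sub>M density N (\<lambda>z. ennreal (l_d z x)))
       (conf N) (\<lambda>(b, z). if b then {#z#} else {#})"

text \<open>
  The independent superposition of the outcomes of all points of \<open>\<phi>\<close>; the index \<open>(x, i)\<close> with
  \<open>i < count \<phi> x\<close> names the \<open>i\<close>-th occurrence of \<open>x\<close> in \<open>\<phi>\<close>.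
\<close>

definition detections_law ::
    "'a measure \<Rightarrow> real \<Rightarrow> ('a \<Rightarrow> 'a \<Rightarrow> real) \<Rightarrow> 'a multiset \<Rightarrow> 'a multiset measure" where
  "detections_law N p_d l_d \<phi> =
     (let I = (SIGMA x : set_mset \<phi>. {..<count \<phi> x})
      in distr (Pi\<^sub>M I (\<lambda>(x, i). detection_law N p_d l_d x)) (conf N) (\<lambda>D. \<Sum>k\<in>I. D k))"

definition measurement_process ::
    "'w measure \<Rightarrow> 'a measure \<Rightarrow> real \<Rightarrow> ('a \<Rightarrow> 'a \<Rightarrow> real) \<Rightarrow> ('a \<Rightarrow> real) \<Rightarrow>
     ('w \<Rightarrow> 'a multiset) \<Rightarrow> ('w \<Rightarrow> 'a multiset) \<Rightarrow> bool" where
  "measurement_process M N p_d l_d l_c \<Phi> \<Xi> \<longleftrightarrow>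
     (\<exists>D C. regular_cond_distr M \<Phi> (conf N) D (conf N) (detections_law N p_d l_d) \<and>
            poisson_point_process M N l_c C \<and>
            prob_space.indep_set M
              {(\<lambda>\<omega>. (\<Phi> \<omega>, D \<omega>)) -` A \<inter> space M | A. A \<in> sets (conf N \<Otimes>\<^sub>M conf N)}
              {C -` A \<inter> space M | A. A \<in> sets (conf N)} \<and>
            (\<forall>\<omega> \<in> space M. \<Xi> \<omega> = D \<omega> + C \<omega>))"

section \<open>The functions in the conditional moment formula\<close>

text \<open>
  With \<open>q_d = 1 - p_d\<close>; \<open>sorted_list_of_set S ! i\<close> is the \<open>i\<close>-th smallest element of \<open>S\<close>
  (starting at 0).
\<close>

definition janossy_meas ::
    "'a measure \<Rightarrow> real \<Rightarrow> ('a \<Rightarrow> 'a \<Rightarrow> real) \<Rightarrow> ('a \<Rightarrow> real) \<Rightarrow> (nat \<Rightarrow> (nat \<Rightarrow> 'a) \<Rightarrow> real) \<Rightarrow>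
     nat \<Rightarrow> (nat \<Rightarrow> 'a) \<Rightarrow> ennreal" where
  "janossy_meas N p_d l_d l_c j m z =
     (\<Sum>n. \<Sum>S | S \<subseteq> {..<m} \<and> card S \<le> n.
        (\<Prod>i\<in>{..<m} - S. ennreal (l_c (z i))) *
        ennreal ((1 - p_d) ^ (n - card S) / fact (n - card S)) *
        (\<integral>\<^sup>+ x. ennreal (j n x) *
           (\<Prod>i<card S. ennreal (p_d * l_d (z (sorted_list_of_set S ! i)) (x i)))
           \<partial>Pi\<^sub>M {..<n} (\<lambda>_. N)))"

definition Upsilon1 ::
    "'a measure \<Rightarrow> real \<Rightarrow> ('a \<Rightarrow> 'a \<Rightarrow> real) \<Rightarrow> ('a \<Rightarrow> real) \<Rightarrow> (nat \<Rightarrow> (nat \<Rightarrow> 'a) \<Rightarrow> real) \<Rightarrow>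
     nat \<Rightarrow> (nat \<Rightarrow> 'a) \<Rightarrow> 'a \<Rightarrow> ennreal" where
  "Upsilon1 N p_d l_d l_c j k w x =
     (\<Sum>p. \<Sum>S | S \<subseteq> {..<k} \<and> card S \<le> p.
        ennreal ((1 - p_d) ^ (p - card S) / fact (p - card S)) *
        (\<Prod>i\<in>{..<k} - S. ennreal (l_c (w i))) *
        (\<integral>\<^sup>+ y. ennreal (j (Suc p) (y(p := x))) *
           (\<Prod>i<card S. ennreal (p_d * l_d (w (sorted_list_of_set S ! i)) (y i)))
           \<partial>Pi\<^sub>M {..<p} (\<lambda>_. N)))"

text \<open>The tuple \<open>z\<close> of length \<open>m\<close> with its entry at position \<open>r\<close> left out.\<close>

definition omit_entry :: "nat \<Rightarrow> nat \<Rightarrow> (nat \<Rightarrow> 'a) \<Rightarrow> nat \<Rightarrow> 'a" where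
  "omit_entry m r z = (\<lambda>i\<in>{..<m - 1}. if i < r then z i else z (Suc i))"

text \<open>\<open>assoc_missed\<close> and \<open>assoc_detected\<close> are \<open>l\<^sup>1(x)\<close> and \<open>l\<^sup>1(x; z\<^sub>r)\<close>.\<close>

definition assoc_missed ::
    "'a measure \<Rightarrow> real \<Rightarrow> ('a \<Rightarrow> 'a \<Rightarrow> real) \<Rightarrow> ('a \<Rightarrow> real) \<Rightarrow> (nat \<Rightarrow> (nat \<Rightarrow> 'a) \<Rightarrow> real) \<Rightarrow>
     nat \<Rightarrow> (nat \<Rightarrow> 'a) \<Rightarrow> 'a \<Rightarrow> ennreal" where
  "assoc_missed N p_d l_d l_c j m z x =
     Upsilon1 N p_d l_d l_c j m z x / janossy_meas N p_d l_d l_c j m z"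

definition assoc_detected ::
    "'a measure \<Rightarrow> real \<Rightarrow> ('a \<Rightarrow> 'a \<Rightarrow> real) \<Rightarrow> ('a \<Rightarrow> real) \<Rightarrow> (nat \<Rightarrow> (nat \<Rightarrow> 'a) \<Rightarrow> real) \<Rightarrow>
     nat \<Rightarrow> (nat \<Rightarrow> 'a) \<Rightarrow> 'a \<Rightarrow> nat \<Rightarrow> ennreal" where
  "assoc_detected N p_d l_d l_c j m z x r =
     Upsilon1 N p_d l_d l_c j (m - 1) (omit_entry m r z) x / janossy_meas N p_d l_d l_c j m z"

end

(*
  Integrating the asserted density over B amounts to counting points: a point of Phi in B is either
  missed (factor q_d) or generates some z_r, so multiplying by j_Xi the right-hand side becomes the
  expression for j_Xi with j_Phi(x_1..x_n) replaced by j_Phi(x_1..x_n) * #{i. x_i in B}. This is a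
  pointwise identity. What has to be proved probabilistically is therefore that E[g(Phi); Xi = dz]
  is given by the expression for j_Xi with j_Phi replaced by g * j_Phi, for g supported on
  configurations of n points. Both sides are measures on configurations, which are determined by
  their generating functionals h |-> E prod_{z in Xi} h(z); these factorize over the points of Phi
  and the clutter, and expanding the product by the binomial theorem gives the sum over S.
  Comparing E[g(Phi); Xi = dz] with the disintegration E[g(Phi) | Xi = z] j_Xi(z) dz yields equality
  of integrals against functions of the multiset {z_1..z_m}. Both densities being symmetric, this
  gives almost everywhere equality. Finally, B ranges over a countable generator.
*)
theory Submission
  imports Defs
begin

section \<open>Configurations and generating functionals\<close>

text \<open>\<open>\<kappa>\<close> depends on the measurements only through their multiset, in
  which points may coincide because the reference measure may have atoms, whereas the formula
  concerns tuples. Everything is therefore tested against functions of the multiset, and the return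
  to tuples rests on the symmetry of the weights. Fixing the number n of hidden points has two
  effects: the Janossy series collapses to one term, and all measures compared are finite, as the
  uniqueness arguments require, although the full first moment may be infinite. The sum over n is
  taken only at the end, in \<open>ennreal\<close>, where it commutes with the integrals. Generating
  functionals are evaluated at simple functions h with values in [0,1]. The product over the points
  is then a finite product of powers of counts, so it is measurable, and independence of Poisson
  counts on disjoint sets applies directly. The constant exp(-\<integral>l_c)/m! relating
  \<open>janossy_meas\<close> to the law of \<Xi> occurs both in the joint law and in the law of
  \<Xi>, and cancels.\<close>

lemma space_conf: "space (conf N) = {\<phi>. set_mset \<phi> \<subseteq> space N}"
  unfolding conf_def by (rule space_measure_of) auto

lemma sets_conf:
  "sets (conf N) = sigma_sets {\<phi>. set_mset \<phi> \<subseteq> space N}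
     {{\<phi>. set_mset \<phi> \<subseteq> space N \<and> num_points B \<phi> = k} | B k. B \<in> sets N}"
  unfolding conf_def by (rule sets_measure_of) auto

lemma num_points_measurable [measurable]:
  assumes "B \<in> sets N"
  shows "num_points B \<in> conf N \<rightarrow>\<^sub>M count_space UNIV"
proof (rule measurableI)
  fix A :: "nat set"
  have "num_points B -` A \<inter> space (conf N) = (\<Union>k\<in>A. {\<phi>. set_mset \<phi> \<subseteq> space N \<and> num_points B \<phi> = k})"
    by (auto simp: space_conf)
  also have "\<dots> \<in> sets (conf N)"
    using assms by (intro sets.countable_UN' countableI_type) (auto simp: sets_conf intro!: sigma_sets.Basic)
  finally show "num_points B -` A \<inter> space (conf N) \<in> sets (conf N)" .
qed auto

lemma measurable_conf:
  assumes "\<And>x. x \<in> space S \<Longrightarrow> set_mset (f x) \<subseteq> space N"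
    and "\<And>B. B \<in> sets N \<Longrightarrow> (\<lambda>x. num_points B (f x)) \<in> S \<rightarrow>\<^sub>M count_space UNIV"
  shows "f \<in> S \<rightarrow>\<^sub>M conf N"
  unfolding conf_def
proof (rule measurable_measure_of)
  fix Y assume "Y \<in> {{\<phi>. set_mset \<phi> \<subseteq> space N \<and> num_points B \<phi> = k} | B k. B \<in> sets N}"
  then obtain B k where B: "B \<in> sets N" and Y: "Y = {\<phi>. set_mset \<phi> \<subseteq> space N \<and> num_points B \<phi> = k}"
    by auto
  have "f -` Y \<inter> space S = (\<lambda>x. num_points B (f x)) -` {k} \<inter> space S"
    using assms(1) Y by auto
  with assms(2)[OF B] show "f -` Y \<inter> space S \<in> sets S"
    by (simp add: measurable_sets)
qed (use assms(1) in auto)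

lemma num_points_simps [simp]:
  "num_points B {#} = 0"
  "num_points B (add_mset x \<phi>) = of_bool (x \<in> B) + num_points B \<phi>"
  "num_points B (\<phi> + \<psi>) = num_points B \<phi> + num_points B \<psi>"
  by (auto simp: num_points_def)

lemma num_points_sum [simp]: "num_points B (\<Sum>k\<in>I. f k) = (\<Sum>k\<in>I. num_points B (f k))"
  by (induction I rule: infinite_finite_induct) auto

lemma num_points_space:
  "\<phi> \<in> space (conf N) \<Longrightarrow> num_points (space N) \<phi> = size \<phi>"
  by (induction \<phi>) (auto simp: space_conf)

lemma size_measurable [measurable]: "size \<in> conf N \<rightarrow>\<^sub>M count_space UNIV"
  by (subst measurable_cong[where g = "num_points (space N)"]) (auto simp: num_points_space)

lemma num_points_le_size: "num_points B \<phi> \<le> size \<phi>"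
  by (simp add: num_points_def size_filter_mset_lesseq)

text \<open>Each point lies in at most one \<open>A i\<close>. This sigma-additivity of counts gives
  closure under disjoint unions in the Dynkin argument for first moments.\<close>

lemma num_points_sums:
  assumes "disjoint_family A"
  shows "(\<Sum>i. of_nat (num_points (A i) \<phi>) :: ennreal) = of_nat (num_points (\<Union>i. A i) \<phi>)"
proof (induction \<phi>)
  case (add x \<phi>)
  have "(\<Sum>i. of_bool (x \<in> A i) :: ennreal) = of_bool (x \<in> (\<Union>i. A i))"
    using suminf_indicator[OF assms, of x]
    by (simp add: indicator_def of_bool_def)
  with add show ?case
    by (simp add: suminf_add[symmetric] del: UN_iff)
qed simp

section \<open>Superposition and configurations of tuples\<close>

lemma plus_measurable_conf [measurable]:
  "(\<lambda>(\<phi>, \<psi>). \<phi> + \<psi>) \<in> conf N \<Otimes>\<^sub>M conf N \<rightarrow>\<^sub>M conf N"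
proof (rule measurable_conf)
  fix B assume [measurable]: "B \<in> sets N"
  show "(\<lambda>x. num_points B (case x of (\<phi>, \<psi>) \<Rightarrow> \<phi> + \<psi>)) \<in> conf N \<Otimes>\<^sub>M conf N \<rightarrow>\<^sub>M count_space UNIV"
    by (simp add: case_prod_beta) measurable
qed (auto simp: space_pair_measure space_conf)

lemma size_config_of [simp]: "size (config_of n x) = n"
  by (simp add: config_of_def)

lemma num_points_config_of:
  "num_points B (config_of n x) = (\<Sum>i<n. of_bool (x i \<in> B))"
proof -
  have "num_points B (image_mset x (mset_set A)) = (\<Sum>i\<in>A. of_bool (x i \<in> B))" if "finite A" for A
    using that by (induction A rule: finite_induct) auto
  then show ?thesis by (simp add: config_of_def)
qed

lemma prod_mset_config_of: "(\<Prod>x\<in>#config_of n y. h x) = (\<Prod>i<n. h (y i))"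
  by (simp add: config_of_def image_mset.compositionality o_def prod_unfold_prod_mset)

lemma config_of_permute:
  assumes "\<pi> permutes {..<n}"
  shows "config_of n (x \<circ> \<pi>) = config_of n x"
proof -
  have "config_of n (x \<circ> \<pi>) = image_mset x (image_mset \<pi> (mset_set {..<n}))"
    by (simp add: config_of_def image_mset.compositionality o_def)
  also have "image_mset \<pi> (mset_set {..<n}) = mset_set {..<n}"
    using assms by (subst image_mset_mset_set) (auto simp: permutes_inj_on permutes_image)
  finally show ?thesis by (simp only: config_of_def)
qed

lemma config_of_measurable [measurable]:
  "config_of n \<in> Pi\<^sub>M {..<n} (\<lambda>_. N) \<rightarrow>\<^sub>M conf N"
proof (rule measurable_conf)
  fix B assume [measurable]: "B \<in> sets N"
  show "(\<lambda>x. num_points B (config_of n x)) \<in> Pi\<^sub>M {..<n} (\<lambda>_. N) \<rightarrow>\<^sub>M count_space UNIV"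
    unfolding num_points_config_of of_bool_def by measurable
qed (auto simp: config_of_def space_PiM)

text \<open>Grouping the points by the value of \<open>h\<close> leaves finitely many factors, each
  a power of a count. This makes the product measurable in \<open>\<phi>\<close> and, for Poisson
  points, a product of functions of independent counts.\<close>

lemma prod_mset_simple_function:
  fixes h :: "'a \<Rightarrow> 'b::comm_semiring_1"
  assumes "finite (h ` space N)" and "\<phi> \<in> space (conf N)"
  shows "(\<Prod>x\<in>#\<phi>. h x) = (\<Prod>v\<in>h ` space N. v ^ num_points (h -` {v} \<inter> space N) \<phi>)"
  using assms(2)
proof (induction \<phi>)
  case (add x \<phi>)
  then have x: "x \<in> space N" and \<phi>: "\<phi> \<in> space (conf N)" by (auto simp: space_conf)
  have "(\<Prod>v\<in>h ` space N. v ^ of_bool (h x = v)) = (\<Prod>v\<in>h ` space N. if v = h x then v else 1)"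
    by (intro prod.cong) auto
  also have "\<dots> = h x"
    using x assms(1) by (subst prod.delta) auto
  finally show ?case
    using add.IH[OF \<phi>] x by (simp add: power_add prod.distrib)
qed simp

lemma prod_mset_measurable:
  fixes h :: "'a \<Rightarrow> ennreal"
  assumes "simple_function N h"
  shows "(\<lambda>\<phi>. \<Prod>x\<in>#\<phi>. h x) \<in> borel_measurable (conf N)"
proof -
  have [measurable]: "h -` {v} \<inter> space N \<in> sets N" for v
    using assms by (rule simple_functionD(2))
  show ?thesis
    by (subst measurable_cong[OF prod_mset_simple_function[OF simple_functionD(1)[OF assms]]], assumption)
       measurable
qed

text \<open>The real version is needed for Ryser's formula, whose terms carry signs.\<close>

lemma prod_mset_measurable_real:
  fixes h :: "'a \<Rightarrow> real"
  assumes "simple_function N h"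
  shows "(\<lambda>\<phi>. \<Prod>x\<in>#\<phi>. h x) \<in> borel_measurable (conf N)"
proof -
  have [measurable]: "h -` {v} \<inter> space N \<in> sets N" for v
    using assms by (rule simple_functionD(2))
  show ?thesis
    by (subst measurable_cong[OF prod_mset_simple_function[OF simple_functionD(1)[OF assms]]], assumption)
       measurable
qed

section \<open>Uniqueness of power series coefficients\<close>

text \<open>Once the coefficients below \<open>n\<close> vanish, dividing by \<open>x ^ n\<close>
  leaves a power series that is continuous at 0 and zero for small positive \<open>x\<close>, so its
  constant term vanishes. Only arguments in (0,1) are available, since generating functionals are
  controlled where the test function is at most 1.\<close>

lemma powser_coeffs_eq_0:
  fixes c :: "nat \<Rightarrow> real"
  assumes "summable c" and "\<And>x. 0 < x \<Longrightarrow> x < 1 \<Longrightarrow> (\<Sum>k. c k * x ^ k) = 0"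
  shows "c n = 0"
proof (induction n rule: less_induct)
  case (less n)
  \<comment> \<open>The factor \<open>1 ^ k\<close> records convergence at 1, hence continuity
    inside the unit disc.\<close>
  have sm: "summable (\<lambda>k. c (k + n) * 1 ^ k)"
    using assms(1) by (simp add: summable_iff_shift)
  define g where "g x = (\<Sum>k. c (k + n) * x ^ k)" for x
  have "isCont g 0"
    unfolding g_def using isCont_powser[OF sm, of 0] by simp
  then have "(g \<longlongrightarrow> g 0) (at_right 0)"
    by (simp add: isCont_def filterlim_at_split)
  moreover have "eventually (\<lambda>x. g x = 0) (at_right 0)"
    unfolding eventually_at_right_field
  proof (intro exI[of _ 1] conjI allI impI)
    fix x :: real assume x: "0 < x" "x < 1"
    have "summable (\<lambda>k. c k * x ^ k)"
      using powser_inside[of c 1 x] assms(1) x by simp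
    then have "(\<Sum>k. c k * x ^ k) = (\<Sum>k. c (k + n) * x ^ (k + n)) + (\<Sum>k<n. c k * x ^ k)"
      by (rule suminf_split_initial_segment)
    also have "(\<Sum>k<n. c k * x ^ k) = 0"
      using less by simp
    also have "(\<Sum>k. c (k + n) * x ^ (k + n)) = (\<Sum>k. c (k + n) * x ^ k * x ^ n)"
      by (simp add: power_add mult.assoc)
    also have "\<dots> = g x * x ^ n"
      unfolding g_def using powser_inside[OF sm, of x] x by (intro suminf_mult2[symmetric]) simp
    finally show "g x = 0"
      using assms(2)[OF x] x by simp
  qed simp
  then have "(g \<longlongrightarrow> 0) (at_right 0)"
    by (rule tendsto_eventually)
  ultimately have "g 0 = 0"
    by (rule tendsto_unique[rotated]) simp
  then show ?case
    by (simp add: g_def)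
qed

text \<open>Evaluation at \<open>s = 1\<close> transfers finiteness from \<open>a\<close> to
  \<open>b\<close>; both sequences are then real and summable, so their difference makes
  sense.\<close>

lemma ennreal_powser_unique:
  fixes a b :: "nat \<Rightarrow> ennreal"
  assumes fin: "(\<Sum>k. a k) < \<infinity>"
    and eq: "\<And>s. 0 \<le> s \<Longrightarrow> s \<le> 1 \<Longrightarrow> (\<Sum>k. a k * ennreal s ^ k) = (\<Sum>k. b k * ennreal s ^ k)"
  shows "a n = b n"
proof -
  have finb: "(\<Sum>k. b k) < \<infinity>"
    using fin eq[of 1] by simp
  have lt: "f k < \<infinity>" if "(\<Sum>k. f k) < \<infinity>" for f :: "nat \<Rightarrow> ennreal" and k
    using sum_le_suminf[of f "{k}"] that by (auto intro: le_less_trans)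
  define a' b' where "a' k = enn2real (a k)" and "b' k = enn2real (b k)" for k
  have a: "a = (\<lambda>k. ennreal (a' k))" and b: "b = (\<lambda>k. ennreal (b' k))"
    using lt[OF fin] lt[OF finb] by (simp_all add: a'_def b'_def)
  have nn: "0 \<le> a' k" "0 \<le> b' k" for k by (auto simp: a'_def b'_def)
  have sa: "summable a'" and sb: "summable b'"
    using fin finb nn unfolding a b by (simp_all add: summable_suminf_not_top)
  have "a' n - b' n = 0"
  proof (rule powser_coeffs_eq_0[where c = "\<lambda>k. a' k - b' k"])
    show "summable (\<lambda>k. a' k - b' k)" using sa sb by (rule summable_diff)
    fix x :: real assume x: "0 < x" "x < 1"
    have sax: "summable (\<lambda>k. a' k * x ^ k)" and sbx: "summable (\<lambda>k. b' k * x ^ k)"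
      using powser_inside[of a' 1 x] powser_inside[of b' 1 x] x sa sb by simp_all
    have "ennreal (\<Sum>k. a' k * x ^ k) = ennreal (\<Sum>k. b' k * x ^ k)"
      using eq[of x] x sax sbx nn unfolding a b
      by (simp add: ennreal_power ennreal_mult[symmetric] suminf_ennreal2)
    then have "(\<Sum>k. a' k * x ^ k) = (\<Sum>k. b' k * x ^ k)"
      using x nn sax sbx by (subst (asm) ennreal_inj) (auto intro!: suminf_nonneg)
    then show "(\<Sum>k. (a' k - b' k) * x ^ k) = 0"
      using sax sbx by (simp add: left_diff_distrib suminf_diff[symmetric])
  qed
  then show ?thesis by (simp add: a b)
qed

text \<open>Multiplying \<open>h\<close> by \<open>s\<close> on \<open>B\<close> turns the generating functional into a power series in \<open>s\<close> whose
  coefficients restrict it to the events \<open>num_points B = k\<close>; iterating this reaches a generator.\<close>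

lemma conf_measure_eqI:
  assumes sets: "sets P = sets (conf N)" "sets Q = sets (conf N)"
    and fin: "emeasure P (space P) < \<infinity>"
    and eq: "\<And>h. simple_function N h \<Longrightarrow> (\<And>x. h x \<le> 1) \<Longrightarrow>
      (\<integral>\<^sup>+\<phi>. (\<Prod>x\<in>#\<phi>. h x) \<partial>P) = (\<integral>\<^sup>+\<phi>. (\<Prod>x\<in>#\<phi>. h x) \<partial>Q)"
  shows "P = Q"
proof -
  note [measurable_cong] = sets
  have sp: "space P = space (conf N)" "space Q = space (conf N)"
    using sets by (auto dest: sets_eq_imp_space_eq)
  \<comment> \<open>Finite conjunctions of count constraints, with sets that may overlap.
    Concatenating lists intersects the events, and the empty list gives the whole space.\<close>
  define ev where "ev L \<phi> \<longleftrightarrow> (\<forall>(B, k)\<in>set L. num_points B \<phi> = k)" for L :: "('a set \<times> nat) list" and \<phi>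
  have ev_measurable [measurable]: "Measurable.pred (conf N) (ev L)"
    if "\<forall>(B, k)\<in>set L. B \<in> sets N" for L
    using that
  proof (induction L)
    case (Cons Bk L)
    obtain B k where Bk: "Bk = (B, k)" by force
    with Cons have [measurable]: "B \<in> sets N" "Measurable.pred (conf N) (ev L)" by auto
    have "ev (Bk # L) = (\<lambda>\<phi>. num_points B \<phi> = k \<and> ev L \<phi>)"
      by (simp add: ev_def Bk fun_eq_iff)
    then show ?case by simp
  qed (simp add: ev_def[abs_def])
  \<comment> \<open>\<open>h\<close> varies in the induction: for a new constraint on
    \<open>B\<close> the hypothesis is applied to \<open>h\<close> rescaled by \<open>s\<close> on
    \<open>B\<close>, for every \<open>s\<close> in [0,1].\<close>
  have main: "(\<integral>\<^sup>+\<phi>. of_bool (ev L \<phi>) * (\<Prod>x\<in>#\<phi>. h x) \<partial>P) = (\<integral>\<^sup>+\<phi>. of_bool (ev L \<phi>) * (\<Prod>x\<in>#\<phi>. h x) \<partial>Q)"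
    if "simple_function N h" "\<And>x. h x \<le> 1" "\<forall>(B, k)\<in>set L. B \<in> sets N" for L h
    using that
  proof (induction L arbitrary: h)
    case Nil
    then show ?case using eq[of h] by (simp add: ev_def)
  next
    case (Cons Bk L)
    obtain B k where Bk: "Bk = (B, k)" by force
    have [measurable]: "B \<in> sets N" and L: "\<forall>(B, k)\<in>set L. B \<in> sets N"
      using Cons.prems Bk by auto
    note [measurable] = prod_mset_measurable[OF Cons.prems(1)] ev_measurable[OF L]
    define t where "t i \<phi> = of_bool (num_points B \<phi> = i) * (of_bool (ev L \<phi>) * (\<Prod>x\<in>#\<phi>. h x))"
      for i \<phi>
    have [measurable]: "t i \<in> borel_measurable (conf N)" for i
      unfolding t_def by measurable
    have sums: "(\<Sum>i. t i \<phi> * c ^ i) = of_bool (ev L \<phi>) * (\<Prod>x\<in>#\<phi>. h x * (if x \<in> B then c else 1))"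
      for \<phi> and c :: ennreal
    proof -
      have "(\<Prod>x\<in>#\<phi>. h x * (if x \<in> B then c else 1)) = (\<Prod>x\<in>#\<phi>. h x) * c ^ num_points B \<phi>"
        by (induction \<phi>) (auto simp: ac_simps)
      moreover have "(\<Sum>i. t i \<phi> * c ^ i) = (\<Sum>i\<in>{num_points B \<phi>}. t i \<phi> * c ^ i)"
        by (rule suminf_finite) (auto simp: t_def)
      ultimately show ?thesis by (simp add: t_def mult.assoc)
    qed
    have gf: "(\<Sum>i. (\<integral>\<^sup>+\<phi>. t i \<phi> \<partial>R) * c ^ i) =
        (\<integral>\<^sup>+\<phi>. of_bool (ev L \<phi>) * (\<Prod>x\<in>#\<phi>. h x * (if x \<in> B then c else 1)) \<partial>R)"
      if [measurable_cong]: "sets R = sets (conf N)" for R and c :: ennreal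
    proof -
      have "(\<Sum>i. (\<integral>\<^sup>+\<phi>. t i \<phi> \<partial>R) * c ^ i) = (\<Sum>i. \<integral>\<^sup>+\<phi>. t i \<phi> * c ^ i \<partial>R)"
        by (intro suminf_cong nn_integral_multc[symmetric]) measurable
      also have "\<dots> = (\<integral>\<^sup>+\<phi>. (\<Sum>i. t i \<phi> * c ^ i) \<partial>R)"
        by (intro nn_integral_suminf[symmetric]) measurable
      finally show ?thesis by (simp add: sums)
    qed
    have "(\<Sum>i. (\<integral>\<^sup>+\<phi>. t i \<phi> \<partial>P)) = (\<integral>\<^sup>+\<phi>. of_bool (ev L \<phi>) * (\<Prod>x\<in>#\<phi>. h x) \<partial>P)"
      using gf[OF sets(1), of 1] by simp
    also have "\<dots> \<le> (\<integral>\<^sup>+\<phi>. 1 \<partial>P)"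
    proof (rule nn_integral_mono)
      fix \<phi>
      have "(\<Prod>x\<in>#\<phi>. h x) \<le> 1"
      proof (induction \<phi>)
        case (add x \<phi>)
        then show ?case using mult_mono[OF Cons.prems(2)[of x] add.IH] by simp
      qed simp
      then show "of_bool (ev L \<phi>) * (\<Prod>x\<in>#\<phi>. h x) \<le> 1" by (cases "ev L \<phi>") auto
    qed
    also have "\<dots> < \<infinity>" using fin by simp
    finally have finite: "(\<Sum>i. (\<integral>\<^sup>+\<phi>. t i \<phi> \<partial>P)) < \<infinity>" .
    have "(\<integral>\<^sup>+\<phi>. t k \<phi> \<partial>P) = (\<integral>\<^sup>+\<phi>. t k \<phi> \<partial>Q)"
    proof (rule ennreal_powser_unique[OF finite])
      fix s :: real assume s: "0 \<le> s" "s \<le> 1"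
      have "simple_function N (\<lambda>x. h x * (if x \<in> B then ennreal s else 1))"
        using Cons.prems(1) by (intro simple_function_mult simple_function_If_set simple_function_const) auto
      moreover have "h x * (if x \<in> B then ennreal s else 1) \<le> 1" for x
        using mult_mono[OF Cons.prems(2)[of x], of "if x \<in> B then ennreal s else 1" 1] s
        by (auto simp: ennreal_le_1)
      ultimately show "(\<Sum>i. (\<integral>\<^sup>+\<phi>. t i \<phi> \<partial>P) * ennreal s ^ i) = (\<Sum>i. (\<integral>\<^sup>+\<phi>. t i \<phi> \<partial>Q) * ennreal s ^ i)"
        unfolding gf[OF sets(1)] gf[OF sets(2)] using L by (rule Cons.IH)
    qed
    moreover have "of_bool (ev (Bk # L) \<phi>) * (\<Prod>x\<in>#\<phi>. h x) = t k \<phi>" for \<phi>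
      by (auto simp: t_def ev_def Bk)
    ultimately show ?case by simp
  qed
  define E where "E = {{\<phi>\<in>space (conf N). ev L \<phi>} | L. \<forall>(B, k)\<in>set L. B \<in> sets N}"
  have E_sets: "E \<subseteq> sets (conf N)"
    by (auto simp: E_def)
  have sets_E: "sets (conf N) = sigma_sets (space (conf N)) E"
  proof
    show "sigma_sets (space (conf N)) E \<subseteq> sets (conf N)"
      by (rule sets.sigma_sets_subset[OF E_sets])
    have "{{\<phi>. set_mset \<phi> \<subseteq> space N \<and> num_points B \<phi> = k} | B k. B \<in> sets N} \<subseteq> E"
    proof safe
      fix B k assume "B \<in> sets N"
      then show "{\<phi>. set_mset \<phi> \<subseteq> space N \<and> num_points B \<phi> = k} \<in> E"
        by (auto simp: E_def ev_def space_conf intro!: exI[of _ "[(B, k)]"])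
    qed
    then show "sets (conf N) \<subseteq> sigma_sets (space (conf N)) E"
      unfolding sets_conf space_conf by (rule sigma_sets_mono')
  qed
  show ?thesis
  proof (rule measure_eqI_generator_eq[where E = E and \<Omega> = "space (conf N)" and A = "\<lambda>_. space (conf N)"])
    show "Int_stable E"
    proof (rule Int_stableI)
      fix a b assume "a \<in> E" "b \<in> E"
      then obtain L L' where "\<forall>(B, k)\<in>set L. B \<in> sets N" "\<forall>(B, k)\<in>set L'. B \<in> sets N"
        "a = {\<phi>\<in>space (conf N). ev L \<phi>}" "b = {\<phi>\<in>space (conf N). ev L' \<phi>}"
        by (auto simp: E_def)
      moreover have "ev (L @ L') \<phi> \<longleftrightarrow> ev L \<phi> \<and> ev L' \<phi>" for \<phi>
        by (simp add: ev_def ball_Un)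
      ultimately show "a \<inter> b \<in> E"
        by (auto simp: E_def intro!: exI[of _ "L @ L'"])
    qed
    show "E \<subseteq> Pow (space (conf N))" by (auto simp: E_def)
    show "range (\<lambda>_. space (conf N)) \<subseteq> E"
      by (auto simp: E_def ev_def intro!: exI[of _ "[]"])
    fix X assume "X \<in> E"
    then obtain L where L: "\<forall>(B, k)\<in>set L. B \<in> sets N" and X: "X = {\<phi>\<in>space (conf N). ev L \<phi>}"
      by (auto simp: E_def)
    have "(\<integral>\<^sup>+\<phi>. of_bool (ev L \<phi>) \<partial>P) = (\<integral>\<^sup>+\<phi>. of_bool (ev L \<phi>) \<partial>Q)"
      using main[of "\<lambda>_. 1" L] L by simp
    moreover have "(\<integral>\<^sup>+\<phi>. of_bool (ev L \<phi>) \<partial>R) = emeasure R X" if "sets R = sets (conf N)" for R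
    proof -
      have "(\<integral>\<^sup>+\<phi>. of_bool (ev L \<phi>) \<partial>R) = (\<integral>\<^sup>+\<phi>. indicator X \<phi> \<partial>R)"
        using sets_eq_imp_space_eq[OF that] by (intro nn_integral_cong) (auto simp: X)
      also have "\<dots> = emeasure R X"
        using \<open>X \<in> E\<close> E_sets that by (intro nn_integral_indicator) auto
      finally show ?thesis .
    qed
    ultimately show "emeasure P X = emeasure Q X" using sets by simp
  qed (use sets fin sp sets_E in auto)
qed

section \<open>Symmetric functions of tuples\<close>

text \<open>The images of \<open>S\<close> under \<open>e\<close> and \<open>e'\<close> leave
  equally many elements of \<open>A\<close>, so a bijection between the remainders completes the
  map. Two placements of labels on points thus differ by a permutation of the points.\<close>

lemma permutes_extend:
  assumes "finite A" and "inj_on e S" "e ` S \<subseteq> A" and "inj_on e' S" "e' ` S \<subseteq> A"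
  obtains \<pi> where "\<pi> permutes A" "\<And>s. s \<in> S \<Longrightarrow> \<pi> (e s) = e' s"
proof -
  have "card (A - e ` S) = card (A - e' ` S)"
    using assms by (simp add: card_Diff_subset finite_subset card_image)
  then obtain f where f: "bij_betw f (A - e ` S) (A - e' ` S)"
    using finite_same_card_bij[of "A - e ` S" "A - e' ` S"] assms(1) by auto
  define \<pi> where "\<pi> x = (if x \<in> e ` S then e' (the_inv_into S e x) else if x \<in> A then f x else x)" for x
  have *: "\<pi> (e s) = e' s" if "s \<in> S" for s
    using that assms(2) by (simp add: \<pi>_def the_inv_into_f_f)
  have "bij_betw \<pi> (e ` S) (e' ` S)"
    unfolding bij_betw_def using * assms(2,4) by (auto simp: inj_on_def image_iff)
  moreover have "bij_betw \<pi> (A - e ` S) (A - e' ` S)"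
    using f by (rule bij_betw_cong[THEN iffD1, rotated]) (simp add: \<pi>_def)
  ultimately have "bij_betw \<pi> (e ` S \<union> (A - e ` S)) (e' ` S \<union> (A - e' ` S))"
    by (rule bij_betw_combine) auto
  then have "bij_betw \<pi> A A"
    using assms(3,5) by (simp add: Un_absorb1)
  then have "\<pi> permutes A"
    by (rule bij_imp_permutes) (use assms(3) in \<open>auto simp: \<pi>_def\<close>)
  then show ?thesis using * that by blast
qed

lemma space_PiM_permute:
  assumes "\<pi> permutes I" and "x \<in> space (Pi\<^sub>M I (\<lambda>_. N))"
  shows "x \<circ> \<pi> \<in> space (Pi\<^sub>M I (\<lambda>_. N))"
  using assms permutes_in_image[OF assms(1)]
  by (auto simp: space_PiM PiE_iff extensional_def permutes_def)

lemma measurable_PiM_permute: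
  assumes "\<pi> permutes I"
  shows "(\<lambda>x. x \<circ> \<pi>) \<in> Pi\<^sub>M I (\<lambda>_. N) \<rightarrow>\<^sub>M Pi\<^sub>M I (\<lambda>_. N)"
proof (rule measurable_PiM_single')
  fix i assume "i \<in> I"
  then have "\<pi> i \<in> I" using permutes_in_image[OF assms] by simp
  then show "(\<lambda>x. (x \<circ> \<pi>) i) \<in> Pi\<^sub>M I (\<lambda>_. N) \<rightarrow>\<^sub>M N"
    by simp
next
  show "(\<lambda>x. x \<circ> \<pi>) \<in> space (Pi\<^sub>M I (\<lambda>_. N)) \<rightarrow> (\<Pi>\<^sub>E i\<in>I. space N)"
    unfolding space_PiM[symmetric] by (intro funcsetI space_PiM_permute[OF assms])
qed

text \<open>Boxes suffice: permuting coordinates permutes the sides of a box, and the product of the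
  measures of its sides does not change.\<close>

lemma (in sigma_finite_measure) nn_integral_PiM_permute:
  assumes \<pi>: "\<pi> permutes I" and I: "finite I" and f: "f \<in> borel_measurable (Pi\<^sub>M I (\<lambda>_. M))"
  shows "(\<integral>\<^sup>+x. f (x \<circ> \<pi>) \<partial>Pi\<^sub>M I (\<lambda>_. M)) = (\<integral>\<^sup>+x. f x \<partial>Pi\<^sub>M I (\<lambda>_. M))"
proof -
  interpret product_sigma_finite "\<lambda>_. M" by standard
  let ?P = "Pi\<^sub>M I (\<lambda>_. M)"
  note [measurable] = measurable_PiM_permute[OF \<pi>]
  have "distr ?P ?P (\<lambda>x. x \<circ> \<pi>) = ?P"
  proof (rule PiM_eqI[OF I])
    fix A assume A: "\<And>i. i \<in> I \<Longrightarrow> A i \<in> sets M"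
    have inv: "inv \<pi> permutes I" by (rule permutes_inv[OF \<pi>])
    have A': "A (inv \<pi> i) \<in> sets M" if "i \<in> I" for i
      using A that permutes_in_image[OF inv] by auto
    have "(\<lambda>x. x \<circ> \<pi>) -` Pi\<^sub>E I A \<inter> space ?P = Pi\<^sub>E I (\<lambda>i. A (inv \<pi> i))"
    proof (intro equalityI subsetI)
      fix x assume x: "x \<in> (\<lambda>x. x \<circ> \<pi>) -` Pi\<^sub>E I A \<inter> space ?P"
      show "x \<in> Pi\<^sub>E I (\<lambda>i. A (inv \<pi> i))"
      proof (rule PiE_I)
        fix i assume "i \<in> I"
        then have "inv \<pi> i \<in> I" using permutes_in_image[OF inv] by simp
        with x have "x (\<pi> (inv \<pi> i)) \<in> A (inv \<pi> i)" by auto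
        then show "x i \<in> A (inv \<pi> i)" by (simp add: permutes_inverses[OF \<pi>])
      qed (use x in \<open>auto simp: space_PiM PiE_iff extensional_def\<close>)
    next
      fix x assume x: "x \<in> Pi\<^sub>E I (\<lambda>i. A (inv \<pi> i))"
      then have xs: "x \<in> space ?P"
        using sets.sets_into_space[OF A'] by (auto simp: space_PiM PiE_iff)
      have "(x \<circ> \<pi>) i \<in> A i" if "i \<in> I" for i
        using x permutes_in_image[OF \<pi>, of i] that
        by (auto simp: PiE_iff permutes_inverses[OF \<pi>] dest!: bspec[of _ _ "\<pi> i"])
      with space_PiM_permute[OF \<pi> xs] have "x \<circ> \<pi> \<in> Pi\<^sub>E I A"
        by (auto simp: space_PiM PiE_iff)
      with xs show "x \<in> (\<lambda>x. x \<circ> \<pi>) -` Pi\<^sub>E I A \<inter> space ?P" by auto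
    qed
    then have "emeasure (distr ?P ?P (\<lambda>x. x \<circ> \<pi>)) (Pi\<^sub>E I A) = emeasure ?P (Pi\<^sub>E I (\<lambda>i. A (inv \<pi> i)))"
      using A I by (subst emeasure_distr) (auto intro!: sets_PiM_I_finite)
    also have "\<dots> = (\<Prod>i\<in>I. emeasure M (A (inv \<pi> i)))"
      using I A' by (subst emeasure_PiM) auto
    also have "\<dots> = (\<Prod>i\<in>I. emeasure M (A i))"
      using prod.permute[OF inv, of "\<lambda>i. emeasure M (A i)"] by (simp add: o_def)
    finally show "emeasure (distr ?P ?P (\<lambda>x. x \<circ> \<pi>)) (Pi\<^sub>E I A) = (\<Prod>i\<in>I. emeasure M (A i))" .
  qed simp
  then have "(\<integral>\<^sup>+x. f x \<partial>?P) = (\<integral>\<^sup>+x. f x \<partial>distr ?P ?P (\<lambda>x. x \<circ> \<pi>))"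
    by simp
  also have "\<dots> = (\<integral>\<^sup>+x. f (x \<circ> \<pi>) \<partial>?P)"
    using f by (intro nn_integral_distr) auto
  finally show ?thesis by simp
qed

definition symmetric_on :: "nat \<Rightarrow> 'a measure \<Rightarrow> ((nat \<Rightarrow> 'a) \<Rightarrow> 'b) \<Rightarrow> bool" where
  "symmetric_on n N u \<longleftrightarrow>
     (\<forall>\<pi> x. \<pi> permutes {..<n} \<longrightarrow> x \<in> space (Pi\<^sub>M {..<n} (\<lambda>_. N)) \<longrightarrow> u (x \<circ> \<pi>) = u x)"

lemma prod_component_measurable:
  fixes G :: "'s \<Rightarrow> 'a \<Rightarrow> ennreal"
  assumes "\<And>s. s \<in> S \<Longrightarrow> G s \<in> borel_measurable N" and "e ` S \<subseteq> I"
  shows "(\<lambda>x. \<Prod>s\<in>S. G s (x (e s))) \<in> borel_measurable (Pi\<^sub>M I (\<lambda>_. N))"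
proof (rule borel_measurable_prod_ennreal)
  fix s assume "s \<in> S"
  then have "(\<lambda>x. x (e s)) \<in> Pi\<^sub>M I (\<lambda>_. N) \<rightarrow>\<^sub>M N"
    using assms(2) by (intro measurable_component_singleton) auto
  then show "(\<lambda>x. G s (x (e s))) \<in> borel_measurable (Pi\<^sub>M I (\<lambda>_. N))"
    using assms(1)[OF \<open>s \<in> S\<close>] by (rule measurable_compose)
qed

text \<open>By symmetry only the set of detected labels matters, not which of the \<open>n\<close> points they are assigned to.\<close>

lemma (in sigma_finite_measure) nn_integral_symmetric_assignment:
  fixes G :: "'s \<Rightarrow> 'a \<Rightarrow> ennreal"
  assumes u: "symmetric_on n M u" "u \<in> borel_measurable (Pi\<^sub>M {..<n} (\<lambda>_. M))"
    and G: "\<And>s. s \<in> S \<Longrightarrow> G s \<in> borel_measurable M"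
    and e: "inj_on e S" "e ` S \<subseteq> {..<n}" and e': "inj_on e' S" "e' ` S \<subseteq> {..<n}"
  shows "(\<integral>\<^sup>+x. u x * (\<Prod>s\<in>S. G s (x (e s))) \<partial>Pi\<^sub>M {..<n} (\<lambda>_. M)) =
         (\<integral>\<^sup>+x. u x * (\<Prod>s\<in>S. G s (x (e' s))) \<partial>Pi\<^sub>M {..<n} (\<lambda>_. M))"
proof -
  obtain \<pi> where \<pi>: "\<pi> permutes {..<n}" "\<And>s. s \<in> S \<Longrightarrow> \<pi> (e s) = e' s"
    using permutes_extend[OF finite_lessThan e e'] by blast
  have "(\<integral>\<^sup>+x. u x * (\<Prod>s\<in>S. G s (x (e s))) \<partial>Pi\<^sub>M {..<n} (\<lambda>_. M)) =
        (\<integral>\<^sup>+x. u (x \<circ> \<pi>) * (\<Prod>s\<in>S. G s ((x \<circ> \<pi>) (e s))) \<partial>Pi\<^sub>M {..<n} (\<lambda>_. M))"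
    using u(2) prod_component_measurable[OF G e(2)]
    by (intro nn_integral_PiM_permute[OF \<pi>(1) finite_lessThan, symmetric]) simp
  also have "\<dots> = (\<integral>\<^sup>+x. u x * (\<Prod>s\<in>S. G s (x (e' s))) \<partial>Pi\<^sub>M {..<n} (\<lambda>_. M))"
    using u(1) \<pi> by (intro nn_integral_cong) (auto simp: symmetric_on_def)
  finally show ?thesis .
qed

lemma bij_betw_sorted_list_of_set:
  "finite S \<Longrightarrow> bij_betw ((!) (sorted_list_of_set S)) {..<card S} S"
  by (rule bij_betw_nth) auto

text \<open>Removes the order from the defining formulas, where the i-th smallest label sits on the
  i-th point: every injective placement of the labels gives the same integral.\<close>

lemma (in sigma_finite_measure) nn_integral_symmetric_sorted:
  fixes G :: "nat \<Rightarrow> 'a \<Rightarrow> ennreal"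
  assumes u: "symmetric_on n M u" "u \<in> borel_measurable (Pi\<^sub>M {..<n} (\<lambda>_. M))"
    and S: "finite S" and G: "\<And>s. s \<in> S \<Longrightarrow> G s \<in> borel_measurable M"
    and e: "inj_on e S" "e ` S \<subseteq> {..<n}"
  shows "(\<integral>\<^sup>+x. u x * (\<Prod>i<card S. G (sorted_list_of_set S ! i) (x i)) \<partial>Pi\<^sub>M {..<n} (\<lambda>_. M)) =
         (\<integral>\<^sup>+x. u x * (\<Prod>s\<in>S. G s (x (e s))) \<partial>Pi\<^sub>M {..<n} (\<lambda>_. M))"
proof -
  let ?r = "(!) (sorted_list_of_set S)"
  note bij = bij_betw_sorted_list_of_set[OF S]
  have "card S \<le> n" using card_inj_on_le[OF e] by simp
  moreover have "inj_on (\<lambda>i. e (?r i)) {..<card S}"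
    using comp_inj_on[OF bij_betw_imp_inj_on[OF bij], of e] e(1) bij_betw_imp_surj_on[OF bij]
    by (simp add: o_def)
  moreover have "(\<lambda>i. e (?r i)) ` {..<card S} \<subseteq> {..<n}"
    using e(2) bij_betw_imp_surj_on[OF bij] by auto
  moreover have "G (?r i) \<in> borel_measurable M" if "i \<in> {..<card S}" for i
    using that G bij_betw_imp_surj_on[OF bij] by auto
  ultimately have "(\<integral>\<^sup>+x. u x * (\<Prod>i<card S. G (?r i) (x i)) \<partial>Pi\<^sub>M {..<n} (\<lambda>_. M)) =
         (\<integral>\<^sup>+x. u x * (\<Prod>i<card S. G (?r i) (x (e (?r i)))) \<partial>Pi\<^sub>M {..<n} (\<lambda>_. M))"
    by (intro nn_integral_symmetric_assignment[OF u, where G = "\<lambda>i. G (?r i)" and e = "\<lambda>i. i"]) auto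
  also have "\<dots> = (\<integral>\<^sup>+x. u x * (\<Prod>s\<in>S. G s (x (e s))) \<partial>Pi\<^sub>M {..<n} (\<lambda>_. M))"
    by (subst prod.reindex_bij_betw[OF bij, of "\<lambda>s. G s (_ (e s))"]) (rule refl)
  finally show ?thesis .
qed

section \<open>Association weights\<close>

text \<open>The common shape of the \<open>n\<close>-th summands of \<open>janossy_meas\<close> and \<open>Upsilon1\<close>; the function \<open>u\<close>
  need not be a Janossy density, which allows test functions of the hidden process to be absorbed into it.\<close>

definition assoc_weight ::
    "'a measure \<Rightarrow> real \<Rightarrow> ('a \<Rightarrow> 'a \<Rightarrow> real) \<Rightarrow> ('a \<Rightarrow> real) \<Rightarrow> nat \<Rightarrow> ((nat \<Rightarrow> 'a) \<Rightarrow> ennreal) \<Rightarrow>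
     nat \<Rightarrow> (nat \<Rightarrow> 'a) \<Rightarrow> ennreal" where
  "assoc_weight N p_d l_d l_c n u m z =
     (\<Sum>S | S \<subseteq> {..<m} \<and> card S \<le> n.
        (\<Prod>i\<in>{..<m} - S. ennreal (l_c (z i))) *
        ennreal ((1 - p_d) ^ (n - card S) / fact (n - card S)) *
        (\<integral>\<^sup>+ x. u x *
           (\<Prod>i<card S. ennreal (p_d * l_d (z (sorted_list_of_set S ! i)) (x i)))
           \<partial>Pi\<^sub>M {..<n} (\<lambda>_. N)))"

lemma sum_subsets_card_le:
  fixes f :: "nat \<Rightarrow> 'b::semiring_1"
  assumes "finite A"
  shows "(\<Sum>S | S \<subseteq> A \<and> card S \<le> n. f (card S)) = (\<Sum>k\<le>n. of_nat (card A choose k) * f k)"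
proof -
  have "(\<Sum>S | S \<subseteq> A \<and> card S \<le> n. f (card S)) =
      (\<Sum>k\<le>n. \<Sum>S\<in>{S \<in> {S. S \<subseteq> A \<and> card S \<le> n}. card S = k}. f (card S))"
    using assms by (intro sum.group[symmetric]) auto
  also have "\<dots> = (\<Sum>k\<le>n. of_nat (card A choose k) * f k)"
  proof (rule sum.cong[OF refl])
    fix k assume "k \<in> {..n}"
    then have "{S \<in> {S. S \<subseteq> A \<and> card S \<le> n}. card S = k} = {S. S \<subseteq> A \<and> card S = k}"
      by auto
    then show "(\<Sum>S\<in>{S \<in> {S. S \<subseteq> A \<and> card S \<le> n}. card S = k}. f (card S)) = of_nat (card A choose k) * f k"
      using n_subsets[OF assms, of k] by simp
  qed
  finally show ?thesis .
qed

text \<open>For \<open>m \<ge> k\<close> the term is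
  \<open>L ^ (m - k) / (fact (m - k) * fact k)\<close>, an exponential series shifted by
  \<open>k\<close>. It sums over the number of clutter points when \<open>k\<close> measurements are
  detections.\<close>

lemma suminf_binomial_exp:
  assumes "0 \<le> L"
  shows "(\<Sum>m. ennreal (1 / fact m) * (of_nat (m choose k) * ennreal L ^ (m - k))) = ennreal (exp L / fact k)"
proof -
  \<comment> \<open>Below \<open>k\<close> the binomial coefficient is 0, although truncated
    subtraction makes the power equal to 1.\<close>
  define f where "f m = (if m < k then 0 else L ^ (m - k) / fact (m - k) / fact k)" for m
  have "f m = real (m choose k) * L ^ (m - k) / fact m" for m
    by (cases "m < k") (auto simp: f_def binomial_fact)
  then have f: "ennreal (1 / fact m) * (of_nat (m choose k) * ennreal L ^ (m - k)) = ennreal (f m)" for m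
    using assms by (simp add: ennreal_power ennreal_of_nat_eq_real_of_nat ennreal_mult[symmetric])
  have "(\<lambda>i. f (i + k)) sums (exp L / fact k)"
    using sums_divide[OF exp_converges[of L], of "fact k"] by (simp add: f_def divide_inverse mult.commute)
  then have "f sums (exp L / fact k + (\<Sum>i<k. f i))"
    by (subst (asm) sums_iff_shift)
  then have "f sums (exp L / fact k)"
    by (simp add: f_def)
  moreover have "0 \<le> f m" for m using assms by (simp add: f_def)
  ultimately show ?thesis
    unfolding f by (subst suminf_ennreal2) (auto simp: sums_iff)
qed

text \<open>Detection and clutter alone. The identities for the weights concern arbitrary symmetric
  measurable \<open>u\<close>, so the hidden process enters only later.\<close>

locale detection_model = finite_measure N for N :: "'a measure" +
  fixes p_d :: real and l_d :: "'a \<Rightarrow> 'a \<Rightarrow> real" and l_c :: "'a \<Rightarrow> real"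
  assumes p_d: "0 \<le> p_d" "p_d \<le> 1"
    and l_d_measurable: "(\<lambda>(z, x). l_d z x) \<in> borel_measurable (N \<Otimes>\<^sub>M N)"
    and l_d_density: "\<And>x. x \<in> space N \<Longrightarrow> (\<integral>\<^sup>+ z. ennreal (l_d z x) \<partial>N) = 1"
    and l_c_nonneg: "\<And>z. z \<in> space N \<Longrightarrow> 0 \<le> l_c z"
    and l_c_integrable: "integrable N l_c"
begin

sublocale product_sigma_finite "\<lambda>_. N"
  by standard

abbreviation "weight \<equiv> assoc_weight N p_d l_d l_c"

abbreviation (input) "kern z x \<equiv> ennreal (p_d * l_d z x)"

lemma l_c_measurable [measurable]: "l_c \<in> borel_measurable N"
  using l_c_integrable by (rule borel_measurable_integrable)

lemma l_d_measurable' [measurable (raw)]: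
  assumes "f \<in> S \<rightarrow>\<^sub>M N" "g \<in> S \<rightarrow>\<^sub>M N"
  shows "(\<lambda>w. l_d (f w) (g w)) \<in> borel_measurable S"
  using measurable_compose[OF measurable_Pair[OF assms] l_d_measurable] by simp

lemma sigma_finite_PiM: "sigma_finite_measure (Pi\<^sub>M {..<n::nat} (\<lambda>_. N))"
  by (rule sigma_finite) simp

lemma sorted_nth_in:
  "S \<subseteq> {..<m::nat} \<Longrightarrow> i < card S \<Longrightarrow> sorted_list_of_set S ! i \<in> {..<m}"
  using bij_betw_imp_surj_on[OF bij_betw_sorted_list_of_set, of S] finite_subset[of S "{..<m}"] by auto

lemma kern_prod_measurable:
  fixes m :: nat
  assumes "S \<subseteq> {..<m}" "card S \<le> n"
  shows "(\<lambda>(z, x). \<Prod>i<card S. kern (z (sorted_list_of_set S ! i)) (x i))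
    \<in> borel_measurable (Pi\<^sub>M {..<m} (\<lambda>_. N) \<Otimes>\<^sub>M Pi\<^sub>M {..<n} (\<lambda>_. N))"
  unfolding case_prod_beta
proof (rule borel_measurable_prod_ennreal)
  fix i assume i: "i \<in> {..<card S}"
  have "(\<lambda>w. fst w (sorted_list_of_set S ! i)) \<in> Pi\<^sub>M {..<m} (\<lambda>_. N) \<Otimes>\<^sub>M Pi\<^sub>M {..<n} (\<lambda>_. N) \<rightarrow>\<^sub>M N"
    using sorted_nth_in[OF assms(1)] i
    by (intro measurable_compose[OF measurable_fst measurable_component_singleton]) auto
  moreover have "(\<lambda>w. snd w i) \<in> Pi\<^sub>M {..<m} (\<lambda>_. N) \<Otimes>\<^sub>M Pi\<^sub>M {..<n} (\<lambda>_. N) \<rightarrow>\<^sub>M N"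
    using i assms(2)
    by (intro measurable_compose[OF measurable_snd measurable_component_singleton]) auto
  ultimately show "(\<lambda>w. kern (fst w (sorted_list_of_set S ! i)) (snd w i))
      \<in> borel_measurable (Pi\<^sub>M {..<m} (\<lambda>_. N) \<Otimes>\<^sub>M Pi\<^sub>M {..<n} (\<lambda>_. N))"
    by measurable
qed

lemma clutter_prod_measurable:
  fixes m :: nat
  shows "(\<lambda>z. \<Prod>i\<in>{..<m} - S. ennreal (l_c (z i))) \<in> borel_measurable (Pi\<^sub>M {..<m} (\<lambda>_. N))"
  by measurable

lemma weight_term_measurable:
  fixes m :: nat
  assumes "S \<subseteq> {..<m}" "card S \<le> n" and [measurable]: "u \<in> borel_measurable (Pi\<^sub>M {..<n} (\<lambda>_. N))"
  shows "(\<lambda>z. \<integral>\<^sup>+ x. u x * (\<Prod>i<card S. kern (z (sorted_list_of_set S ! i)) (x i)) \<partial>Pi\<^sub>M {..<n} (\<lambda>_. N))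
    \<in> borel_measurable (Pi\<^sub>M {..<m} (\<lambda>_. N))"
proof -
  interpret Pn: sigma_finite_measure "Pi\<^sub>M {..<n} (\<lambda>_. N)" by (rule sigma_finite_PiM)
  note [measurable] = kern_prod_measurable[OF assms(1,2)]
  show ?thesis by measurable
qed

lemma weight_measurable:
  assumes [measurable]: "u \<in> borel_measurable (Pi\<^sub>M {..<n} (\<lambda>_. N))"
  shows "weight n u m \<in> borel_measurable (Pi\<^sub>M {..<m} (\<lambda>_. N))"
proof -
  have "(\<lambda>z. weight n u m z) \<in> borel_measurable (Pi\<^sub>M {..<m} (\<lambda>_. N))"
    unfolding assoc_weight_def
    by (intro borel_measurable_sum borel_measurable_times_ennreal weight_term_measurable clutter_prod_measurable
        borel_measurable_const assms) auto
  then show ?thesis by simp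
qed

text \<open>For fixed \<open>x\<close>, the integral over \<open>z\<close> factorizes over the
  labels: those outside \<open>S\<close> each give the clutter integral, and the i-th label of
  \<open>S\<close> gives the kernel integral at \<open>x i\<close>.\<close>

lemma nn_integral_weight_term:
  fixes m :: nat
  assumes [measurable]: "u \<in> borel_measurable (Pi\<^sub>M {..<n} (\<lambda>_. N))" "h \<in> borel_measurable N"
    and S: "S \<subseteq> {..<m}" "card S \<le> n"
  shows "(\<integral>\<^sup>+z. (\<Prod>i<m. h (z i)) * ((\<Prod>i\<in>{..<m} - S. ennreal (l_c (z i))) *
        (\<integral>\<^sup>+ x. u x * (\<Prod>i<card S. kern (z (sorted_list_of_set S ! i)) (x i)) \<partial>Pi\<^sub>M {..<n} (\<lambda>_. N)))
        \<partial>Pi\<^sub>M {..<m} (\<lambda>_. N)) =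
     (\<integral>\<^sup>+z. h z * ennreal (l_c z) \<partial>N) ^ (m - card S) *
     (\<integral>\<^sup>+x. u x * (\<Prod>i<card S. \<integral>\<^sup>+z. h z * kern z (x i) \<partial>N) \<partial>Pi\<^sub>M {..<n} (\<lambda>_. N))"
    (is "?lhs = ?L ^ _ * ?R")
proof -
  let ?Pm = "Pi\<^sub>M {..<m} (\<lambda>_. N)" and ?Pn = "Pi\<^sub>M {..<n} (\<lambda>_. N)" and ?r = "(!) (sorted_list_of_set S)"
  interpret Pm: sigma_finite_measure ?Pm by (rule sigma_finite_PiM)
  interpret Pn: sigma_finite_measure ?Pn by (rule sigma_finite_PiM)
  interpret pair_sigma_finite ?Pm ?Pn ..
  have fin: "finite S" using S(1) by (rule finite_subset) simp
  note bij = bij_betw_sorted_list_of_set[OF fin]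
  note [measurable] = kern_prod_measurable[OF S]
  have "?lhs = (\<integral>\<^sup>+z. \<integral>\<^sup>+x. u x * ((\<Prod>i<m. h (z i)) * (\<Prod>i\<in>{..<m} - S. ennreal (l_c (z i))) *
        (\<Prod>i<card S. kern (z (?r i)) (x i))) \<partial>?Pn \<partial>?Pm)"
  proof (rule nn_integral_cong)
    fix z assume z[measurable]: "z \<in> space ?Pm"
    have [measurable]: "(\<lambda>x. \<Prod>i<card S. kern (z (?r i)) (x i)) \<in> borel_measurable ?Pn"
      using measurable_compose[OF measurable_Pair1'[OF z] kern_prod_measurable[OF S]] by simp
    have "(\<integral>\<^sup>+x. u x * ((\<Prod>i<m. h (z i)) * (\<Prod>i\<in>{..<m} - S. ennreal (l_c (z i))) *
        (\<Prod>i<card S. kern (z (?r i)) (x i))) \<partial>?Pn) =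
      (\<integral>\<^sup>+x. (\<Prod>i<m. h (z i)) * (\<Prod>i\<in>{..<m} - S. ennreal (l_c (z i))) *
        (u x * (\<Prod>i<card S. kern (z (?r i)) (x i))) \<partial>?Pn)"
      by (intro nn_integral_cong) (simp only: mult.left_commute)
    also have "\<dots> = (\<Prod>i<m. h (z i)) * (\<Prod>i\<in>{..<m} - S. ennreal (l_c (z i))) *
        (\<integral>\<^sup>+ x. u x * (\<Prod>i<card S. kern (z (?r i)) (x i)) \<partial>?Pn)"
      by (rule nn_integral_cmult) measurable
    finally show "(\<Prod>i<m. h (z i)) * ((\<Prod>i\<in>{..<m} - S. ennreal (l_c (z i))) *
        (\<integral>\<^sup>+ x. u x * (\<Prod>i<card S. kern (z (?r i)) (x i)) \<partial>?Pn)) =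
      (\<integral>\<^sup>+x. u x * ((\<Prod>i<m. h (z i)) * (\<Prod>i\<in>{..<m} - S. ennreal (l_c (z i))) *
        (\<Prod>i<card S. kern (z (?r i)) (x i))) \<partial>?Pn)"
      by (simp only: mult.assoc)
  qed
  also have "\<dots> = (\<integral>\<^sup>+x. \<integral>\<^sup>+z. u x * ((\<Prod>i<m. h (z i)) * (\<Prod>i\<in>{..<m} - S. ennreal (l_c (z i))) *
        (\<Prod>i<card S. kern (z (?r i)) (x i))) \<partial>?Pm \<partial>?Pn)"
    by (rule Fubini'[symmetric]) measurable
  also have "\<dots> = (\<integral>\<^sup>+x. u x * (?L ^ (m - card S) * (\<Prod>i<card S. \<integral>\<^sup>+z. h z * kern z (x i) \<partial>N)) \<partial>?Pn)"
  proof (rule nn_integral_cong)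
    fix x assume x: "x \<in> space ?Pn"
    \<comment> \<open>The factor of label \<open>s\<close>. For \<open>s\<close> in
      \<open>S\<close>, inverting the sorted enumeration finds the point from which
      \<open>z s\<close> originates.\<close>
    define g where "g s = (if s \<in> S then (\<lambda>z. h z * kern z (x (the_inv_into {..<card S} ?r s)))
      else (\<lambda>z. h z * ennreal (l_c z)))" for s
    have xi [measurable]: "x i \<in> space N" if "i < card S" for i
      using x that S(2) by (auto simp: space_PiM PiE_iff)
    have inv: "the_inv_into {..<card S} ?r s < card S" if "s \<in> S" for s
      using bij_betw_apply[OF bij_betw_the_inv_into[OF bij] that] by simp
    have g_meas: "g s \<in> borel_measurable N" for s
      using xi inv by (cases "s \<in> S") (simp_all add: g_def)
    have inv_r: "the_inv_into {..<card S} ?r (?r i) = i" and r_in: "?r i \<in> S" if "i < card S" for i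
      using the_inv_into_f_f[OF bij_betw_imp_inj_on[OF bij]] bij_betw_apply[OF bij] that by auto
    have split: "(\<Prod>s<m. f s) = (\<Prod>i\<in>{..<m} - S. f i) * (\<Prod>i<card S. f (?r i))" for f :: "nat \<Rightarrow> ennreal"
      using prod.subset_diff[OF S(1), of f] prod.reindex_bij_betw[OF bij, of f] by simp
    have "(\<integral>\<^sup>+z. u x * ((\<Prod>i<m. h (z i)) * (\<Prod>i\<in>{..<m} - S. ennreal (l_c (z i))) *
        (\<Prod>i<card S. kern (z (?r i)) (x i))) \<partial>?Pm) = (\<integral>\<^sup>+z. u x * (\<Prod>s<m. g s (z s)) \<partial>?Pm)"
    proof (intro nn_integral_cong arg_cong2[where f = "(*)"] refl)
      fix z
      show "(\<Prod>i<m. h (z i)) * (\<Prod>i\<in>{..<m} - S. ennreal (l_c (z i))) * (\<Prod>i<card S. kern (z (?r i)) (x i)) =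
        (\<Prod>s<m. g s (z s))"
        unfolding split by (simp add: g_def inv_r r_in prod.distrib ac_simps)
    qed
    also have "\<dots> = u x * (\<integral>\<^sup>+z. (\<Prod>s<m. g s (z s)) \<partial>?Pm)"
      by (rule nn_integral_cmult) (intro prod_component_measurable g_meas, simp)
    also have "(\<integral>\<^sup>+z. (\<Prod>s<m. g s (z s)) \<partial>?Pm) = (\<Prod>s<m. \<integral>\<^sup>+z. g s z \<partial>N)"
      by (rule product_nn_integral_prod) (simp_all add: g_meas)
    also have "\<dots> = ?L ^ (m - card S) * (\<Prod>i<card S. \<integral>\<^sup>+z. h z * kern z (x i) \<partial>N)"
      unfolding split using S(1) fin by (simp add: g_def inv_r r_in card_Diff_subset)
    finally show "(\<integral>\<^sup>+z. u x * ((\<Prod>i<m. h (z i)) * (\<Prod>i\<in>{..<m} - S. ennreal (l_c (z i))) *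
        (\<Prod>i<card S. kern (z (?r i)) (x i))) \<partial>?Pm) =
       u x * (?L ^ (m - card S) * (\<Prod>i<card S. \<integral>\<^sup>+z. h z * kern z (x i) \<partial>N))" .
  qed
  also have "\<dots> = ?L ^ (m - card S) * ?R"
  proof -
    have "(\<lambda>x. \<Prod>i<card S. \<integral>\<^sup>+z. h z * kern z (x i) \<partial>N) \<in> borel_measurable ?Pn"
      using S(2) by (intro prod_component_measurable) auto
    then show ?thesis
      by (subst nn_integral_cmult[symmetric]) (auto simp: ac_simps)
  qed
  finally show ?thesis .
qed

text \<open>After integration over \<open>z\<close> a summand depends on \<open>S\<close> only
  through \<open>card S\<close>, hence the binomial coefficient.\<close>

lemma nn_integral_weight:
  assumes [measurable]: "u \<in> borel_measurable (Pi\<^sub>M {..<n} (\<lambda>_. N))" "h \<in> borel_measurable N"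
  shows "(\<integral>\<^sup>+z. (\<Prod>i<m. h (z i)) * weight n u m z \<partial>Pi\<^sub>M {..<m} (\<lambda>_. N)) =
     (\<Sum>k\<le>n. of_nat (m choose k) * (ennreal ((1 - p_d) ^ (n - k) / fact (n - k)) *
        ((\<integral>\<^sup>+z. h z * ennreal (l_c z) \<partial>N) ^ (m - k) *
         (\<integral>\<^sup>+x. u x * (\<Prod>i<k. \<integral>\<^sup>+z. h z * kern z (x i) \<partial>N) \<partial>Pi\<^sub>M {..<n} (\<lambda>_. N)))))"
    (is "?lhs = (\<Sum>k\<le>n. _ * ?f k)")
proof -
  let ?Pm = "Pi\<^sub>M {..<m} (\<lambda>_. N)" and ?Pn = "Pi\<^sub>M {..<n} (\<lambda>_. N)"
  let ?t = "\<lambda>S z. (\<Prod>i<m. h (z i)) * ((\<Prod>i\<in>{..<m} - S. ennreal (l_c (z i))) *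
        (\<integral>\<^sup>+ x. u x * (\<Prod>i<card S. kern (z (sorted_list_of_set S ! i)) (x i)) \<partial>?Pn))"
  have t: "?t S \<in> borel_measurable ?Pm" if "S \<subseteq> {..<m}" "card S \<le> n" for S
    using that by (intro borel_measurable_times_ennreal prod_component_measurable weight_term_measurable
        clutter_prod_measurable) auto
  have "?lhs = (\<integral>\<^sup>+z. (\<Sum>S | S \<subseteq> {..<m} \<and> card S \<le> n.
      ennreal ((1 - p_d) ^ (n - card S) / fact (n - card S)) * ?t S z) \<partial>?Pm)"
    unfolding assoc_weight_def by (simp add: sum_distrib_left ac_simps)
  also have "\<dots> = (\<Sum>S | S \<subseteq> {..<m} \<and> card S \<le> n.
      ennreal ((1 - p_d) ^ (n - card S) / fact (n - card S)) * (\<integral>\<^sup>+z. ?t S z \<partial>?Pm))"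
    using t by (subst nn_integral_sum) (auto simp: nn_integral_cmult)
  also have "\<dots> = (\<Sum>S | S \<subseteq> {..<m} \<and> card S \<le> n. ?f (card S))"
    by (intro sum.cong refl) (auto simp: nn_integral_weight_term)
  also have "\<dots> = (\<Sum>k\<le>n. of_nat (m choose k) * ?f k)"
    by (subst sum_subsets_card_le) auto
  finally show ?thesis .
qed

text \<open>The expansion runs over sets of detected points rather than of labels. By symmetry of
  \<open>u\<close> every set of size \<open>k\<close> contributes as the first \<open>k\<close>
  points do.\<close>

lemma nn_integral_prod_binomial:
  fixes q :: ennreal
  assumes u: "symmetric_on n N u" "u \<in> borel_measurable (Pi\<^sub>M {..<n} (\<lambda>_. N))"
    and H: "H \<in> borel_measurable N"
  shows "(\<integral>\<^sup>+x. u x * (\<Prod>i<n. q + H (x i)) \<partial>Pi\<^sub>M {..<n} (\<lambda>_. N)) =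
    (\<Sum>k\<le>n. of_nat (n choose k) * (q ^ (n - k) * (\<integral>\<^sup>+x. u x * (\<Prod>i<k. H (x i)) \<partial>Pi\<^sub>M {..<n} (\<lambda>_. N))))"
proof -
  let ?P = "Pi\<^sub>M {..<n} (\<lambda>_. N)"
  have meas: "(\<lambda>x. u x * (\<Prod>i\<in>S. H (x i))) \<in> borel_measurable ?P" if "S \<subseteq> {..<n}" for S
    using u(2) H that by (intro borel_measurable_times_ennreal prod_component_measurable) auto
  have "(\<integral>\<^sup>+x. u x * (\<Prod>i<n. q + H (x i)) \<partial>?P) =
      (\<integral>\<^sup>+x. (\<Sum>S\<in>Pow {..<n}. q ^ (n - card S) * (u x * (\<Prod>i\<in>S. H (x i)))) \<partial>?P)"
  proof (rule nn_integral_cong)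
    fix x
    have "(\<Prod>i<n. q + H (x i)) = (\<Prod>i<n. H (x i) + q)"
      by (simp add: add.commute)
    also have "\<dots> = (\<Sum>S\<in>Pow {..<n}. (\<Prod>i\<in>S. H (x i)) * q ^ (n - card S))"
      by (subst prod_add) (auto simp: card_Diff_subset finite_subset intro!: sum.cong)
    finally show "u x * (\<Prod>i<n. q + H (x i)) =
        (\<Sum>S\<in>Pow {..<n}. q ^ (n - card S) * (u x * (\<Prod>i\<in>S. H (x i))))"
      by (simp add: sum_distrib_left ac_simps)
  qed
  also have "\<dots> = (\<Sum>S\<in>Pow {..<n}. q ^ (n - card S) * (\<integral>\<^sup>+x. u x * (\<Prod>i\<in>S. H (x i)) \<partial>?P))"
    using meas by (subst nn_integral_sum) (auto simp: nn_integral_cmult)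
  also have "\<dots> = (\<Sum>S\<in>Pow {..<n}. q ^ (n - card S) * (\<integral>\<^sup>+x. u x * (\<Prod>i<card S. H (x i)) \<partial>?P))"
    using nn_integral_symmetric_sorted[OF u, where G = "\<lambda>_. H" and e = "\<lambda>s. s"] H
    by (intro sum.cong refl) (auto simp: finite_subset)
  also have "Pow {..<n} = {S. S \<subseteq> {..<n} \<and> card S \<le> n}"
    using card_mono[of "{..<n}"] by auto
  also have "(\<Sum>S | S \<subseteq> {..<n} \<and> card S \<le> n. q ^ (n - card S) * (\<integral>\<^sup>+x. u x * (\<Prod>i<card S. H (x i)) \<partial>?P)) =
      (\<Sum>k\<le>n. of_nat (n choose k) * (q ^ (n - k) * (\<integral>\<^sup>+x. u x * (\<Prod>i<k. H (x i)) \<partial>?P)))"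
    using sum_subsets_card_le[of "{..<n}" "\<lambda>k. q ^ (n - k) * (\<integral>\<^sup>+x. u x * (\<Prod>i<k. H (x i)) \<partial>?P)" n]
    by simp
  finally show ?thesis .
qed

text \<open>Summing over \<open>m\<close> turns the choice of \<open>k\<close> detection labels into
  \<open>exp L / fact k\<close>. With the factor \<open>1 / fact (n - k)\<close> of the weight this
  is \<open>exp L * (n choose k) / fact n\<close>, and the binomial expansion over the points closes
  up into the product. The exponential remains because the weight omits the Poisson
  normalization.\<close>

lemma weight_generating_function:
  assumes u: "symmetric_on n N u" "u \<in> borel_measurable (Pi\<^sub>M {..<n} (\<lambda>_. N))"
    and h[measurable]: "h \<in> borel_measurable N" and L: "0 \<le> L" "(\<integral>\<^sup>+z. h z * ennreal (l_c z) \<partial>N) = ennreal L"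
  shows "(\<Sum>m. ennreal (1 / fact m) * (\<integral>\<^sup>+z. (\<Prod>i<m. h (z i)) * weight n u m z \<partial>Pi\<^sub>M {..<m} (\<lambda>_. N))) =
    ennreal (exp L) * (ennreal (1 / fact n) *
      (\<integral>\<^sup>+x. u x * (\<Prod>i<n. ennreal (1 - p_d) + (\<integral>\<^sup>+z. h z * kern z (x i) \<partial>N)) \<partial>Pi\<^sub>M {..<n} (\<lambda>_. N)))"
proof -
  let ?P = "Pi\<^sub>M {..<n} (\<lambda>_. N)"
  define a where "a k = (\<integral>\<^sup>+x. u x * (\<Prod>i<k. \<integral>\<^sup>+z. h z * kern z (x i) \<partial>N) \<partial>?P)" for k
  define c where "c k = ennreal ((1 - p_d) ^ (n - k) / fact (n - k))" for k
  have "(\<Sum>m. ennreal (1 / fact m) * (\<integral>\<^sup>+z. (\<Prod>i<m. h (z i)) * weight n u m z \<partial>Pi\<^sub>M {..<m} (\<lambda>_. N))) =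
      (\<Sum>m. \<Sum>k\<le>n. (ennreal (1 / fact m) * (of_nat (m choose k) * ennreal L ^ (m - k))) * (c k * a k))"
    unfolding nn_integral_weight[OF u(2) h] L(2) a_def[symmetric] c_def[symmetric]
    by (simp add: sum_distrib_left ac_simps)
  also have "\<dots> = (\<Sum>k\<le>n. \<Sum>m. (ennreal (1 / fact m) * (of_nat (m choose k) * ennreal L ^ (m - k))) * (c k * a k))"
    by (rule suminf_sum) (rule summableI)
  also have "\<dots> = (\<Sum>k\<le>n. ennreal (exp L / fact k) * (c k * a k))"
    by (simp only: ennreal_suminf_multc suminf_binomial_exp[OF L(1)])
  also have "\<dots> = (\<Sum>k\<le>n. ennreal (exp L) * (ennreal (1 / fact n) *
      (of_nat (n choose k) * (ennreal (1 - p_d) ^ (n - k) * a k))))"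
  proof (rule sum.cong[OF refl])
    fix k assume "k \<in> {..n}"
    then have "exp L / fact k * ((1 - p_d) ^ (n - k) / fact (n - k)) =
        exp L * (1 / fact n * (real (n choose k) * (1 - p_d) ^ (n - k)))"
      by (simp add: binomial_fact)
    then have "ennreal (exp L / fact k) * c k =
        ennreal (exp L) * (ennreal (1 / fact n) * (of_nat (n choose k) * ennreal (1 - p_d) ^ (n - k)))"
      using p_d unfolding c_def
      by (simp add: ennreal_mult[symmetric] ennreal_power ennreal_of_nat_eq_real_of_nat)
    then show "ennreal (exp L / fact k) * (c k * a k) =
        ennreal (exp L) * (ennreal (1 / fact n) * (of_nat (n choose k) * (ennreal (1 - p_d) ^ (n - k) * a k)))"
      by (simp add: mult.assoc[symmetric])
  qed
  also have "\<dots> = ennreal (exp L) * (ennreal (1 / fact n) *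
      (\<integral>\<^sup>+x. u x * (\<Prod>i<n. ennreal (1 - p_d) + (\<integral>\<^sup>+z. h z * kern z (x i) \<partial>N)) \<partial>?P))"
    by (subst nn_integral_prod_binomial[OF u]) (simp_all add: a_def sum_distrib_left)
  finally show ?thesis .
qed

end

section \<open>Ranks, relabelling and removal of measurements\<close>

text \<open>The position of an element in the increasing enumeration of \<open>S\<close>. It turns
  products over positions into products over labels, which are easier to reindex.\<close>

definition rank_in :: "nat set \<Rightarrow> nat \<Rightarrow> nat" where
  "rank_in S = the_inv_into {..<card S} ((!) (sorted_list_of_set S))"

lemma bij_betw_rank_in: "finite S \<Longrightarrow> bij_betw (rank_in S) S {..<card S}"
  unfolding rank_in_def by (rule bij_betw_the_inv_into[OF bij_betw_sorted_list_of_set])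

lemma prod_sorted_list_of_set:
  assumes "finite S"
  shows "(\<Prod>i<card S. f (sorted_list_of_set S ! i) i) = (\<Prod>s\<in>S. f s (rank_in S s))"
proof -
  note bij = bij_betw_sorted_list_of_set[OF assms]
  have "(\<Prod>s\<in>S. f s (rank_in S s)) =
      (\<Prod>i<card S. f (sorted_list_of_set S ! i) (rank_in S (sorted_list_of_set S ! i)))"
    by (rule prod.reindex_bij_betw[OF bij, symmetric])
  also have "\<dots> = (\<Prod>i<card S. f (sorted_list_of_set S ! i) i)"
    unfolding rank_in_def using bij_betw_imp_inj_on[OF bij]
    by (intro prod.cong refl) (simp add: the_inv_into_f_f)
  finally show ?thesis by simp
qed

lemma sorted_list_of_set_image:
  fixes f :: "'b::linorder \<Rightarrow> 'c::linorder"
  assumes "finite A" "strict_mono f"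
  shows "sorted_list_of_set (f ` A) = map f (sorted_list_of_set A)"
proof -
  have "sorted_wrt (<) (map f (sorted_list_of_set A))"
    unfolding sorted_wrt_map
    by (rule sorted_wrt_mono_rel[OF _ strict_sorted_list_of_set])
       (simp add: strict_mono_less[OF assms(2)])
  moreover have "card (f ` A) = card A"
    using strict_mono_imp_inj_on[OF assms(2)] by (intro card_image) (auto intro: inj_on_subset)
  ultimately show ?thesis
    using assms(1) sorted_list_of_set_unique[of "f ` A" "map f (sorted_list_of_set A)"] by simp
qed

text \<open>The increasing injection that misses \<open>r\<close> (a coface map). On its index range
  \<open>omit_entry m r z\<close> is \<open>z\<close> composed with it.\<close>

definition skip :: "nat \<Rightarrow> nat \<Rightarrow> nat" where
  "skip r i = (if i < r then i else Suc i)"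

lemma strict_mono_skip: "strict_mono (skip r)"
  by (auto simp: strict_mono_def skip_def)

lemma skip_image:
  assumes "r < m"
  shows "skip r ` {..<m - 1} = {..<m} - {r}"
proof (intro equalityI subsetI)
  fix x assume x: "x \<in> {..<m} - {r}"
  show "x \<in> skip r ` {..<m - 1}"
  proof (cases "x < r")
    case True
    with assms show ?thesis by (intro image_eqI[of _ _ x]) (auto simp: skip_def)
  next
    case False
    with x show ?thesis by (intro image_eqI[of _ _ "x - 1"]) (auto simp: skip_def)
  qed
qed (use assms in \<open>auto simp: skip_def\<close>)

context detection_model
begin

text \<open>The summand at \<open>S\<close> for the permuted tuple is the summand at the image of
  \<open>S\<close> for the original one. The permutation disturbs the sorted order of the labels,
  which is harmless because \<open>u\<close> is symmetric.\<close>

lemma weight_permute: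
  assumes u: "symmetric_on n N u" "u \<in> borel_measurable (Pi\<^sub>M {..<n} (\<lambda>_. N))"
  shows "symmetric_on m N (weight n u m)"
  unfolding symmetric_on_def
proof (intro allI impI)
  fix \<pi> z assume \<pi>: "\<pi> permutes {..<m}" and z: "z \<in> space (Pi\<^sub>M {..<m} (\<lambda>_. N))"
  let ?P = "Pi\<^sub>M {..<n} (\<lambda>_. N)"
  have zN: "z i \<in> space N" if "i < m" for i
    using z that by (auto simp: space_PiM PiE_iff)
  have inj: "inj_on \<pi> A" for A
    using permutes_inj[OF \<pi>] by (rule inj_on_subset) simp
  have inv: "inv \<pi> permutes {..<m}" by (rule permutes_inv[OF \<pi>])
  define A where "A = {S. S \<subseteq> {..<m} \<and> card S \<le> n}"
  define f where "f z S = (\<Prod>i\<in>{..<m} - S. ennreal (l_c (z i))) *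
      ennreal ((1 - p_d) ^ (n - card S) / fact (n - card S)) *
      (\<integral>\<^sup>+ x. u x * (\<Prod>i<card S. kern (z (sorted_list_of_set S ! i)) (x i)) \<partial>?P)" for z :: "nat \<Rightarrow> 'a" and S
  have f: "f (z \<circ> \<pi>) S = f z (\<pi> ` S)" if S: "S \<in> A" for S
  proof -
    have fin: "finite S" and sub: "S \<subseteq> {..<m}" and card: "card (\<pi> ` S) = card S" "card S \<le> n"
      using S by (auto simp: A_def finite_subset card_image[OF inj])
    have sub': "\<pi> ` S \<subseteq> {..<m}" using sub permutes_in_image[OF \<pi>] by auto
    have "(\<Prod>i\<in>{..<m} - \<pi> ` S. ennreal (l_c (z i))) = (\<Prod>i\<in>\<pi> ` ({..<m} - S). ennreal (l_c (z i)))"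
      using permutes_image[OF \<pi>] by (simp add: image_set_diff[OF permutes_inj[OF \<pi>]])
    then have 1: "(\<Prod>i\<in>{..<m} - \<pi> ` S. ennreal (l_c (z i))) = (\<Prod>i\<in>{..<m} - S. ennreal (l_c ((z \<circ> \<pi>) i)))"
      by (simp add: prod.reindex[OF inj])
    have rank: "bij_betw (rank_in S) S {..<card S}" by (rule bij_betw_rank_in[OF fin])
    \<comment> \<open>A label of the image is placed at the rank of its preimage in
      \<open>S\<close>, not at its own rank; this placement matches the permuted tuple.\<close>
    have inj_e: "inj_on (rank_in S \<circ> inv \<pi>) (\<pi> ` S)"
      using bij_betw_imp_inj_on[OF rank] permutes_inverses[OF \<pi>] by (auto simp: inj_on_def)
    have im_e: "(rank_in S \<circ> inv \<pi>) ` (\<pi> ` S) \<subseteq> {..<n}"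
      using bij_betw_imp_surj_on[OF rank] permutes_inverses[OF \<pi>] card(2) by (auto simp: image_image)
    have meas: "kern (z s) \<in> borel_measurable N" if "s \<in> \<pi> ` S" for s
      using zN[of s] that sub' by auto
    have "(\<integral>\<^sup>+ x. u x * (\<Prod>i<card (\<pi> ` S). kern (z (sorted_list_of_set (\<pi> ` S) ! i)) (x i)) \<partial>?P) =
        (\<integral>\<^sup>+ x. u x * (\<Prod>s\<in>\<pi> ` S. kern (z s) (x ((rank_in S \<circ> inv \<pi>) s))) \<partial>?P)"
      by (rule nn_integral_symmetric_sorted[OF u finite_imageI[OF fin] meas inj_e im_e])
    also have "\<dots> = (\<integral>\<^sup>+ x. u x * (\<Prod>i<card S. kern ((z \<circ> \<pi>) (sorted_list_of_set S ! i)) (x i)) \<partial>?P)"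
      using permutes_inverses[OF \<pi>]
      by (simp add: prod.reindex[OF inj] prod_sorted_list_of_set[OF fin, of "\<lambda>s i. kern (z (\<pi> s)) (_ i)"])
    finally show ?thesis
      unfolding f_def 1 card by simp
  qed
  have "weight n u m (z \<circ> \<pi>) = (\<Sum>S\<in>A. f (z \<circ> \<pi>) S)"
    by (simp add: assoc_weight_def f_def A_def)
  also have "\<dots> = (\<Sum>S\<in>A. f z S)"
  proof (rule sum.reindex_bij_witness[where i = "(`) (inv \<pi>)" and j = "(`) \<pi>"])
    fix S assume S: "S \<in> A"
    show "inv \<pi> ` \<pi> ` S = S" "\<pi> ` inv \<pi> ` S = S"
      using permutes_inverses[OF \<pi>] by (auto simp: image_image)
    have img: "\<rho> ` S \<in> A" if \<rho>: "\<rho> permutes {..<m}" for \<rho>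
    proof -
      have "card (\<rho> ` S) = card S"
        by (intro card_image inj_on_subset[OF permutes_inj[OF \<rho>]]) simp
      moreover have "\<rho> ` S \<subseteq> \<rho> ` {..<m}" using S by (auto simp: A_def)
      ultimately show ?thesis using S by (simp add: A_def permutes_image[OF \<rho>])
    qed
    show "\<pi> ` S \<in> A" "inv \<pi> ` S \<in> A" by (rule img[OF \<pi>] img[OF inv])+
    show "f z (\<pi> ` S) = f (z \<circ> \<pi>) S" using f[OF S] by simp
  qed
  also have "\<dots> = weight n u m z"
    by (simp add: assoc_weight_def f_def A_def)
  finally show "weight n u m (z \<circ> \<pi>) = weight n u m z" .
qed

text \<open>\<open>skip r\<close> preserves order, so labels keep their ranks. Subsets of the
  original labels that avoid \<open>r\<close> are what is left when a detected label
  \<open>r\<close> is removed from \<open>S\<close>.\<close>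

lemma weight_omit_entry:
  assumes r: "r < m"
  shows "weight p u (m - 1) (omit_entry m r z) =
    (\<Sum>S | S \<subseteq> {..<m} - {r} \<and> card S \<le> p.
        (\<Prod>i\<in>{..<m} - {r} - S. ennreal (l_c (z i))) *
        ennreal ((1 - p_d) ^ (p - card S) / fact (p - card S)) *
        (\<integral>\<^sup>+ x. u x * (\<Prod>i<card S. kern (z (sorted_list_of_set S ! i)) (x i)) \<partial>Pi\<^sub>M {..<p} (\<lambda>_. N)))"
  (is "_ = sum ?f ?A")
proof -
  let ?w = "omit_entry m r z"
  have w: "?w i = z (skip r i)" if "i < m - 1" for i
    using that by (simp add: omit_entry_def skip_def)
  have inj: "inj_on (skip r) S" for S
    by (rule strict_mono_imp_inj_on[OF strict_mono_skip])
  note card = card_image[OF inj]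
  have "bij_betw ((`) (skip r)) {S. S \<subseteq> {..<m - 1} \<and> card S \<le> p} ?A"
  proof (rule bij_betw_imageI)
    show "inj_on ((`) (skip r)) {S. S \<subseteq> {..<m - 1} \<and> card S \<le> p}"
      using inj[of UNIV] by (auto simp: inj_on_def inj_image_eq_iff)
    show "(`) (skip r) ` {S. S \<subseteq> {..<m - 1} \<and> card S \<le> p} = ?A"
    proof (intro equalityI subsetI)
      fix S assume S: "S \<in> ?A"
      then obtain T where "T \<subseteq> {..<m - 1}" "S = skip r ` T"
        using skip_image[OF r] by (metis (no_types, lifting) mem_Collect_eq subset_imageE)
      then show "S \<in> (`) (skip r) ` {S. S \<subseteq> {..<m - 1} \<and> card S \<le> p}"
        using S card by auto
    qed (use card skip_image[OF r] in auto)
  qed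
  then have "sum ?f ?A = (\<Sum>S | S \<subseteq> {..<m - 1} \<and> card S \<le> p. ?f (skip r ` S))"
    by (rule sum.reindex_bij_betw[symmetric])
  also have "\<dots> = weight p u (m - 1) ?w"
    unfolding assoc_weight_def
  proof (intro sum.cong refl)
    fix S assume "S \<in> {S. S \<subseteq> {..<m - 1} \<and> card S \<le> p}"
    then have S: "S \<subseteq> {..<m - 1}" and fin: "finite S" by (auto simp: finite_subset)
    have "{..<m} - {r} - skip r ` S = skip r ` ({..<m - 1} - S)"
      using skip_image[OF r] by (simp add: image_set_diff[OF inj])
    then have 1: "(\<Prod>i\<in>{..<m} - {r} - skip r ` S. ennreal (l_c (z i))) = (\<Prod>i\<in>{..<m - 1} - S. ennreal (l_c (?w i)))"
      by (simp add: prod.reindex[OF inj] w)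
    have "z (sorted_list_of_set (skip r ` S) ! i) = ?w (sorted_list_of_set S ! i)" if "i < card S" for i
      using that sorted_nth_in[OF S that] fin w
      by (simp add: sorted_list_of_set_image[OF fin strict_mono_skip])
    then show "?f (skip r ` S) = (\<Prod>i\<in>{..<m - 1} - S. ennreal (l_c (?w i))) *
        ennreal ((1 - p_d) ^ (p - card S) / fact (p - card S)) *
        (\<integral>\<^sup>+ x. u x * (\<Prod>i<card S. kern (?w (sorted_list_of_set S ! i)) (x i)) \<partial>Pi\<^sub>M {..<p} (\<lambda>_. N))"
      unfolding 1 card by simp
  qed
  finally show ?thesis by simp
qed

section \<open>Splitting off one hidden point\<close>

lemma fun_upd_measurable:
  "(\<lambda>(x, y). y(p := x)) \<in> N \<Otimes>\<^sub>M Pi\<^sub>M {..<p} (\<lambda>_. N) \<rightarrow>\<^sub>M Pi\<^sub>M {..<Suc p} (\<lambda>_. N)"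
  unfolding case_prod_beta
  by (rule measurable_fun_upd[where J = "{..<p}"]) (auto simp: lessThan_Suc)

text \<open>A permutation of the first \<open>p\<close> indices fixes \<open>p\<close>, so it
  commutes with setting the last coordinate.\<close>

lemma fun_upd_symmetric:
  assumes v: "symmetric_on (Suc p) N v" "v \<in> borel_measurable (Pi\<^sub>M {..<Suc p} (\<lambda>_. N))" and x: "x \<in> space N"
  shows "symmetric_on p N (\<lambda>y. v (y(p := x)))" "(\<lambda>y. v (y(p := x))) \<in> borel_measurable (Pi\<^sub>M {..<p} (\<lambda>_. N))"
proof -
  have upd: "(\<lambda>y. y(p := x)) \<in> Pi\<^sub>M {..<p} (\<lambda>_. N) \<rightarrow>\<^sub>M Pi\<^sub>M {..<Suc p} (\<lambda>_. N)"
    using measurable_compose[OF measurable_Pair1'[OF x] fun_upd_measurable] by simp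
  then show "(\<lambda>y. v (y(p := x))) \<in> borel_measurable (Pi\<^sub>M {..<p} (\<lambda>_. N))"
    using v(2) by (rule measurable_compose)
  show "symmetric_on p N (\<lambda>y. v (y(p := x)))"
    unfolding symmetric_on_def
  proof (intro allI impI)
    fix \<pi> y assume \<pi>: "\<pi> permutes {..<p}" and y: "y \<in> space (Pi\<^sub>M {..<p} (\<lambda>_. N))"
    have "\<pi> permutes {..<Suc p}" by (rule permutes_subset[OF \<pi>]) auto
    moreover have "(y \<circ> \<pi>)(p := x) = y(p := x) \<circ> \<pi>"
    proof (rule ext)
      fix i
      have "\<pi> p = p" using permutes_not_in[OF \<pi>, of p] by simp
      then have "\<pi> i = p \<longleftrightarrow> i = p" using inj_eq[OF permutes_inj[OF \<pi>], of i p] by simp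
      then show "((y \<circ> \<pi>)(p := x)) i = (y(p := x) \<circ> \<pi>) i" by simp
    qed
    ultimately show "v ((y \<circ> \<pi>)(p := x)) = v (y(p := x))"
      using v(1) measurable_space[OF upd y] by (simp add: symmetric_on_def)
  qed
qed

text \<open>Symmetry of \<open>v\<close> moves the marked point to the last coordinate and the
  sources of \<open>S\<close> to the first \<open>card S\<close> ones; the last coordinate is then
  integrated separately. The label \<open>r\<close> only marks a point: it may be a measurement or a
  dummy.\<close>

lemma nn_integral_split_point:
  fixes G :: "nat \<Rightarrow> 'a \<Rightarrow> ennreal"
  assumes v: "symmetric_on (Suc p) N v" "v \<in> borel_measurable (Pi\<^sub>M {..<Suc p} (\<lambda>_. N))"
    and S: "finite S" "r \<notin> S" "card S \<le> p"
    and e: "inj_on e (insert r S)" "e ` insert r S \<subseteq> {..<Suc p}"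
    and G: "\<And>s. s \<in> S \<Longrightarrow> G s \<in> borel_measurable N" and g: "g \<in> borel_measurable N"
  shows "(\<integral>\<^sup>+x. v x * (g (x (e r)) * (\<Prod>s\<in>S. G s (x (e s)))) \<partial>Pi\<^sub>M {..<Suc p} (\<lambda>_. N)) =
    (\<integral>\<^sup>+x. g x * (\<integral>\<^sup>+y. v (y(p := x)) * (\<Prod>i<card S. G (sorted_list_of_set S ! i) (y i)) \<partial>Pi\<^sub>M {..<p} (\<lambda>_. N)) \<partial>N)"
proof -
  let ?P = "Pi\<^sub>M {..<Suc p} (\<lambda>_. N)"
  define G' where "G' s = (if s = r then g else G s)" for s
  define e' where "e' s = (if s = r then p else rank_in S s)" for s
  have rank: "bij_betw (rank_in S) S {..<card S}" by (rule bij_betw_rank_in[OF S(1)])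
  have rank_less: "rank_in S s < p" if "s \<in> S" for s
    using bij_betw_apply[OF rank that] S(3) by simp
  have e': "inj_on e' (insert r S)" "e' ` insert r S \<subseteq> {..<Suc p}"
    using bij_betw_imp_inj_on[OF rank] rank_less
    by (auto simp: e'_def inj_on_def less_Suc_eq split: if_splits)
  have G': "G' s \<in> borel_measurable N" if "s \<in> insert r S" for s
    using that G g by (auto simp: G'_def)
  have prod: "(\<Prod>s\<in>insert r S. G' s (x (e s))) = g (x (e r)) * (\<Prod>s\<in>S. G s (x (e s)))" for x and e :: "nat \<Rightarrow> nat"
    using S by (auto simp: G'_def intro!: prod.cong arg_cong2[where f = "(*)"])
  have e'_simps: "e' r = p" "(\<Prod>s\<in>S. G s (x (e' s))) = (\<Prod>i<card S. G (sorted_list_of_set S ! i) (x i))" for x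
  proof -
    show "e' r = p" by (simp add: e'_def)
    have "(\<Prod>s\<in>S. G s (x (e' s))) = (\<Prod>s\<in>S. G s (x (rank_in S s)))"
      using S by (intro prod.cong) (auto simp: e'_def)
    then show "(\<Prod>s\<in>S. G s (x (e' s))) = (\<Prod>i<card S. G (sorted_list_of_set S ! i) (x i))"
      by (simp add: prod_sorted_list_of_set[OF S(1), of "\<lambda>s i. G s (x i)"])
  qed
  have "(\<integral>\<^sup>+x. v x * (g (x (e r)) * (\<Prod>s\<in>S. G s (x (e s)))) \<partial>?P) =
      (\<integral>\<^sup>+x. v x * (\<Prod>s\<in>insert r S. G' s (x (e' s))) \<partial>?P)"
    unfolding prod[symmetric]
    by (rule nn_integral_symmetric_assignment[OF v]) (use G' e e' in auto)
  also have "\<dots> = (\<integral>\<^sup>+x. \<integral>\<^sup>+y. v (y(p := x)) * (\<Prod>s\<in>insert r S. G' s ((y(p := x)) (e' s)))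
      \<partial>Pi\<^sub>M {..<p} (\<lambda>_. N) \<partial>N)"
    unfolding lessThan_Suc
    by (rule product_nn_integral_insert_rev)
       (use v(2) prod_component_measurable[OF G' e'(2)] in \<open>auto simp: lessThan_Suc[symmetric]\<close>)
  also have "\<dots> = (\<integral>\<^sup>+x. g x * (\<integral>\<^sup>+y. v (y(p := x)) * (\<Prod>i<card S. G (sorted_list_of_set S ! i) (y i))
      \<partial>Pi\<^sub>M {..<p} (\<lambda>_. N)) \<partial>N)"
  proof (rule nn_integral_cong)
    fix x assume x: "x \<in> space N"
    have "(\<lambda>y. \<Prod>i<card S. G (sorted_list_of_set S ! i) (y i)) \<in> borel_measurable (Pi\<^sub>M {..<p} (\<lambda>_. N))"
      using S(3) G bij_betw_imp_surj_on[OF bij_betw_sorted_list_of_set[OF S(1)]]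
      by (intro prod_component_measurable) auto
    then have "g x * (\<integral>\<^sup>+y. v (y(p := x)) * (\<Prod>i<card S. G (sorted_list_of_set S ! i) (y i)) \<partial>Pi\<^sub>M {..<p} (\<lambda>_. N)) =
      (\<integral>\<^sup>+y. g x * (v (y(p := x)) * (\<Prod>i<card S. G (sorted_list_of_set S ! i) (y i))) \<partial>Pi\<^sub>M {..<p} (\<lambda>_. N))"
      using fun_upd_symmetric(2)[OF v x] by (intro nn_integral_cmult[symmetric]) simp
    also have "\<dots> = (\<integral>\<^sup>+y. v (y(p := x)) * (\<Prod>s\<in>insert r S. G' s ((y(p := x)) (e' s))) \<partial>Pi\<^sub>M {..<p} (\<lambda>_. N))"
    proof (rule nn_integral_cong)
      fix y
      have "(\<Prod>i<card S. G (sorted_list_of_set S ! i) ((y(p := x)) i)) = (\<Prod>i<card S. G (sorted_list_of_set S ! i) (y i))"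
        using S(3) by (intro prod.cong) auto
      then show "g x * (v (y(p := x)) * (\<Prod>i<card S. G (sorted_list_of_set S ! i) (y i))) =
          v (y(p := x)) * (\<Prod>s\<in>insert r S. G' s ((y(p := x)) (e' s)))"
        unfolding prod e'_simps by (simp only: fun_upd_same mult.left_commute)
    qed
    finally show "(\<integral>\<^sup>+y. v (y(p := x)) * (\<Prod>s\<in>insert r S. G' s ((y(p := x)) (e' s))) \<partial>Pi\<^sub>M {..<p} (\<lambda>_. N)) =
        g x * (\<integral>\<^sup>+y. v (y(p := x)) * (\<Prod>i<card S. G (sorted_list_of_set S ! i) (y i)) \<partial>Pi\<^sub>M {..<p} (\<lambda>_. N))" ..
  qed
  finally show ?thesis .
qed

lemma slice_measurable:
  fixes k :: nat
  assumes v: "v \<in> borel_measurable (Pi\<^sub>M {..<Suc p} (\<lambda>_. N))"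
    and w: "w \<in> space (Pi\<^sub>M {..<k} (\<lambda>_. N))" and S: "S \<subseteq> {..<k}" "card S \<le> p"
  shows "(\<lambda>x. \<integral>\<^sup>+y. v (y(p := x)) * (\<Prod>i<card S. kern (w (sorted_list_of_set S ! i)) (y i)) \<partial>Pi\<^sub>M {..<p} (\<lambda>_. N))
    \<in> borel_measurable N"
proof -
  interpret Q: sigma_finite_measure "Pi\<^sub>M {..<p} (\<lambda>_. N)" by (rule sigma_finite_PiM)
  have [measurable]: "(\<lambda>(x, y). v (y(p := x))) \<in> borel_measurable (N \<Otimes>\<^sub>M Pi\<^sub>M {..<p} (\<lambda>_. N))"
    using measurable_compose[OF fun_upd_measurable v] by (simp add: case_prod_beta)
  have "(\<lambda>x. kern (w r) x) \<in> borel_measurable N" if "r < k" for r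
    using w that by (intro measurable_compose[OF _ measurable_ennreal]) (auto simp: space_PiM PiE_iff)
  then have [measurable]: "(\<lambda>y. \<Prod>i<card S. kern (w (sorted_list_of_set S ! i)) (y i)) \<in> borel_measurable (Pi\<^sub>M {..<p} (\<lambda>_. N))"
    using S sorted_nth_in[OF S(1)] by (intro prod_component_measurable) auto
  show ?thesis by measurable
qed

text \<open>The point counted in \<open>B\<close> is either undetected, which costs a factor \<open>1 - p_d\<close>, or it is the
  source of some measurement \<open>z r\<close>, which is then removed from \<open>z\<close>.\<close>

lemma weight_num_points:
  assumes v: "symmetric_on (Suc p) N v" "v \<in> borel_measurable (Pi\<^sub>M {..<Suc p} (\<lambda>_. N))"
    and B [measurable]: "B \<in> sets N" and z: "z \<in> space (Pi\<^sub>M {..<m} (\<lambda>_. N))"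
  shows "weight (Suc p) (\<lambda>x. of_nat (num_points B (config_of (Suc p) x)) * v x) m z =
    (\<integral>\<^sup>+x\<in>B. (ennreal (1 - p_d) * weight p (\<lambda>y. v (y(p := x))) m z +
       (\<Sum>r<m. kern (z r) x * weight p (\<lambda>y. v (y(p := x))) (m - 1) (omit_entry m r z))) \<partial>N)"
proof -
  let ?P = "Pi\<^sub>M {..<Suc p} (\<lambda>_. N)" and ?Q = "Pi\<^sub>M {..<p} (\<lambda>_. N)"
  define T where "T S x = (\<integral>\<^sup>+y. v (y(p := x)) * (\<Prod>i<card S. kern (z (sorted_list_of_set S ! i)) (y i)) \<partial>?Q)" for S x
  define a where "a k = ennreal ((1 - p_d) ^ k / fact k)" for k :: nat
  define c where "c A = (\<Prod>i\<in>A. ennreal (l_c (z i)))" for A :: "nat set"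
  \<comment> \<open>The part of the count due to the point at position \<open>i\<close> lying in
    \<open>B\<close>. Positions below \<open>card S\<close> are the sources of detections.\<close>
  define I where "I S i = (\<integral>\<^sup>+x. indicator B (x i) * v x *
      (\<Prod>k<card S. kern (z (sorted_list_of_set S ! k)) (x k)) \<partial>?P)" for S i
  define D where "D g S = (\<integral>\<^sup>+x. g x * T S x \<partial>N)" for g :: "'a \<Rightarrow> ennreal" and S
  let ?B = "indicator B :: 'a \<Rightarrow> ennreal"
  let ?K = "\<lambda>r x. ?B x * kern (z r) x"
  have zN: "z i \<in> space N" if "i < m" for i
    using z that by (auto simp: space_PiM PiE_iff)
  have kern_meas: "(\<lambda>x. kern (z r) x) \<in> borel_measurable N" if "r < m" for r
    using zN[OF that] by measurable
  have T_meas: "T S \<in> borel_measurable N" if "S \<subseteq> {..<m}" "card S \<le> p" for S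
    unfolding T_def[abs_def] by (rule slice_measurable[OF v(2) z that])
  have I_missed: "I S i = D ?B S" if S: "S \<subseteq> {..<m}" and i: "card S \<le> i" "i < Suc p" for S i
  proof -
    have fin: "finite S" using S by (rule finite_subset) simp
    \<comment> \<open>The number \<open>m\<close> is not a measurement label, so it serves as a
      dummy label for the undetected point.\<close>
    have m: "m \<notin> S" using S by auto
    define e where "e s = (if s = m then i else rank_in S s)" for s
    have rank: "bij_betw (rank_in S) S {..<card S}" by (rule bij_betw_rank_in[OF fin])
    have rank_less: "rank_in S s < i" if "s \<in> S" for s
      using bij_betw_apply[OF rank that] i(1) by simp
    have e: "inj_on e (insert m S)" "e ` insert m S \<subseteq> {..<Suc p}"
      using bij_betw_imp_inj_on[OF rank] rank_less i(2)
      by (auto simp: e_def inj_on_def dest: less_trans split: if_splits)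
    have *: "(\<Prod>s\<in>S. kern (z s) (x (e s))) = (\<Prod>k<card S. kern (z (sorted_list_of_set S ! k)) (x k))" for x
    proof -
      have "(\<Prod>s\<in>S. kern (z s) (x (e s))) = (\<Prod>s\<in>S. kern (z s) (x (rank_in S s)))"
        using m by (intro prod.cong) (auto simp: e_def)
      then show ?thesis by (simp add: prod_sorted_list_of_set[OF fin, of "\<lambda>s i. kern (z s) (x i)"])
    qed
    have "(\<integral>\<^sup>+x. v x * (?B (x (e m)) * (\<Prod>s\<in>S. kern (z s) (x (e s)))) \<partial>?P) = D ?B S"
      unfolding D_def T_def
    proof (rule nn_integral_split_point[OF v fin m _ e])
      show "card S \<le> p" using i by simp
    qed (use S kern_meas in auto)
    then show ?thesis
      unfolding * I_def by (simp add: e_def ac_simps)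
  qed
  \<comment> \<open>Position \<open>i\<close> is the source of \<open>z r\<close>: the kernel at
    \<open>z r\<close> goes with the marked point, and the remaining labels form
    \<open>S - {r}\<close>.\<close>
  have I_detected: "I S i = D (?K r) (S - {r})"
    if S: "S \<subseteq> {..<m}" "card S \<le> Suc p" and r: "r \<in> S" "i = rank_in S r" for S i r
  proof -
    have fin: "finite S" using S(1) by (rule finite_subset) simp
    have ins: "insert r (S - {r}) = S" using r by auto
    have rank: "bij_betw (rank_in S) S {..<card S}" by (rule bij_betw_rank_in[OF fin])
    have e: "inj_on (rank_in S) (insert r (S - {r}))" "rank_in S ` insert r (S - {r}) \<subseteq> {..<Suc p}"
      unfolding ins using bij_betw_imp_inj_on[OF rank] bij_betw_imp_surj_on[OF rank] S(2) by auto
    have "(\<integral>\<^sup>+x. v x * (?K r (x (rank_in S r)) * (\<Prod>s\<in>S - {r}. kern (z s) (x (rank_in S s)))) \<partial>?P) =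
        D (?K r) (S - {r})"
      unfolding D_def T_def
    proof (rule nn_integral_split_point[OF v _ _ _ e])
      show "card (S - {r}) \<le> p" using S(2) r fin by simp
    qed (use fin S r kern_meas in auto)
    moreover have "(\<Prod>k<card S. kern (z (sorted_list_of_set S ! k)) (x k)) =
        kern (z r) (x i) * (\<Prod>s\<in>S - {r}. kern (z s) (x (rank_in S s)))" for x
      using prod.remove[OF fin r(1), of "\<lambda>s. kern (z s) (x (rank_in S s))"]
      by (simp add: prod_sorted_list_of_set[OF fin, of "\<lambda>s i. kern (z s) (x i)"] r(2))
    ultimately show ?thesis
      unfolding I_def r(2) by (simp add: ac_simps)
  qed
  have I_sum: "(\<integral>\<^sup>+ x. of_nat (num_points B (config_of (Suc p) x)) * v x *
      (\<Prod>i<card S. kern (z (sorted_list_of_set S ! i)) (x i)) \<partial>?P) =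
      (\<Sum>r\<in>S. D (?K r) (S - {r})) + of_nat (Suc p - card S) * D ?B S"
    if S: "S \<subseteq> {..<m}" "card S \<le> Suc p" for S
  proof -
    have fin: "finite S" using S(1) by (rule finite_subset) simp
    have rank: "bij_betw (rank_in S) S {..<card S}" by (rule bij_betw_rank_in[OF fin])
    have [measurable]: "(\<lambda>x. \<Prod>k<card S. kern (z (sorted_list_of_set S ! k)) (x k)) \<in> borel_measurable ?P"
      using S sorted_nth_in[OF S(1)] kern_meas by (intro prod_component_measurable) auto
    have [measurable]: "(\<lambda>x. x i) \<in> ?P \<rightarrow>\<^sub>M N" if "i < Suc p" for i
      using that by (intro measurable_component_singleton) auto
    have "(\<integral>\<^sup>+ x. of_nat (num_points B (config_of (Suc p) x)) * v x *
        (\<Prod>i<card S. kern (z (sorted_list_of_set S ! i)) (x i)) \<partial>?P) =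
      (\<integral>\<^sup>+ x. (\<Sum>i<Suc p. ?B (x i) * v x * (\<Prod>k<card S. kern (z (sorted_list_of_set S ! k)) (x k))) \<partial>?P)"
      unfolding num_points_config_of
      by (simp add: sum_distrib_right indicator_def of_bool_def if_distrib[of of_nat] del: sum.lessThan_Suc cong: if_cong)
    also have "\<dots> = (\<Sum>i<Suc p. I S i)"
      unfolding I_def using v(2) by (intro nn_integral_sum) auto
    \<comment> \<open>Positions below \<open>card S\<close> are detected; the other
      \<open>Suc p - card S\<close> positions are interchangeable.\<close>
    also have "(\<Sum>i<Suc p. I S i) = (\<Sum>i<card S. I S i) + (\<Sum>i=card S..<Suc p. I S i)"
    proof -
      have "{..<Suc p} = {..<card S} \<union> {card S..<Suc p}" using S(2) by auto
      then show ?thesis by (metis finite_atLeastLessThan finite_lessThan ivl_disj_int_one(2) sum.union_disjoint)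
    qed
    also have "(\<Sum>i<card S. I S i) = (\<Sum>r\<in>S. I S (rank_in S r))"
      by (rule sum.reindex_bij_betw[OF rank, symmetric])
    also have "\<dots> = (\<Sum>r\<in>S. D (?K r) (S - {r}))"
      using I_detected[OF S] by (intro sum.cong refl) auto
    also have "(\<Sum>i=card S..<Suc p. I S i) = (\<Sum>i=card S..<Suc p. D ?B S)"
      using I_missed[OF S(1)] by (intro sum.cong refl) auto
    finally show ?thesis by simp
  qed
  \<comment> \<open>The number of choices of the undetected point cancels one factor of the
    factorial and leaves one factor \<open>1 - p_d\<close>.\<close>
  have a_Suc: "a (Suc p - k) * of_nat (Suc p - k) = ennreal (1 - p_d) * a (p - k)" if "k \<le> p" for k
  proof -
    have "(1 - p_d) ^ Suc l / fact (Suc l) * real (Suc l) = (1 - p_d) * ((1 - p_d) ^ l / fact l)" for l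
      by (simp add: fact_Suc divide_simps del: of_nat_Suc)
    then have "a (Suc l) * of_nat (Suc l) = ennreal (1 - p_d) * a l" for l
      using p_d unfolding a_def
      by (simp add: ennreal_of_nat_eq_real_of_nat ennreal_mult[symmetric] del: of_nat_Suc power_Suc fact_Suc)
    with that show ?thesis by (simp add: Suc_diff_le del: of_nat_Suc)
  qed
  define A where "A = {S. S \<subseteq> {..<m} \<and> card S \<le> Suc p}"
  define A' where "A' M = {S. S \<subseteq> M \<and> card S \<le> p}" for M :: "nat set"
  have finA: "finite A" "finite (A' M)" if "finite M" for M
    using that by (auto simp: A_def A'_def)
  have "weight (Suc p) (\<lambda>x. of_nat (num_points B (config_of (Suc p) x)) * v x) m z =
      (\<Sum>S\<in>A. c ({..<m} - S) * a (Suc p - card S) *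
         ((\<Sum>r\<in>S. D (?K r) (S - {r})) + of_nat (Suc p - card S) * D ?B S))"
    unfolding assoc_weight_def A_def c_def a_def
    by (intro sum.cong refl arg_cong2[where f = "(*)"]) (use I_sum in auto)
  also have "\<dots> = (\<Sum>S\<in>A. c ({..<m} - S) * (a (Suc p - card S) * of_nat (Suc p - card S)) * D ?B S) +
      (\<Sum>S\<in>A. \<Sum>r\<in>S. c ({..<m} - S) * a (Suc p - card S) * D (?K r) (S - {r}))"
    by (simp add: sum.distrib[symmetric] distrib_left sum_distrib_left add.commute mult.assoc)
  \<comment> \<open>Sets of size \<open>Suc p\<close> leave no undetected point: the factor
    \<open>Suc p - card S\<close> is 0.\<close>
  also have "(\<Sum>S\<in>A. c ({..<m} - S) * (a (Suc p - card S) * of_nat (Suc p - card S)) * D ?B S) =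
      (\<Sum>S\<in>A' {..<m}. c ({..<m} - S) * (a (Suc p - card S) * of_nat (Suc p - card S)) * D ?B S)"
    using finA by (intro sum.mono_neutral_right) (auto simp: A_def A'_def not_le)
  also have "\<dots> = (\<Sum>S\<in>A' {..<m}. ennreal (1 - p_d) * (c ({..<m} - S) * a (p - card S) * D ?B S))"
  proof (rule sum.cong[OF refl])
    fix S assume "S \<in> A' {..<m}"
    then have "card S \<le> p" by (simp add: A'_def)
    then show "c ({..<m} - S) * (a (Suc p - card S) * of_nat (Suc p - card S)) * D ?B S =
        ennreal (1 - p_d) * (c ({..<m} - S) * a (p - card S) * D ?B S)"
      unfolding a_Suc[OF \<open>card S \<le> p\<close>] by (simp only: ac_simps)
  qed
  also have "(\<Sum>S\<in>A. \<Sum>r\<in>S. c ({..<m} - S) * a (Suc p - card S) * D (?K r) (S - {r})) =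
      (\<Sum>S\<in>A. \<Sum>r\<in>{r\<in>{..<m}. r \<in> S}. c ({..<m} - S) * a (Suc p - card S) * D (?K r) (S - {r}))"
    by (intro sum.cong refl) (auto simp: A_def)
  also have "\<dots> = (\<Sum>r<m. \<Sum>S\<in>{S\<in>A. r \<in> S}. c ({..<m} - S) * a (Suc p - card S) * D (?K r) (S - {r}))"
    using finA by (intro sum.swap_restrict) auto
  \<comment> \<open>Removing \<open>r\<close> lowers the size by one, so the number
    \<open>Suc p - card S\<close> of undetected points reads
    \<open>p - card (S - {r})\<close>.\<close>
  also have "\<dots> = (\<Sum>r<m. \<Sum>S\<in>A' ({..<m} - {r}). c ({..<m} - {r} - S) * a (p - card S) * D (?K r) S)"
  proof (rule sum.cong[OF refl])
    fix r assume r: "r \<in> {..<m}"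
    show "(\<Sum>S\<in>{S\<in>A. r \<in> S}. c ({..<m} - S) * a (Suc p - card S) * D (?K r) (S - {r})) =
        (\<Sum>S\<in>A' ({..<m} - {r}). c ({..<m} - {r} - S) * a (p - card S) * D (?K r) S)"
    proof (rule sum.reindex_bij_witness[where i = "insert r" and j = "\<lambda>S. S - {r}"])
      fix S assume S: "S \<in> {S\<in>A. r \<in> S}"
      then have fin: "finite S" by (auto simp: A_def finite_subset)
      have card: "card S = Suc (card (S - {r}))" using card.remove[OF fin, of r] S by auto
      show "insert r (S - {r}) = S" using S by auto
      show "S - {r} \<in> A' ({..<m} - {r})" using S card by (auto simp: A_def A'_def)
      have "{..<m} - {r} - (S - {r}) = {..<m} - S" using S by auto
      then show "c ({..<m} - {r} - (S - {r})) * a (p - card (S - {r})) * D (?K r) (S - {r}) =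
          c ({..<m} - S) * a (Suc p - card S) * D (?K r) (S - {r})"
        by (simp add: card)
    next
      fix S assume S: "S \<in> A' ({..<m} - {r})"
      then have fin: "finite S" and "r \<notin> S" by (auto simp: A'_def finite_subset)
      then show "insert r S - {r} = S" "insert r S \<in> {S\<in>A. r \<in> S}"
        using S r by (auto simp: A_def A'_def)
    qed
  qed
  also have "(\<Sum>S\<in>A' {..<m}. ennreal (1 - p_d) * (c ({..<m} - S) * a (p - card S) * D ?B S)) +
      (\<Sum>r<m. \<Sum>S\<in>A' ({..<m} - {r}). c ({..<m} - {r} - S) * a (p - card S) * D (?K r) S) =
      (\<integral>\<^sup>+x. (\<Sum>S\<in>A' {..<m}. ennreal (1 - p_d) * (c ({..<m} - S) * a (p - card S) * (?B x * T S x))) +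
        (\<Sum>r<m. \<Sum>S\<in>A' ({..<m} - {r}). c ({..<m} - {r} - S) * a (p - card S) * (?K r x * T S x)) \<partial>N)"
  proof -
    have T1: "T S \<in> borel_measurable N" if "S \<in> A' {..<m}" for S
      using that by (intro T_meas) (auto simp: A'_def)
    have T2: "T S \<in> borel_measurable N" if "S \<in> A' ({..<m} - {r})" for S r
      using that by (intro T_meas) (auto simp: A'_def)
    show ?thesis
      unfolding D_def using T1 T2 kern_meas
      by (subst nn_integral_add; (subst nn_integral_sum)?; (intro borel_measurable_sum)?)
         (auto simp: nn_integral_cmult nn_integral_sum intro!: sum.cong)
  qed
  also have "\<dots> = (\<integral>\<^sup>+x\<in>B. (ennreal (1 - p_d) * weight p (\<lambda>y. v (y(p := x))) m z +
       (\<Sum>r<m. kern (z r) x * weight p (\<lambda>y. v (y(p := x))) (m - 1) (omit_entry m r z))) \<partial>N)"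
  proof (rule nn_integral_cong)
    fix x
    have 1: "weight p (\<lambda>y. v (y(p := x))) m z = (\<Sum>S\<in>A' {..<m}. c ({..<m} - S) * a (p - card S) * T S x)"
      by (simp add: assoc_weight_def A'_def c_def a_def T_def)
    have 2: "weight p (\<lambda>y. v (y(p := x))) (m - 1) (omit_entry m r z) =
        (\<Sum>S\<in>A' ({..<m} - {r}). c ({..<m} - {r} - S) * a (p - card S) * T S x)" if "r \<in> {..<m}" for r
      using that weight_omit_entry[of r m p] by (simp add: A'_def c_def a_def T_def)
    have 3: "(\<Sum>r<m. kern (z r) x * weight p (\<lambda>y. v (y(p := x))) (m - 1) (omit_entry m r z)) =
        (\<Sum>r<m. kern (z r) x * (\<Sum>S\<in>A' ({..<m} - {r}). c ({..<m} - {r} - S) * a (p - card S) * T S x))"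
      using 2 by (intro sum.cong refl) simp
    show "(\<Sum>S\<in>A' {..<m}. ennreal (1 - p_d) * (c ({..<m} - S) * a (p - card S) * (?B x * T S x))) +
        (\<Sum>r<m. \<Sum>S\<in>A' ({..<m} - {r}). c ({..<m} - {r} - S) * a (p - card S) * (?K r x * T S x)) =
      (ennreal (1 - p_d) * weight p (\<lambda>y. v (y(p := x))) m z +
       (\<Sum>r<m. kern (z r) x * weight p (\<lambda>y. v (y(p := x))) (m - 1) (omit_entry m r z))) * ?B x"
      unfolding 1 3 by (simp add: sum_distrib_left sum_distrib_right distrib_left distrib_right ac_simps)
  qed
  finally show ?thesis .
qed

end

section \<open>Permanents and symmetric densities\<close>

text \<open>Passing to complements in \<open>A\<close> gives the expansion of a product of factors
  -1 + 1 over \<open>A - R\<close>, the cancellation behind inclusion-exclusion.\<close>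

lemma sum_signed_supersets:
  assumes "finite A" "R \<subseteq> A"
  shows "(\<Sum>T | R \<subseteq> T \<and> T \<subseteq> A. (- 1) ^ (card A - card T)) = (of_bool (R = A) :: real)"
proof -
  have "(\<Sum>T | R \<subseteq> T \<and> T \<subseteq> A. (- 1) ^ (card A - card T)) = (\<Sum>U\<in>Pow (A - R). (- 1 :: real) ^ card U)"
    by (rule sum.reindex_bij_witness[where i = "\<lambda>U. A - U" and j = "\<lambda>T. A - T"])
       (use assms in \<open>auto simp: card_Diff_subset finite_subset\<close>)
  also have "\<dots> = (\<Prod>x\<in>A - R. - 1 + 1)"
    using assms by (subst prod_add) auto
  also have "\<dots> = of_bool (R = A)"
    using assms by (auto simp: prod_zero_iff)
  finally show ?thesis .
qed

text \<open>Ryser's formula for the permanent. It makes the symmetrization of the indicator of a box a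
  function of the multisets \<open>{#z\<^sub>0, \<dots>, z\<^sub>m\<^sub>-\<^sub>1#}\<close> that is visibly measurable.\<close>

lemma ryser_permanent:
  fixes a :: "nat \<Rightarrow> nat \<Rightarrow> real"
  shows "(\<Sum>T\<in>Pow {..<m}. (- 1) ^ (m - card T) * (\<Prod>i<m. \<Sum>k\<in>T. a k i)) =
    (\<Sum>\<pi> | \<pi> permutes {..<m}. \<Prod>i<m. a (\<pi> i) i)"
proof -
  let ?A = "{..<m}"
  let ?F = "?A \<rightarrow>\<^sub>E ?A"
  have finF: "finite ?F" by (intro finite_PiE) auto
  have "(\<Sum>T\<in>Pow ?A. (- 1) ^ (m - card T) * (\<Prod>i<m. \<Sum>k\<in>T. a k i)) =
      (\<Sum>T\<in>Pow ?A. \<Sum>g\<in>{g\<in>?F. g ` ?A \<subseteq> T}. (- 1) ^ (m - card T) * (\<Prod>i<m. a (g i) i))"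
  proof (rule sum.cong[OF refl])
    fix T assume T: "T \<in> Pow ?A"
    then have "?A \<rightarrow>\<^sub>E T = {g\<in>?F. g ` ?A \<subseteq> T}" unfolding PiE_def Pi_def by blast
    with T show "(- 1) ^ (m - card T) * (\<Prod>i<m. \<Sum>k\<in>T. a k i) =
        (\<Sum>g\<in>{g\<in>?F. g ` ?A \<subseteq> T}. (- 1) ^ (m - card T) * (\<Prod>i<m. a (g i) i))"
      by (subst prod_sum_PiE) (auto simp: sum_distrib_left finite_subset)
  qed
  also have "\<dots> = (\<Sum>g\<in>?F. \<Sum>T\<in>{T\<in>Pow ?A. g ` ?A \<subseteq> T}. (- 1) ^ (m - card T) * (\<Prod>i<m. a (g i) i))"
    using finF by (intro sum.swap_restrict) auto
  \<comment> \<open>For fixed \<open>g\<close> the signs cancel unless \<open>g\<close> is onto, and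
    an onto self-map of a finite set is a bijection.\<close>
  also have "\<dots> = (\<Sum>g\<in>?F. of_bool (g ` ?A = ?A) * (\<Prod>i<m. a (g i) i))"
  proof (rule sum.cong[OF refl])
    fix g assume "g \<in> ?F"
    then have "g ` ?A \<subseteq> ?A" by auto
    moreover have "{T\<in>Pow ?A. g ` ?A \<subseteq> T} = {T. g ` ?A \<subseteq> T \<and> T \<subseteq> ?A}" by auto
    ultimately show "(\<Sum>T\<in>{T\<in>Pow ?A. g ` ?A \<subseteq> T}. (- 1) ^ (m - card T) * (\<Prod>i<m. a (g i) i)) =
        of_bool (g ` ?A = ?A) * (\<Prod>i<m. a (g i) i)"
      using sum_signed_supersets[of ?A "g ` ?A"] by (simp add: sum_distrib_right[symmetric])
  qed
  also have "\<dots> = (\<Sum>g\<in>{g\<in>?F. g ` ?A = ?A}. \<Prod>i<m. a (g i) i)"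
    unfolding sum.inter_filter[OF finF] by (intro sum.cong) auto
  also have "\<dots> = (\<Sum>\<pi> | \<pi> permutes ?A. \<Prod>i<m. a (\<pi> i) i)"
  \<comment> \<open>Restriction and extension by the identity translate between extensional maps and
    permutations of the naturals.\<close>
  proof (rule sum.reindex_bij_witness[where i = "\<lambda>\<pi>. restrict \<pi> ?A" and j = "\<lambda>g i. if i < m then g i else i"])
    fix g assume g: "g \<in> {g\<in>?F. g ` ?A = ?A}"
    show "restrict (\<lambda>i. if i < m then g i else i) ?A = g"
      using g by (auto simp: fun_eq_iff PiE_iff extensional_def)
    have "inj_on g ?A" using g by (intro eq_card_imp_inj_on) auto
    with g have "bij_betw g ?A ?A" by (simp add: bij_betw_def)
    then have "bij_betw (\<lambda>i. if i < m then g i else i) ?A ?A"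
      by (rule bij_betw_cong[THEN iffD1, rotated]) simp
    then have "(\<lambda>i. if i < m then g i else i) permutes ?A"
      by (rule bij_imp_permutes) simp
    then show "(\<lambda>i. if i < m then g i else i) \<in> {\<pi>. \<pi> permutes ?A}"
      by simp
    show "(\<Prod>i<m. a ((if i < m then g i else i)) i) = (\<Prod>i<m. a (g i) i)"
      by (intro prod.cong) auto
  next
    fix \<pi> assume "\<pi> \<in> {\<pi>. \<pi> permutes ?A}"
    then have \<pi>: "\<pi> permutes ?A" by simp
    show "(\<lambda>i. if i < m then restrict \<pi> ?A i else i) = \<pi>"
      using permutes_not_in[OF \<pi>] by (auto simp: fun_eq_iff)
    show "restrict \<pi> ?A \<in> {g\<in>?F. g ` ?A = ?A}"
      using permutes_image[OF \<pi>] permutes_in_image[OF \<pi>] by auto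
  qed
  finally show ?thesis .
qed

text \<open>Densities are compared on boxes. The indicator of a box need not depend on the multiset
  alone, but its sum over all permutations does; against a symmetric density every permutation has
  the same integral, so the factor \<open>fact m\<close> cancels.\<close>

lemma (in sigma_finite_measure) AE_eq_if_symmetric:
  assumes f: "symmetric_on m M f" "f \<in> borel_measurable (Pi\<^sub>M {..<m} (\<lambda>_. M))"
    and f': "symmetric_on m M f'" "f' \<in> borel_measurable (Pi\<^sub>M {..<m} (\<lambda>_. M))"
    and fin: "(\<integral>\<^sup>+z. f z \<partial>Pi\<^sub>M {..<m} (\<lambda>_. M)) < \<infinity>"
    and eq: "\<And>F :: 'a multiset \<Rightarrow> ennreal. F \<in> borel_measurable (conf M) \<Longrightarrow>
      (\<integral>\<^sup>+z. F (config_of m z) * f z \<partial>Pi\<^sub>M {..<m} (\<lambda>_. M)) = (\<integral>\<^sup>+z. F (config_of m z) * f' z \<partial>Pi\<^sub>M {..<m} (\<lambda>_. M))"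
  shows "AE z in Pi\<^sub>M {..<m} (\<lambda>_. M). f z = f' z"
proof -
  interpret product_sigma_finite "\<lambda>_. M" by standard
  let ?P = "Pi\<^sub>M {..<m} (\<lambda>_. M)"
  let ?\<Pi> = "{\<pi>. \<pi> permutes {..<m}}"
  interpret P: sigma_finite_measure ?P by (rule sigma_finite) simp
  have "density ?P f (Pi\<^sub>E {..<m} B) = density ?P f' (Pi\<^sub>E {..<m} B)"
    if B: "\<And>i. i \<in> {..<m} \<Longrightarrow> B i \<in> sets M" for B
  proof -
    let ?R = "Pi\<^sub>E {..<m} B"
    have R: "?R \<in> sets ?P" using B by (intro sets_PiM_I_finite) auto
    \<comment> \<open>Real because of the signs. On configurations of \<open>m\<close>-tuples the
      value is a sum of indicators, so passing to \<open>ennreal\<close> loses nothing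
      there.\<close>
    define G :: "'a multiset \<Rightarrow> real" where
      "G \<phi> = (\<Sum>T\<in>Pow {..<m}. (- 1) ^ (m - card T) * (\<Prod>x\<in>#\<phi>. \<Sum>k\<in>T. indicator (B k) x))" for \<phi>
    have "simple_function M (\<lambda>x. \<Sum>k\<in>T. indicator (B k) x :: real)" if "T \<subseteq> {..<m}" for T
      using B that by (intro simple_function_sum simple_function_indicator) auto
    then have G_meas: "G \<in> borel_measurable (conf M)"
      unfolding G_def[abs_def]
      by (intro borel_measurable_sum borel_measurable_times borel_measurable_const prod_mset_measurable_real) auto
    have G: "G (config_of m z) = (\<Sum>\<pi>\<in>?\<Pi>. indicator ?R (z \<circ> inv \<pi>))" if z: "z \<in> space ?P" for z
    proof -
      have "G (config_of m z) = (\<Sum>\<pi>\<in>?\<Pi>. \<Prod>i<m. indicator (B (\<pi> i)) (z i))"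
        unfolding G_def prod_mset_config_of using ryser_permanent[of m "\<lambda>k i. indicator (B k) (z i)"] by simp
      also have "\<dots> = (\<Sum>\<pi>\<in>?\<Pi>. indicator ?R (z \<circ> inv \<pi>))"
      proof (rule sum.cong[OF refl])
        fix \<pi> assume "\<pi> \<in> ?\<Pi>"
        then have \<pi>: "\<pi> permutes {..<m}" by simp
        have "(\<Prod>i<m. indicator (B (\<pi> i)) (z i) :: real) = (\<Prod>i<m. indicator (B i) ((z \<circ> inv \<pi>) i))"
          using prod.permute[OF \<pi>, of "\<lambda>i. indicator (B i) ((z \<circ> inv \<pi>) i) :: real"]
          by (simp add: permutes_inverses[OF \<pi>])
        also have "\<dots> = indicator ?R (z \<circ> inv \<pi>)"
          using space_PiM_permute[OF permutes_inv[OF \<pi>] z]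
          by (auto simp: indicator_def space_PiM PiE_iff prod_zero_iff)
        finally show "(\<Prod>i<m. indicator (B (\<pi> i)) (z i) :: real) = indicator ?R (z \<circ> inv \<pi>)" .
      qed
      finally show ?thesis .
    qed
    have *: "(\<integral>\<^sup>+z. ennreal (G (config_of m z)) * g z \<partial>?P) = of_nat (fact m) * emeasure (density ?P g) ?R"
      if g: "symmetric_on m M g" "g \<in> borel_measurable ?P" for g
    proof -
      have 1: "(\<integral>\<^sup>+z. indicator ?R (z \<circ> inv \<pi>) * g z \<partial>?P) = emeasure (density ?P g) ?R" if "\<pi> \<in> ?\<Pi>" for \<pi>
      proof -
        have inv: "inv \<pi> permutes {..<m}" using that by (auto intro: permutes_inv)
        have "(\<integral>\<^sup>+z. indicator ?R (z \<circ> inv \<pi>) * g z \<partial>?P) =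
            (\<integral>\<^sup>+z. indicator ?R (z \<circ> inv \<pi>) * g (z \<circ> inv \<pi>) \<partial>?P)"
          using g(1) inv by (intro nn_integral_cong) (simp add: symmetric_on_def)
        also have "\<dots> = (\<integral>\<^sup>+z. indicator ?R z * g z \<partial>?P)"
          using g(2) R by (intro nn_integral_PiM_permute[OF inv]) auto
        also have "\<dots> = emeasure (density ?P g) ?R"
          using g(2) R by (simp add: emeasure_density mult.commute)
        finally show ?thesis .
      qed
      have "(\<integral>\<^sup>+z. ennreal (G (config_of m z)) * g z \<partial>?P) =
          (\<integral>\<^sup>+z. (\<Sum>\<pi>\<in>?\<Pi>. indicator ?R (z \<circ> inv \<pi>) * g z) \<partial>?P)"
        by (intro nn_integral_cong) (simp add: G sum_distrib_right[symmetric] sum_ennreal[symmetric] ennreal_indicator)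
      also have "\<dots> = (\<Sum>\<pi>\<in>?\<Pi>. \<integral>\<^sup>+z. indicator ?R (z \<circ> inv \<pi>) * g z \<partial>?P)"
      proof (rule nn_integral_sum)
        fix \<pi> assume "\<pi> \<in> ?\<Pi>"
        then have "(\<lambda>z. z \<circ> inv \<pi>) \<in> ?P \<rightarrow>\<^sub>M ?P"
          by (intro measurable_PiM_permute permutes_inv) simp
        then show "(\<lambda>z. indicator ?R (z \<circ> inv \<pi>) * g z) \<in> borel_measurable ?P"
          using g(2) R by (intro borel_measurable_times_ennreal measurable_compose[OF _ borel_measurable_indicator]) auto
      qed
      also have "\<dots> = of_nat (fact m) * emeasure (density ?P g) ?R"
        using 1 card_permutations[of "{..<m}" m] by simp
      finally show ?thesis .
    qed
    have "of_nat (fact m) * emeasure (density ?P f) ?R = of_nat (fact m) * emeasure (density ?P f') ?R"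
      using eq[of "\<lambda>\<phi>. ennreal (G \<phi>)"] G_meas *[OF f] *[OF f'] by simp
    then show ?thesis
      by (subst (asm) ennreal_mult_cancel_left) (auto simp: ennreal_of_nat_eq_real_of_nat)
  qed
  moreover have "emeasure (density ?P f) (space ?P) \<noteq> \<infinity>"
    using fin f(2) by (simp add: emeasure_density nn_integral_cong[of ?P "\<lambda>z. f z * indicator (space ?P) z" f])
  moreover have "space ?P \<in> prod_algebra {..<m} (\<lambda>_. M)"
    by (auto simp: space_PiM intro!: prod_algebraI_finite)
  ultimately have "density ?P f = density ?P f'"
    by (intro measure_eqI_PiM_finite[where A = "\<lambda>_. space ?P" and I = "{..<m}" and M = "\<lambda>_. M"]) auto
  then show ?thesis
    by (rule P.density_unique[OF f(2) f'(2)])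
qed

section \<open>Conditional, Poisson and detection laws\<close>

text \<open>Two passages from sets to functions. For fixed \<open>B\<close> both sides are measures
  in \<open>A\<close>, which admits general \<open>g\<close>; reweighting \<open>M\<close> by
  \<open>g (X \<omega>)\<close> then makes the law of \<open>Y\<close> a mixture of
  \<open>\<kappa>\<close>, which admits general \<open>f\<close>.\<close>

lemma regular_cond_distr_nn_integral:
  assumes rcd: "regular_cond_distr M X S Y T \<kappa>"
    and g[measurable]: "g \<in> borel_measurable S" and f[measurable]: "f \<in> borel_measurable T"
  shows "(\<integral>\<^sup>+\<omega>. g (X \<omega>) * f (Y \<omega>) \<partial>M) = (\<integral>\<^sup>+\<omega>. g (X \<omega>) * (\<integral>\<^sup>+y. f y \<partial>\<kappa> (X \<omega>)) \<partial>M)"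
proof -
  have [measurable]: "X \<in> M \<rightarrow>\<^sub>M S" "Y \<in> M \<rightarrow>\<^sub>M T" "\<kappa> \<in> S \<rightarrow>\<^sub>M prob_algebra T"
    and eq: "\<And>A B. A \<in> sets S \<Longrightarrow> B \<in> sets T \<Longrightarrow>
        emeasure M {\<omega> \<in> space M. X \<omega> \<in> A \<and> Y \<omega> \<in> B} =
        (\<integral>\<^sup>+ \<omega>. indicator A (X \<omega>) * emeasure (\<kappa> (X \<omega>)) B \<partial>M)"
    using rcd by (auto simp: regular_cond_distr_def)
  have [measurable]: "\<kappa> \<in> S \<rightarrow>\<^sub>M subprob_algebra T"
    by (rule measurable_prob_algebraD) measurable
  have [measurable]: "(\<lambda>\<omega>. emeasure (\<kappa> (X \<omega>)) B) \<in> borel_measurable M" if "B \<in> sets T" for B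
    using that by measurable
  have 1: "(\<integral>\<^sup>+\<omega>. g (X \<omega>) * indicator B (Y \<omega>) \<partial>M) = (\<integral>\<^sup>+\<omega>. g (X \<omega>) * emeasure (\<kappa> (X \<omega>)) B \<partial>M)"
    if [measurable]: "B \<in> sets T" for B
  proof -
    let ?a = "\<lambda>\<omega>. indicator B (Y \<omega>) :: ennreal" and ?b = "\<lambda>\<omega>. emeasure (\<kappa> (X \<omega>)) B"
    have "distr (density M ?a) S X = distr (density M ?b) S X"
    proof (rule measure_eqI)
      fix A assume "A \<in> sets (distr (density M ?a) S X)"
      then have [measurable]: "A \<in> sets S" by simp
      have "emeasure (distr (density M ?a) S X) A = (\<integral>\<^sup>+\<omega>. ?a \<omega> * indicator (X -` A \<inter> space M) \<omega> \<partial>M)"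
        by (simp add: emeasure_distr emeasure_density)
      also have "\<dots> = (\<integral>\<^sup>+\<omega>. indicator {\<omega> \<in> space M. X \<omega> \<in> A \<and> Y \<omega> \<in> B} \<omega> \<partial>M)"
        by (intro nn_integral_cong) (auto simp: indicator_def)
      also have "\<dots> = (\<integral>\<^sup>+ \<omega>. indicator A (X \<omega>) * ?b \<omega> \<partial>M)"
        by (subst nn_integral_indicator) (auto simp: eq)
      also have "\<dots> = (\<integral>\<^sup>+\<omega>. ?b \<omega> * indicator (X -` A \<inter> space M) \<omega> \<partial>M)"
        by (intro nn_integral_cong) (auto simp: indicator_def)
      also have "\<dots> = emeasure (distr (density M ?b) S X) A"
        by (simp add: emeasure_distr emeasure_density)
      finally show "emeasure (distr (density M ?a) S X) A = emeasure (distr (density M ?b) S X) A" .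
    qed simp
    then have "(\<integral>\<^sup>+x. g x \<partial>distr (density M ?a) S X) = (\<integral>\<^sup>+x. g x \<partial>distr (density M ?b) S X)"
      by simp
    then show ?thesis
      by (simp add: nn_integral_distr nn_integral_density mult.commute)
  qed
  let ?G = "density M (\<lambda>\<omega>. g (X \<omega>))"
  have sk: "sets (\<kappa> (X \<omega>)) = sets T" if "\<omega> \<in> space M" for \<omega>
    using that by (intro sets_kernel[OF \<open>\<kappa> \<in> S \<rightarrow>\<^sub>M subprob_algebra T\<close>] measurable_space[OF \<open>X \<in> M \<rightarrow>\<^sub>M S\<close>])
  have K: "(\<lambda>\<omega>. \<kappa> (X \<omega>)) \<in> ?G \<rightarrow>\<^sub>M subprob_algebra T"
    by measurable
  show ?thesis
  \<comment> \<open>\<open>bind\<close> over an empty space takes a default value, hence the case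
    distinction.\<close>
  proof (cases "space M = {}")
    case False
    have "distr ?G T Y = bind ?G (\<lambda>\<omega>. \<kappa> (X \<omega>))"
    proof (rule measure_eqI)
      show "sets (distr ?G T Y) = sets (bind ?G (\<lambda>\<omega>. \<kappa> (X \<omega>)))"
        using False sk by (subst sets_bind[where N = T]) auto
      fix B assume "B \<in> sets (distr ?G T Y)"
      then have [measurable]: "B \<in> sets T" by simp
      have "emeasure (distr ?G T Y) B = (\<integral>\<^sup>+\<omega>. g (X \<omega>) * indicator (Y -` B \<inter> space M) \<omega> \<partial>M)"
        by (simp add: emeasure_distr emeasure_density)
      also have "\<dots> = (\<integral>\<^sup>+\<omega>. g (X \<omega>) * indicator B (Y \<omega>) \<partial>M)"
        by (intro nn_integral_cong) (auto simp: indicator_def)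
      also have "\<dots> = (\<integral>\<^sup>+\<omega>. g (X \<omega>) * emeasure (\<kappa> (X \<omega>)) B \<partial>M)"
        by (rule 1) simp
      also have "\<dots> = emeasure (bind ?G (\<lambda>\<omega>. \<kappa> (X \<omega>))) B"
        using False by (subst emeasure_bind[OF _ K]) (auto simp: nn_integral_density)
      finally show "emeasure (distr ?G T Y) B = emeasure (bind ?G (\<lambda>\<omega>. \<kappa> (X \<omega>))) B" .
    qed
    then have "(\<integral>\<^sup>+y. f y \<partial>distr ?G T Y) = (\<integral>\<^sup>+y. f y \<partial>bind ?G (\<lambda>\<omega>. \<kappa> (X \<omega>)))"
      by simp
    moreover have "(\<integral>\<^sup>+y. f y \<partial>bind ?G (\<lambda>\<omega>. \<kappa> (X \<omega>))) = (\<integral>\<^sup>+\<omega>. g (X \<omega>) * (\<integral>\<^sup>+y. f y \<partial>\<kappa> (X \<omega>)) \<partial>M)"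
      by (subst nn_integral_bind[OF f K]) (simp add: nn_integral_density)
    ultimately show ?thesis
      by (simp add: nn_integral_distr nn_integral_density)
  qed (simp add: nn_integral_empty)
qed

section \<open>Generating functional of the Poisson clutter\<close>

text \<open>The exponential series at \<open>v * l\<close>. Rate 0 and argument 0 are covered
  because 0^0 = 1.\<close>

lemma (in prob_space) poisson_pgf:
  assumes N: "X \<in> M \<rightarrow>\<^sub>M count_space UNIV"
    and pr: "\<And>k. prob {\<omega> \<in> space M. X \<omega> = k} = l ^ k / fact k * exp (- l)"
    and l: "0 \<le> l" and v: "0 \<le> v"
  shows "(\<integral>\<^sup>+\<omega>. ennreal v ^ X \<omega> \<partial>M) = ennreal (exp (v * l - l))"
proof -
  note [measurable] = N
  have "ennreal v ^ X \<omega> = (\<Sum>k. ennreal v ^ k * indicator {\<omega> \<in> space M. X \<omega> = k} \<omega>)" if "\<omega> \<in> space M" for \<omega>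
    using that by (subst suminf_finite[of "{X \<omega>}"]) (auto simp: indicator_def)
  then have "(\<integral>\<^sup>+\<omega>. ennreal v ^ X \<omega> \<partial>M) =
      (\<integral>\<^sup>+\<omega>. (\<Sum>k. ennreal v ^ k * indicator {\<omega> \<in> space M. X \<omega> = k} \<omega>) \<partial>M)"
    by (intro nn_integral_cong) auto
  also have "\<dots> = (\<Sum>k. ennreal v ^ k * emeasure M {\<omega> \<in> space M. X \<omega> = k})"
    by (subst nn_integral_suminf) (auto simp: nn_integral_cmult)
  also have "\<dots> = (\<Sum>k. ennreal ((v * l) ^ k / fact k * exp (- l)))"
    using v by (intro suminf_cong)
      (simp add: emeasure_eq_measure pr ennreal_power ennreal_mult'[symmetric] power_mult_distrib mult.assoc)
  also have "\<dots> = ennreal (exp (v * l - l))"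
  proof (rule suminf_ennreal_eq)
    show "(\<lambda>k. (v * l) ^ k / fact k * exp (- l)) sums exp (v * l - l)"
      using sums_mult2[OF exp_converges[of "v * l"], of "exp (- l)"]
      by (simp add: exp_diff exp_minus divide_inverse mult.commute)
  qed (use v l in simp)
  finally show ?thesis .
qed

text \<open>The level sets of \<open>h\<close> are disjoint, so the counts on them are independent
  Poisson variables. Multiplying their generating functions adds the exponents over the values of
  \<open>h\<close>, which gives the difference of the two integrals.\<close>

lemma (in prob_space) poisson_point_process_pgf:
  assumes C: "poisson_point_process M N l_c C"
    and l_c: "\<And>z. z \<in> space N \<Longrightarrow> 0 \<le> l_c z" "integrable N l_c"
    and h: "simple_function N h" "\<And>x. 0 \<le> h x" "\<And>x. h x \<le> (1::real)"
  shows "(\<integral>\<^sup>+\<omega>. (\<Prod>x\<in>#C \<omega>. ennreal (h x)) \<partial>M) = ennreal (exp ((LINT z|N. h z * l_c z) - (LINT z|N. l_c z)))"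
proof -
  have [measurable]: "C \<in> M \<rightarrow>\<^sub>M conf N"
    and pr: "\<And>B k. B \<in> sets N \<Longrightarrow> prob {\<omega> \<in> space M. num_points B (C \<omega>) = k} =
        (LINT z:B|N. l_c z) ^ k / fact k * exp (- (LINT z:B|N. l_c z))"
    and ind: "\<And>(I :: nat set) B. finite I \<Longrightarrow> (\<And>i. i\<in>I \<Longrightarrow> B i \<in> sets N) \<Longrightarrow> disjoint_family_on B I \<Longrightarrow>
        indep_vars (\<lambda>_. count_space UNIV) (\<lambda>i \<omega>. num_points (B i) (C \<omega>)) I"
    using C by (auto simp: poisson_point_process_def)
  let ?V = "h ` space N"
  have finV: "finite ?V" using h(1) by (rule simple_functionD)
  \<comment> \<open>Independence is available for families indexed by natural numbers, so the values
    of \<open>h\<close> are enumerated.\<close>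
  then obtain f where f: "bij_betw f {..<card ?V} ?V"
    using ex_bij_betw_nat_finite[of ?V] by (auto simp: atLeast0LessThan)
  define L where "L v = h -` {v} \<inter> space N" for v
  have L [measurable]: "L v \<in> sets N" for v
    unfolding L_def using h(1) by (rule simple_functionD)
  define rate where "rate v = (LINT z:L v|N. l_c z)" for v
  have int: "integrable N (\<lambda>z. indicator (L v) z * l_c z)" for v
    using integrable_mult_indicator[OF L l_c(2)] by simp
  have rate_nonneg: "0 \<le> rate v" for v
    unfolding rate_def set_lebesgue_integral_def using l_c(1)
    by (intro integral_nonneg_AE) (auto simp: indicator_def)
  \<comment> \<open>Used for \<open>g v = v\<close> and \<open>g v = 1\<close>, which give the two
    integrals in the exponent.\<close>
  have sum_eq: "(LINT z|N. g (h z) * l_c z) = (\<Sum>v\<in>?V. g v * rate v)" for g :: "real \<Rightarrow> real"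
  proof -
    have "(LINT z|N. g (h z) * l_c z) = (LINT z|N. (\<Sum>v\<in>?V. g v * (indicator (L v) z * l_c z)))"
    proof (rule Bochner_Integration.integral_cong[OF refl])
      fix z assume z: "z \<in> space N"
      have "(\<Sum>v\<in>?V. g v * (indicator (L v) z * l_c z)) = (\<Sum>v\<in>?V. if v = h z then g v * l_c z else 0)"
        using z by (intro sum.cong) (auto simp: L_def)
      then show "g (h z) * l_c z = (\<Sum>v\<in>?V. g v * (indicator (L v) z * l_c z))"
        using z finV by (simp add: sum.delta)
    qed
    also have "\<dots> = (\<Sum>v\<in>?V. g v * rate v)"
      using int by (subst Bochner_Integration.integral_sum) (auto simp: rate_def set_lebesgue_integral_def)
    finally show ?thesis .
  qed
  have V0: "0 \<le> v" if "v \<in> ?V" for v using that h(2) by auto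
  have "(\<integral>\<^sup>+\<omega>. (\<Prod>x\<in>#C \<omega>. ennreal (h x)) \<partial>M) =
      (\<integral>\<^sup>+\<omega>. (\<Prod>i<card ?V. ennreal (f i) ^ num_points (L (f i)) (C \<omega>)) \<partial>M)"
  proof (rule nn_integral_cong)
    fix \<omega> assume "\<omega> \<in> space M"
    then have "C \<omega> \<in> space (conf N)" by (rule measurable_space[OF \<open>C \<in> M \<rightarrow>\<^sub>M conf N\<close>])
    then have "(\<Prod>x\<in>#C \<omega>. h x) = (\<Prod>v\<in>?V. v ^ num_points (L v) (C \<omega>))"
      unfolding L_def by (rule prod_mset_simple_function[OF finV])
    moreover have "(\<Prod>x\<in>#\<phi>. ennreal (h x)) = ennreal (\<Prod>x\<in>#\<phi>. h x)" for \<phi>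
    proof (induction \<phi>)
      case (add x \<phi>)
      have "0 \<le> (\<Prod>x\<in>#\<phi>. h x)" using h(2) by (induction \<phi>) auto
      with add h(2) show ?case by (simp add: ennreal_mult)
    qed simp
    ultimately have "(\<Prod>x\<in>#C \<omega>. ennreal (h x)) = (\<Prod>v\<in>?V. ennreal v ^ num_points (L v) (C \<omega>))"
      using V0 by (simp add: prod_ennreal[symmetric] ennreal_power)
    then show "(\<Prod>x\<in>#C \<omega>. ennreal (h x)) = (\<Prod>i<card ?V. ennreal (f i) ^ num_points (L (f i)) (C \<omega>))"
      by (simp add: prod.reindex_bij_betw[OF f, symmetric])
  qed
  also have "\<dots> = (\<Prod>i<card ?V. \<integral>\<^sup>+\<omega>. ennreal (f i) ^ num_points (L (f i)) (C \<omega>) \<partial>M)"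
  proof (rule indep_vars_nn_integral)
    have "disjoint_family_on (\<lambda>i. L (f i)) {..<card ?V}"
      using bij_betw_imp_inj_on[OF f] by (auto simp: disjoint_family_on_def L_def inj_on_def)
    then have "indep_vars (\<lambda>_. count_space UNIV) (\<lambda>i \<omega>. num_points (L (f i)) (C \<omega>)) {..<card ?V}"
      by (intro ind) auto
    then show "indep_vars (\<lambda>_. borel) (\<lambda>i \<omega>. ennreal (f i) ^ num_points (L (f i)) (C \<omega>)) {..<card ?V}"
      by (rule indep_vars_compose2[where Y = "\<lambda>i k. ennreal (f i) ^ k"]) simp
  qed auto
  also have "\<dots> = (\<Prod>v\<in>?V. \<integral>\<^sup>+\<omega>. ennreal v ^ num_points (L v) (C \<omega>) \<partial>M)"
    by (rule prod.reindex_bij_betw[OF f])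
  also have "\<dots> = (\<Prod>v\<in>?V. ennreal (exp (v * rate v - rate v)))"
  proof (rule prod.cong[OF refl])
    fix v assume v: "v \<in> ?V"
    show "(\<integral>\<^sup>+\<omega>. ennreal v ^ num_points (L v) (C \<omega>) \<partial>M) = ennreal (exp (v * rate v - rate v))"
      using pr[OF L[of v]] rate_nonneg V0[OF v] by (intro poisson_pgf) (auto simp: rate_def)
  qed
  also have "\<dots> = ennreal (exp (\<Sum>v\<in>?V. v * rate v - rate v))"
    using finV by (simp add: prod_ennreal exp_sum)
  also have "(\<Sum>v\<in>?V. v * rate v - rate v) = (LINT z|N. h z * l_c z) - (LINT z|N. l_c z)"
    using sum_eq[of "\<lambda>v. v"] sum_eq[of "\<lambda>_. 1"] by (simp add: sum_subtractf)
  finally show ?thesis .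
qed

text \<open>Independence is a constant conditional law. The library's \<open>indep_var\<close> needs both variables to
  have the same type, which fails for a pair and a single configuration.\<close>

lemma (in prob_space) nn_integral_indep_set:
  assumes X: "X \<in> M \<rightarrow>\<^sub>M S" and Y: "Y \<in> M \<rightarrow>\<^sub>M T"
    and ind: "indep_set {X -` A \<inter> space M | A. A \<in> sets S} {Y -` A \<inter> space M | A. A \<in> sets T}"
    and f: "f \<in> borel_measurable S" and g: "g \<in> borel_measurable T"
  shows "(\<integral>\<^sup>+\<omega>. f (X \<omega>) * g (Y \<omega>) \<partial>M) = (\<integral>\<^sup>+\<omega>. f (X \<omega>) \<partial>M) * (\<integral>\<^sup>+\<omega>. g (Y \<omega>) \<partial>M)"
proof -
  note [measurable] = X Y
  let ?D = "distr M T Y"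
  interpret D: prob_space ?D by (rule prob_space_distr[OF Y])
  have "regular_cond_distr M X S Y T (\<lambda>_. ?D)"
    unfolding regular_cond_distr_def
  proof (intro conjI ballI X Y)
    show "(\<lambda>_. ?D) \<in> S \<rightarrow>\<^sub>M prob_algebra T"
      using D.prob_space_axioms by (intro measurable_const) (simp add: space_prob_algebra)
    fix A B assume [measurable]: "A \<in> sets S" "B \<in> sets T"
    have "{\<omega> \<in> space M. X \<omega> \<in> A \<and> Y \<omega> \<in> B} = (X -` A \<inter> space M) \<inter> (Y -` B \<inter> space M)"
      by auto
    moreover have "prob ((X -` A \<inter> space M) \<inter> (Y -` B \<inter> space M)) = prob (X -` A \<inter> space M) * prob (Y -` B \<inter> space M)"
      by (rule indep_setD[OF ind]) (use \<open>A \<in> sets S\<close> \<open>B \<in> sets T\<close> in blast)+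
    ultimately have "emeasure M {\<omega> \<in> space M. X \<omega> \<in> A \<and> Y \<omega> \<in> B} =
        emeasure M (X -` A \<inter> space M) * emeasure M (Y -` B \<inter> space M)"
      by (simp add: emeasure_eq_measure ennreal_mult)
    also have "\<dots> = (\<integral>\<^sup>+ \<omega>. indicator (X -` A \<inter> space M) \<omega> * emeasure ?D B \<partial>M)"
      by (simp add: nn_integral_multc emeasure_distr)
    also have "\<dots> = (\<integral>\<^sup>+ \<omega>. indicator A (X \<omega>) * emeasure ?D B \<partial>M)"
      by (intro nn_integral_cong) (auto simp: indicator_def)
    finally show "emeasure M {\<omega> \<in> space M. X \<omega> \<in> A \<and> Y \<omega> \<in> B} =
        (\<integral>\<^sup>+ \<omega>. indicator A (X \<omega>) * emeasure ?D B \<partial>M)" .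
  qed
  from regular_cond_distr_nn_integral[OF this f g] show ?thesis
    using f g by (simp add: nn_integral_distr nn_integral_multc)
qed

section \<open>Generating functional of the detections\<close>

context detection_model
begin

lemma prob_space_displacement:
  assumes "x \<in> space N"
  shows "prob_space (density N (\<lambda>z. ennreal (l_d z x)))"
proof (rule prob_spaceI)
  have "(\<integral>\<^sup>+z. ennreal (l_d z x) * indicator (space N) z \<partial>N) = (\<integral>\<^sup>+z. ennreal (l_d z x) \<partial>N)"
    by (intro nn_integral_cong) simp
  then show "emeasure (density N (\<lambda>z. ennreal (l_d z x))) (space (density N (\<lambda>z. ennreal (l_d z x)))) = 1"
    using assms l_d_density by (simp add: emeasure_density)
qed

lemma detection_law_measurable:
  "(\<lambda>(b, z). if b then {#z#} else {#}) \<in>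
    measure_pmf q \<Otimes>\<^sub>M density N f \<rightarrow>\<^sub>M conf N"
proof (rule measurable_conf)
  fix B assume [measurable]: "B \<in> sets N"
  have "(\<lambda>w. num_points B (case w of (b, z) \<Rightarrow> if b then {#z#} else {#})) =
      (\<lambda>w. if fst w then of_bool (snd w \<in> B) else 0)"
    by (auto simp: fun_eq_iff)
  then show "(\<lambda>w. num_points B (case w of (b, z) \<Rightarrow> if b then {#z#} else {#})) \<in>
      measure_pmf q \<Otimes>\<^sub>M density N f \<rightarrow>\<^sub>M count_space UNIV"
    unfolding of_bool_def by simp
qed (auto simp: space_pair_measure split: if_splits)

lemma prob_space_detection_law:
  assumes "x \<in> space N"
  shows "prob_space (detection_law N p_d l_d x)"
proof -
  interpret D: prob_space "density N (\<lambda>z. ennreal (l_d z x))"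
    by (rule prob_space_displacement[OF assms])
  interpret P: pair_prob_space "measure_pmf (bernoulli_pmf p_d)" "density N (\<lambda>z. ennreal (l_d z x))" ..
  show ?thesis
    unfolding detection_law_def by (rule P.prob_space_distr[OF detection_law_measurable])
qed

text \<open>A missed point, of probability \<open>1 - p_d\<close>, contributes the empty product 1;
  a kept point contributes \<open>h\<close> averaged over its displacement.\<close>

lemma detection_law_pgf:
  assumes x: "x \<in> space N" and h: "simple_function N h"
  shows "(\<integral>\<^sup>+\<phi>. (\<Prod>y\<in>#\<phi>. h y) \<partial>detection_law N p_d l_d x) =
    ennreal (1 - p_d) + (\<integral>\<^sup>+z. h z * kern z x \<partial>N)"
proof -
  let ?D = "density N (\<lambda>z. ennreal (l_d z x))"
  interpret D: prob_space ?D by (rule prob_space_displacement[OF x])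
  have [measurable]: "h \<in> borel_measurable N" using h by (rule borel_measurable_simple_function)
  have "(\<integral>\<^sup>+\<phi>. (\<Prod>y\<in>#\<phi>. h y) \<partial>detection_law N p_d l_d x) =
      (\<integral>\<^sup>+w. (if fst w then h (snd w) else 1) \<partial>(measure_pmf (bernoulli_pmf p_d) \<Otimes>\<^sub>M ?D))"
    unfolding detection_law_def
    using prod_mset_measurable[OF h]
    by (subst nn_integral_distr[OF detection_law_measurable]) (auto intro!: nn_integral_cong)
  also have "\<dots> = (\<integral>\<^sup>+b. \<integral>\<^sup>+z. (if b then h z else 1) \<partial>?D \<partial>measure_pmf (bernoulli_pmf p_d))"
    by (subst D.nn_integral_fst[symmetric]) (simp_all cong: if_cong)
  also have "\<dots> = (\<integral>\<^sup>+z. h z \<partial>?D) * ennreal p_d + ennreal (1 - p_d)"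
    using p_d D.emeasure_space_1 by simp
  also have "(\<integral>\<^sup>+z. h z \<partial>?D) * ennreal p_d = (\<integral>\<^sup>+z. h z * kern z x \<partial>N)"
  proof -
    have "(\<integral>\<^sup>+z. h z \<partial>?D) * ennreal p_d = (\<integral>\<^sup>+z. ennreal (l_d z x) * h z * ennreal p_d \<partial>N)"
      using x by (simp add: nn_integral_density nn_integral_multc)
    also have "\<dots> = (\<integral>\<^sup>+z. h z * kern z x \<partial>N)"
      using p_d by (intro nn_integral_cong) (simp add: ennreal_mult' ac_simps)
    finally show ?thesis .
  qed
  finally show ?thesis by (simp add: add.commute)
qed

text \<open>Outcomes of different occurrences are independent, so the integral factorizes; grouping
  the indices \<open>(x, i)\<close> by \<open>x\<close> restores the multiplicities.\<close>

lemma detections_law_pgf: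
  assumes \<phi>: "\<phi> \<in> space (conf N)" and h: "simple_function N h"
  shows "(\<integral>\<^sup>+\<psi>. (\<Prod>y\<in>#\<psi>. h y) \<partial>detections_law N p_d l_d \<phi>) =
    (\<Prod>x\<in>#\<phi>. ennreal (1 - p_d) + (\<integral>\<^sup>+z. h z * kern z x \<partial>N))"
proof -
  define I where "I = (SIGMA x : set_mset \<phi>. {..<count \<phi> x})"
  have fin: "finite I" by (simp add: I_def)
  \<comment> \<open>Outside \<open>I\<close> a point mass serves as default, because the product
    space requires a probability measure at every index.\<close>
  define K where "K k = (if k \<in> I then detection_law N p_d l_d (fst k) else return (conf N) {#})" for k
  have IN: "fst k \<in> space N" if "k \<in> I" for k
    using that \<phi> by (auto simp: I_def space_conf)
  have K: "prob_space (K k)" for k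
    unfolding K_def using IN prob_space_detection_law by (auto intro: prob_space_return simp: space_conf)
  have sets_K [measurable_cong]: "sets (K k) = sets (conf N)" for k
    by (simp add: K_def detection_law_def)
  interpret K: product_prob_space K by (intro product_prob_spaceI K)
  have PiM: "Pi\<^sub>M I (\<lambda>(x, i). detection_law N p_d l_d x) = Pi\<^sub>M I K"
    by (intro PiM_cong) (auto simp: K_def)
  have sum_meas: "(\<lambda>D. \<Sum>k\<in>I. D k) \<in> Pi\<^sub>M I K \<rightarrow>\<^sub>M conf N"
  proof (rule measurable_conf)
    fix B assume [measurable]: "B \<in> sets N"
    show "(\<lambda>D. num_points B (\<Sum>k\<in>I. D k)) \<in> Pi\<^sub>M I K \<rightarrow>\<^sub>M count_space UNIV"
      unfolding num_points_sum by measurable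
  next
    fix D assume D: "D \<in> space (Pi\<^sub>M I K)"
    have "set_mset (D k) \<subseteq> space N" if "k \<in> I" for k
      using D that sets_eq_imp_space_eq[OF sets_K] by (auto simp: space_PiM PiE_iff space_conf)
    then have "\<forall>k\<in>I. set_mset (D k) \<subseteq> space N" by blast
    with fin show "set_mset (\<Sum>k\<in>I. D k) \<subseteq> space N"
      by (induction I rule: finite_induct) auto
  qed
  have prod: "(\<Prod>y\<in>#(\<Sum>k\<in>I. D k). h y) = (\<Prod>k\<in>I. \<Prod>y\<in>#D k. h y)" for D
    using fin by (induction I rule: finite_induct) auto
  have "(\<integral>\<^sup>+\<psi>. (\<Prod>y\<in>#\<psi>. h y) \<partial>detections_law N p_d l_d \<phi>) =
      (\<integral>\<^sup>+D. (\<Prod>k\<in>I. \<Prod>y\<in>#D k. h y) \<partial>Pi\<^sub>M I K)"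
    unfolding detections_law_def Let_def I_def[symmetric] PiM prod[symmetric]
    using prod_mset_measurable[OF h] by (intro nn_integral_distr[OF sum_meas]) simp
  also have "\<dots> = (\<Prod>k\<in>I. \<integral>\<^sup>+\<psi>. (\<Prod>y\<in>#\<psi>. h y) \<partial>K k)"
    using prod_mset_measurable[OF h] fin
    by (intro K.product_nn_integral_prod) (simp_all cong: measurable_cong_sets)
  also have "\<dots> = (\<Prod>k\<in>I. ennreal (1 - p_d) + (\<integral>\<^sup>+z. h z * kern z (fst k) \<partial>N))"
    by (intro prod.cong refl) (simp add: K_def detection_law_pgf[OF IN h])
  also have "\<dots> = (\<Prod>x\<in>set_mset \<phi>. \<Prod>i<count \<phi> x. ennreal (1 - p_d) + (\<integral>\<^sup>+z. h z * kern z x \<partial>N))"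
    unfolding I_def by (subst prod.Sigma) (auto intro!: prod.cong)
  also have "\<dots> = (\<Prod>x\<in>#\<phi>. ennreal (1 - p_d) + (\<integral>\<^sup>+z. h z * kern z x \<partial>N))"
    by (simp add: image_prod_mset_multiplicity)
  finally show ?thesis .
qed

end

section \<open>The joint law of the hidden and the measured process\<close>

locale measurement_model = detection_model N p_d l_d l_c + M: prob_space M
  for N :: "'a measure" and p_d l_d l_c and M :: "'w measure" +
  fixes \<Phi> \<Xi> :: "'w \<Rightarrow> 'a multiset" and j :: "nat \<Rightarrow> (nat \<Rightarrow> 'a) \<Rightarrow> real"
  assumes janossy: "janossy_densities M N \<Phi> j"
    and measurement: "measurement_process M N p_d l_d l_c \<Phi> \<Xi>"
begin

lemma j_measurable [measurable]: "j n \<in> borel_measurable (Pi\<^sub>M {..<n} (\<lambda>_. N))"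
  using janossy by (simp add: janossy_densities_def)

lemma j_symmetric: "symmetric_on n N (j n)"
  using janossy unfolding janossy_densities_def symmetric_on_def by blast

lemma nn_integral_janossy:
  assumes F: "F \<in> borel_measurable (conf N)" and supp: "\<And>\<phi>. size \<phi> \<noteq> n \<Longrightarrow> F \<phi> = 0"
  shows "(\<integral>\<^sup>+\<omega>. F (\<Phi> \<omega>) \<partial>M) =
    ennreal (1 / fact n) * (\<integral>\<^sup>+x. F (config_of n x) * ennreal (j n x) \<partial>Pi\<^sub>M {..<n} (\<lambda>_. N))"
proof -
  have "(\<integral>\<^sup>+\<omega>. F (\<Phi> \<omega>) \<partial>M) = (\<Sum>k. ennreal (1 / fact k) *
      (\<integral>\<^sup>+x. F (config_of k x) * ennreal (j k x) \<partial>Pi\<^sub>M {..<k} (\<lambda>_. N)))"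
    using janossy F by (simp add: janossy_densities_def)
  also have "\<dots> = (\<Sum>k\<in>{n}. ennreal (1 / fact k) *
      (\<integral>\<^sup>+x. F (config_of k x) * ennreal (j k x) \<partial>Pi\<^sub>M {..<k} (\<lambda>_. N)))"
    by (rule suminf_finite) (auto simp: supp)
  finally show ?thesis by simp
qed

lemma measurement_measurable [measurable]:
  "\<Phi> \<in> M \<rightarrow>\<^sub>M conf N" "\<Xi> \<in> M \<rightarrow>\<^sub>M conf N"
proof -
  obtain D C where rcd: "regular_cond_distr M \<Phi> (conf N) D (conf N) (detections_law N p_d l_d)"
    and C: "poisson_point_process M N l_c C" and \<Xi>: "\<And>\<omega>. \<omega> \<in> space M \<Longrightarrow> \<Xi> \<omega> = D \<omega> + C \<omega>"
    using measurement by (auto simp: measurement_process_def)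
  show "\<Phi> \<in> M \<rightarrow>\<^sub>M conf N"
    using rcd by (simp add: regular_cond_distr_def)
  have "(\<lambda>\<omega>. (D \<omega>, C \<omega>)) \<in> M \<rightarrow>\<^sub>M conf N \<Otimes>\<^sub>M conf N"
    using rcd C by (intro measurable_Pair) (auto simp: regular_cond_distr_def poisson_point_process_def)
  from measurable_compose[OF this plus_measurable_conf] have "(\<lambda>\<omega>. D \<omega> + C \<omega>) \<in> M \<rightarrow>\<^sub>M conf N"
    by simp
  then show "\<Xi> \<in> M \<rightarrow>\<^sub>M conf N"
    by (subst measurable_cong[OF \<Xi>])
qed

text \<open>Independence splits off the clutter factor, conditioning on \<Phi> replaces the
  detections by a product over the hidden points, and the Janossy formula turns the expectation into
  an integral over \<open>n\<close> points.\<close>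

lemma measurement_pgf:
  assumes g[measurable]: "g \<in> borel_measurable (conf N)" and supp: "\<And>\<phi>. size \<phi> \<noteq> n \<Longrightarrow> g \<phi> = 0"
    and h: "simple_function N h" "\<And>x. 0 \<le> h x" "\<And>x. h x \<le> (1::real)"
  shows "(\<integral>\<^sup>+\<omega>. g (\<Phi> \<omega>) * (\<Prod>x\<in>#\<Xi> \<omega>. ennreal (h x)) \<partial>M) =
    ennreal (exp ((LINT z|N. h z * l_c z) - (LINT z|N. l_c z))) * (ennreal (1 / fact n) *
      (\<integral>\<^sup>+x. g (config_of n x) * ennreal (j n x) *
        (\<Prod>i<n. ennreal (1 - p_d) + (\<integral>\<^sup>+z. ennreal (h z) * kern z (x i) \<partial>N)) \<partial>Pi\<^sub>M {..<n} (\<lambda>_. N)))"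
proof -
  let ?\<Pi> = "\<lambda>\<phi>. \<Prod>x\<in>#\<phi>. ennreal (h x)"
  obtain D C where rcd: "regular_cond_distr M \<Phi> (conf N) D (conf N) (detections_law N p_d l_d)"
    and C: "poisson_point_process M N l_c C" and \<Xi>: "\<And>\<omega>. \<omega> \<in> space M \<Longrightarrow> \<Xi> \<omega> = D \<omega> + C \<omega>"
    and ind: "M.indep_set {(\<lambda>\<omega>. (\<Phi> \<omega>, D \<omega>)) -` A \<inter> space M | A. A \<in> sets (conf N \<Otimes>\<^sub>M conf N)}
              {C -` A \<inter> space M | A. A \<in> sets (conf N)}"
    using measurement by (auto simp: measurement_process_def)
  have h': "simple_function N (\<lambda>x. ennreal (h x))"
    by (rule simple_function_compose1[OF h(1)])
  note pgf_meas [measurable] = prod_mset_measurable[OF h']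
  have [measurable]: "D \<in> M \<rightarrow>\<^sub>M conf N" "C \<in> M \<rightarrow>\<^sub>M conf N"
    and law: "detections_law N p_d l_d \<in> conf N \<rightarrow>\<^sub>M prob_algebra (conf N)"
    using rcd C by (auto simp: regular_cond_distr_def poisson_point_process_def)
  have law' [measurable]: "detections_law N p_d l_d \<in> conf N \<rightarrow>\<^sub>M subprob_algebra (conf N)"
    by (rule measurable_prob_algebraD[OF law])
  \<comment> \<open>The conditional expectation of the detection product given \<Phi>, weighted by
    \<open>g\<close>, as a function of the configuration.\<close>
  define F where "F \<phi> = g \<phi> * (\<integral>\<^sup>+\<psi>. ?\<Pi> \<psi> \<partial>detections_law N p_d l_d \<phi>)" for \<phi>
  have F_meas: "F \<in> borel_measurable (conf N)"
    unfolding F_def[abs_def]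
    by (intro borel_measurable_times_ennreal g measurable_compose[OF law' nn_integral_measurable_subprob_algebra] pgf_meas)
  \<comment> \<open>The product is grouped as a function of the pair of \<Phi> and \<open>D\<close>
    times one of \<open>C\<close>, the form in which independence is assumed.\<close>
  have "(\<integral>\<^sup>+\<omega>. g (\<Phi> \<omega>) * ?\<Pi> (\<Xi> \<omega>) \<partial>M) = (\<integral>\<^sup>+\<omega>. (case (\<Phi> \<omega>, D \<omega>) of (\<phi>, \<psi>) \<Rightarrow> g \<phi> * ?\<Pi> \<psi>) * ?\<Pi> (C \<omega>) \<partial>M)"
    by (intro nn_integral_cong) (simp add: \<Xi> mult.assoc)
  also have "\<dots> = (\<integral>\<^sup>+\<omega>. (case (\<Phi> \<omega>, D \<omega>) of (\<phi>, \<psi>) \<Rightarrow> g \<phi> * ?\<Pi> \<psi>) \<partial>M) * (\<integral>\<^sup>+\<omega>. ?\<Pi> (C \<omega>) \<partial>M)"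
    by (rule M.nn_integral_indep_set[OF _ _ ind]) measurable
  also have "(\<integral>\<^sup>+\<omega>. (case (\<Phi> \<omega>, D \<omega>) of (\<phi>, \<psi>) \<Rightarrow> g \<phi> * ?\<Pi> \<psi>) \<partial>M) = (\<integral>\<^sup>+\<omega>. F (\<Phi> \<omega>) \<partial>M)"
    using regular_cond_distr_nn_integral[OF rcd g pgf_meas] by (simp add: F_def)
  also have "\<dots> = ennreal (1 / fact n) * (\<integral>\<^sup>+x. F (config_of n x) * ennreal (j n x) \<partial>Pi\<^sub>M {..<n} (\<lambda>_. N))"
    by (rule nn_integral_janossy[OF F_meas]) (simp add: F_def supp)
  also have "(\<integral>\<^sup>+x. F (config_of n x) * ennreal (j n x) \<partial>Pi\<^sub>M {..<n} (\<lambda>_. N)) =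
      (\<integral>\<^sup>+x. g (config_of n x) * ennreal (j n x) *
        (\<Prod>i<n. ennreal (1 - p_d) + (\<integral>\<^sup>+z. ennreal (h z) * kern z (x i) \<partial>N)) \<partial>Pi\<^sub>M {..<n} (\<lambda>_. N))"
  proof (rule nn_integral_cong)
    fix x assume "x \<in> space (Pi\<^sub>M {..<n} (\<lambda>_. N))"
    then have "config_of n x \<in> space (conf N)"
      by (rule measurable_space[OF config_of_measurable])
    then show "F (config_of n x) * ennreal (j n x) = g (config_of n x) * ennreal (j n x) *
        (\<Prod>i<n. ennreal (1 - p_d) + (\<integral>\<^sup>+z. ennreal (h z) * kern z (x i) \<partial>N))"
      by (simp add: F_def detections_law_pgf[OF _ h'] prod_mset_config_of ac_simps)
  qed
  finally show ?thesis
    by (simp add: M.poisson_point_process_pgf[OF C l_c_nonneg l_c_integrable h] mult.commute)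
qed

text \<open>Both sides are measures in \<open>F\<close>; their generating functionals agree because replacing \<open>h\<close> by
  \<open>s * h\<close> separates the sizes \<open>m\<close> as the coefficients of a power series in \<open>s\<close>.\<close>

lemma measurement_law:
  assumes g[measurable]: "g \<in> borel_measurable (conf N)" and supp: "\<And>\<phi>. size \<phi> \<noteq> n \<Longrightarrow> g \<phi> = 0"
    and fin: "(\<integral>\<^sup>+\<omega>. g (\<Phi> \<omega>) \<partial>M) < \<infinity>" and F[measurable]: "F \<in> borel_measurable (conf N)"
  shows "(\<integral>\<^sup>+\<omega>. g (\<Phi> \<omega>) * (of_bool (size (\<Xi> \<omega>) = m) * F (\<Xi> \<omega>)) \<partial>M) =
    ennreal (exp (- (LINT z|N. l_c z)) / fact m) *
    (\<integral>\<^sup>+z. F (config_of m z) * weight n (\<lambda>x. g (config_of n x) * ennreal (j n x)) m z \<partial>Pi\<^sub>M {..<m} (\<lambda>_. N))"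
proof -
  define u where "u x = g (config_of n x) * ennreal (j n x)" for x
  let ?E = "exp (- (LINT z|N. l_c z))"
  let ?Pm = "\<lambda>m. Pi\<^sub>M {..<m} (\<lambda>_. N)"
  have u_sym: "symmetric_on n N u"
    using j_symmetric[of n] by (auto simp: symmetric_on_def u_def config_of_permute)
  have u_meas [measurable]: "u \<in> borel_measurable (?Pm n)"
    unfolding u_def[abs_def] by measurable
  note w_meas [measurable] = weight_measurable[OF u_meas]
  \<comment> \<open>\<open>g\<close> is absorbed into the measure: \<open>P m\<close> is the law of
    \<Xi> weighted by \<open>g (\<Phi> \<omega>)\<close> on the event of \<open>m\<close>
    measurements, and \<open>Q m\<close> is its proposed form.\<close>
  define P where "P m = distr (density M (\<lambda>\<omega>. g (\<Phi> \<omega>) * of_bool (size (\<Xi> \<omega>) = m))) (conf N) \<Xi>" for m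
  define Q where "Q m = distr (density (?Pm m) (\<lambda>z. ennreal (?E / fact m) * weight n u m z)) (conf N) (config_of m)" for m
  have P: "(\<integral>\<^sup>+\<phi>. f \<phi> \<partial>P m) = (\<integral>\<^sup>+\<omega>. g (\<Phi> \<omega>) * (of_bool (size (\<Xi> \<omega>) = m) * f (\<Xi> \<omega>)) \<partial>M)"
    if [measurable]: "f \<in> borel_measurable (conf N)" for f m
    unfolding P_def by (subst nn_integral_distr; (subst nn_integral_density)?; simp add: mult.assoc)
  have Q: "(\<integral>\<^sup>+\<phi>. f \<phi> \<partial>Q m) = ennreal (?E / fact m) * (\<integral>\<^sup>+z. f (config_of m z) * weight n u m z \<partial>?Pm m)"
    if [measurable]: "f \<in> borel_measurable (conf N)" for f m
    unfolding Q_def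
    by (subst nn_integral_distr; (subst nn_integral_density)?; (subst nn_integral_cmult[symmetric])?; simp add: ac_simps)
  have "P m = Q m"
  proof (rule conf_measure_eqI)
    have le: "(\<integral>\<^sup>+\<omega>. g (\<Phi> \<omega>) * (of_bool (size (\<Xi> \<omega>) = m) * 1) \<partial>M) \<le> (\<integral>\<^sup>+\<omega>. g (\<Phi> \<omega>) \<partial>M)"
      by (intro nn_integral_mono) (auto simp: of_bool_def)
    have "emeasure (P m) (space (P m)) = (\<integral>\<^sup>+\<phi>. 1 \<partial>P m)"
      by simp
    also have "\<dots> < \<infinity>"
      using le fin by (subst P) (auto intro: le_less_trans)
    finally show "emeasure (P m) (space (P m)) < \<infinity>" .
    fix h' :: "'a \<Rightarrow> ennreal" assume h': "simple_function N h'" "\<And>x. h' x \<le> 1"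
    \<comment> \<open>\<open>h'\<close> is at most 1, hence finite; the Poisson formula uses real
      integrals and therefore a real test function.\<close>
    define h where "h x = enn2real (h' x)" for x
    have h: "simple_function N h" "\<And>x. 0 \<le> h x" "\<And>x. h x \<le> 1" and hh': "h' = (\<lambda>x. ennreal (h x))"
    proof -
      show "simple_function N h"
        unfolding h_def by (rule simple_function_compose1[OF h'(1)])
      have *: "h' x < \<infinity>" for x using le_less_trans[OF h'(2)[of x]] by simp
      then show "h' = (\<lambda>x. ennreal (h x))"
        by (simp add: h_def)
      then show "h x \<le> 1" for x using h'(2)[of x] by simp
    qed (simp add: h_def)
    note pgf_meas [measurable] = prod_mset_measurable[OF h'(1)]
    note h_meas [measurable] = borel_measurable_simple_function[OF h(1)]
    have size_pgf: "(\<Sum>m. (\<integral>\<^sup>+\<omega>. g (\<Phi> \<omega>) * (of_bool (size (\<Xi> \<omega>) = m) * (\<Prod>x\<in>#\<Xi> \<omega>. h' x)) \<partial>M) * ennreal s ^ m) =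
        (\<integral>\<^sup>+\<omega>. g (\<Phi> \<omega>) * (\<Prod>x\<in>#\<Xi> \<omega>. ennreal (s * h x)) \<partial>M)" if s: "0 \<le> s" "s \<le> 1" for s
    proof -
      have "(\<Sum>m. of_bool (size \<phi> = m) * ennreal s ^ m) = ennreal s ^ size \<phi>" for \<phi> :: "'a multiset"
        by (subst suminf_finite[of "{size \<phi>}"]) auto
      moreover have "(\<Prod>x\<in>#\<phi>. ennreal (s * h x)) = ennreal s ^ size \<phi> * (\<Prod>x\<in>#\<phi>. h' x)" for \<phi>
        using s h(2) by (induction \<phi>) (auto simp: hh' ennreal_mult ac_simps)
      ultimately have *: "(\<Sum>m. (g \<phi>' * (of_bool (size \<phi> = m) * (\<Prod>x\<in>#\<phi>. h' x))) * ennreal s ^ m) =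
          g \<phi>' * (\<Prod>x\<in>#\<phi>. ennreal (s * h x))" for \<phi> \<phi>'
        using ennreal_suminf_cmult[of "g \<phi>' * (\<Prod>x\<in>#\<phi>. h' x)" "\<lambda>m. of_bool (size \<phi> = m) * ennreal s ^ m"]
        by (simp add: ac_simps)
      have "(\<Sum>m. (\<integral>\<^sup>+\<omega>. g (\<Phi> \<omega>) * (of_bool (size (\<Xi> \<omega>) = m) * (\<Prod>x\<in>#\<Xi> \<omega>. h' x)) \<partial>M) * ennreal s ^ m) =
          (\<Sum>m. \<integral>\<^sup>+\<omega>. (g (\<Phi> \<omega>) * (of_bool (size (\<Xi> \<omega>) = m) * (\<Prod>x\<in>#\<Xi> \<omega>. h' x))) * ennreal s ^ m \<partial>M)"
        by (intro suminf_cong nn_integral_multc[symmetric]) measurable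
      also have "\<dots> = (\<integral>\<^sup>+\<omega>. (\<Sum>m. (g (\<Phi> \<omega>) * (of_bool (size (\<Xi> \<omega>) = m) * (\<Prod>x\<in>#\<Xi> \<omega>. h' x))) * ennreal s ^ m) \<partial>M)"
        by (intro nn_integral_suminf[symmetric]) measurable
      finally show ?thesis unfolding * .
    qed
    have "(\<integral>\<^sup>+\<omega>. g (\<Phi> \<omega>) * (of_bool (size (\<Xi> \<omega>) = m) * (\<Prod>x\<in>#\<Xi> \<omega>. h' x)) \<partial>M) =
        ennreal (?E / fact m) * (\<integral>\<^sup>+z. (\<Prod>i<m. h' (z i)) * weight n u m z \<partial>?Pm m)"
    proof (rule ennreal_powser_unique)
      have "(\<Sum>m. (\<integral>\<^sup>+\<omega>. g (\<Phi> \<omega>) * (of_bool (size (\<Xi> \<omega>) = m) * (\<Prod>x\<in>#\<Xi> \<omega>. h' x)) \<partial>M)) =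
          (\<integral>\<^sup>+\<omega>. g (\<Phi> \<omega>) * (\<Prod>x\<in>#\<Xi> \<omega>. ennreal (h x)) \<partial>M)"
        using size_pgf[of 1] by simp
      also have "\<dots> \<le> (\<integral>\<^sup>+\<omega>. g (\<Phi> \<omega>) * 1 \<partial>M)"
      proof (intro nn_integral_mono mult_left_mono)
        fix \<omega>
        have "(\<Prod>x\<in>#\<phi>. ennreal (h x)) \<le> 1" for \<phi>
          using h'(2) by (induction \<phi>) (auto simp: hh' mult_le_one)
        then show "(\<Prod>x\<in>#\<Xi> \<omega>. ennreal (h x)) \<le> 1" .
      qed simp
      finally show "(\<Sum>m. (\<integral>\<^sup>+\<omega>. g (\<Phi> \<omega>) * (of_bool (size (\<Xi> \<omega>) = m) * (\<Prod>x\<in>#\<Xi> \<omega>. h' x)) \<partial>M)) < \<infinity>"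
        using fin by (auto intro: le_less_trans)
      fix s :: real assume s: "0 \<le> s" "s \<le> 1"
      let ?hs = "\<lambda>z. s * h z"
      let ?L = "LINT z|N. ?hs z * l_c z"
      have hs: "simple_function N ?hs" "\<And>x. 0 \<le> ?hs x" "\<And>x. ?hs x \<le> 1"
        using s h by (auto intro: simple_function_mult simple_function_const mult_le_one)
      have int: "integrable N (\<lambda>z. ?hs z * l_c z)"
        using hs l_c_nonneg s
        by (intro Bochner_Integration.integrable_bound[OF l_c_integrable])
           (auto simp: abs_mult h(2) intro!: AE_I2 mult_left_le_one_le)
      have L: "(\<integral>\<^sup>+z. ennreal (?hs z) * ennreal (l_c z) \<partial>N) = ennreal ?L" "0 \<le> ?L"
      proof -
        have "(\<integral>\<^sup>+z. ennreal (?hs z) * ennreal (l_c z) \<partial>N) = (\<integral>\<^sup>+z. ennreal (?hs z * l_c z) \<partial>N)"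
          using hs l_c_nonneg by (intro nn_integral_cong) (simp add: ennreal_mult)
        also have "\<dots> = ennreal ?L"
          using hs(2) l_c_nonneg by (intro nn_integral_eq_integral[OF int]) auto
        finally show "(\<integral>\<^sup>+z. ennreal (?hs z) * ennreal (l_c z) \<partial>N) = ennreal ?L" .
        show "0 \<le> ?L" using hs(2) l_c_nonneg by (intro integral_nonneg_AE) auto
      qed
      have prod_s: "(\<Prod>i<m. ennreal (?hs (z i))) = (\<Prod>i<m. h' (z i)) * ennreal s ^ m" for z m
        using s h(2) by (simp add: hh' ennreal_mult prod.distrib mult.commute)
      have term_eq: "ennreal (?E / fact m) * (\<integral>\<^sup>+z. (\<Prod>i<m. h' (z i)) * weight n u m z \<partial>?Pm m) * ennreal s ^ m =
          ennreal ?E * (ennreal (1 / fact m) * (\<integral>\<^sup>+z. (\<Prod>i<m. ennreal (?hs (z i))) * weight n u m z \<partial>?Pm m))" for m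
      proof -
        have [measurable]: "(\<lambda>z. \<Prod>i<m. h' (z i)) \<in> borel_measurable (?Pm m)"
          using borel_measurable_simple_function[OF h'(1)] by (intro prod_component_measurable) auto
        have "(\<integral>\<^sup>+z. (\<Prod>i<m. ennreal (?hs (z i))) * weight n u m z \<partial>?Pm m) =
            (\<integral>\<^sup>+z. ((\<Prod>i<m. h' (z i)) * weight n u m z) * ennreal s ^ m \<partial>?Pm m)"
          unfolding prod_s by (simp only: ac_simps)
        also have "\<dots> = (\<integral>\<^sup>+z. (\<Prod>i<m. h' (z i)) * weight n u m z \<partial>?Pm m) * ennreal s ^ m"
          by (rule nn_integral_multc) measurable
        finally show ?thesis
          using ennreal_mult[of ?E "1 / fact m"] by (simp add: mult.assoc)
      qed
      have "(\<Sum>m. ennreal (?E / fact m) * (\<integral>\<^sup>+z. (\<Prod>i<m. h' (z i)) * weight n u m z \<partial>?Pm m) * ennreal s ^ m) =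
          ennreal ?E * (ennreal (exp ?L) * (ennreal (1 / fact n) *
            (\<integral>\<^sup>+x. u x * (\<Prod>i<n. ennreal (1 - p_d) + (\<integral>\<^sup>+z. ennreal (?hs z) * kern z (x i) \<partial>N)) \<partial>?Pm n)))"
        unfolding term_eq using weight_generating_function[OF u_sym u_meas _ L(2,1)] by simp
      \<comment> \<open>The normalization \<open>?E\<close> and the factor \<open>exp ?L\<close>
        from the clutter sum combine to the exponential in the Poisson generating
        functional.\<close>
      also have "\<dots> = (\<integral>\<^sup>+\<omega>. g (\<Phi> \<omega>) * (\<Prod>x\<in>#\<Xi> \<omega>. ennreal (?hs x)) \<partial>M)"
        using ennreal_mult[of ?E "exp ?L"] measurement_pgf[OF g supp hs]
        by (simp add: u_def mult.assoc exp_diff exp_minus divide_inverse mult.commute[of "inverse _"])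
      finally show "(\<Sum>m. (\<integral>\<^sup>+\<omega>. g (\<Phi> \<omega>) * (of_bool (size (\<Xi> \<omega>) = m) * (\<Prod>x\<in>#\<Xi> \<omega>. h' x)) \<partial>M) * ennreal s ^ m) =
          (\<Sum>m. ennreal (?E / fact m) * (\<integral>\<^sup>+z. (\<Prod>i<m. h' (z i)) * weight n u m z \<partial>?Pm m) * ennreal s ^ m)"
        using size_pgf[OF s] by simp
    qed
    then show "(\<integral>\<^sup>+\<phi>. (\<Prod>x\<in>#\<phi>. h' x) \<partial>P m) = (\<integral>\<^sup>+\<phi>. (\<Prod>x\<in>#\<phi>. h' x) \<partial>Q m)"
      by (simp add: P Q prod_mset_config_of)
  qed (simp_all add: P_def Q_def)
  then have "(\<integral>\<^sup>+\<phi>. F \<phi> \<partial>P m) = (\<integral>\<^sup>+\<phi>. F \<phi> \<partial>Q m)" by simp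
  then show ?thesis
    unfolding P[OF F] Q[OF F] by (simp only: u_def[abs_def])
qed

end

section \<open>The conditional first moment\<close>

text \<open>Countability provides one exceptional null set for all test sets, stability the
  extension to all Borel sets. Finite intersections of a countable basis have both properties, and
  the empty intersection is \<open>UNIV\<close>.\<close>

lemma countable_Int_stable_generator_borel:
  obtains G :: "'a::second_countable_topology set set"
  where "countable G" "Int_stable G" "UNIV \<in> G" "sets borel = sigma_sets UNIV G"
proof -
  obtain B :: "'a set set" where B: "countable B" "topological_basis B"
    using ex_countable_basis by auto
  define G where "G = (\<lambda>F. \<Inter>F) ` {F. finite F \<and> F \<subseteq> B}"
  have "countable G"
    unfolding G_def using countable_Collect_finite_subset[OF B(1)] by (intro countable_image) (simp add: conj_commute)
  moreover have "Int_stable G"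
  proof (rule Int_stableI)
    fix a b assume "a \<in> G" "b \<in> G"
    then obtain F F' where "finite F" "F \<subseteq> B" "finite F'" "F' \<subseteq> B" "a = \<Inter>F" "b = \<Inter>F'"
      by (auto simp: G_def)
    then show "a \<inter> b \<in> G"
      unfolding G_def by (intro image_eqI[of _ _ "F \<union> F'"]) auto
  qed
  moreover have "UNIV \<in> G"
    unfolding G_def by (intro image_eqI[of _ _ "{}"]) auto
  moreover have "sets borel = sigma_sets UNIV G"
  proof
    have "B \<subseteq> G"
      unfolding G_def by (auto intro!: image_eqI[of _ _ "{_}"])
    then have "sigma_sets UNIV B \<subseteq> sigma_sets UNIV G"
      by (rule sigma_sets_mono')
    moreover have "sets borel = sigma_sets UNIV B"
      by (subst borel_eq_countable_basis[OF B]) simp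
    ultimately show "sets borel \<subseteq> sigma_sets UNIV G" by simp
    have "open A" if "A \<in> G" for A
      using that B(2) by (auto simp: G_def intro!: open_Inter dest: topological_basis_open)
    then have "G \<subseteq> sets borel" by auto
    then show "sigma_sets UNIV G \<subseteq> sets borel"
      using sets.sigma_sets_subset[of G borel] by simp
  qed
  ultimately show ?thesis using that by blast
qed

text \<open>The factor \<open>of_bool (size \<phi> = n)\<close> restricts to configurations of exactly \<open>n\<close> points so that all the
  measures involved are finite.\<close>

lemma moment_density_eqI:
  assumes P: "sets P = sets (conf N)" "finite_measure P"
    and G: "Int_stable G" "space N \<in> G" "G \<subseteq> Pow (space N)" "sets N = sigma_sets (space N) G"
    and f[measurable]: "f \<in> borel_measurable N"
    and eq: "\<And>B. B \<in> G \<Longrightarrow> (\<integral>\<^sup>+\<phi>. of_nat (num_points B \<phi>) * of_bool (size \<phi> = n) \<partial>P) = (\<integral>\<^sup>+x\<in>B. f x \<partial>N)"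
    and B: "B \<in> sets N"
  shows "(\<integral>\<^sup>+\<phi>. of_nat (num_points B \<phi>) * of_bool (size \<phi> = n) \<partial>P) = (\<integral>\<^sup>+x\<in>B. f x \<partial>N)"
proof -
  note [measurable_cong] = P(1)
  interpret P: finite_measure P by (rule P(2))
  let ?a = "\<lambda>B. \<integral>\<^sup>+\<phi>. of_nat (num_points B \<phi>) * of_bool (size \<phi> = n) \<partial>P"
  let ?b = "\<lambda>B. \<integral>\<^sup>+x\<in>B. f x \<partial>N"
  have finite: "?a B < \<infinity>" for B
  proof -
    have "?a B \<le> (\<integral>\<^sup>+\<phi>. of_nat n \<partial>P)"
      using num_points_le_size by (intro nn_integral_mono) (auto simp: of_bool_def)
    also have "\<dots> < \<infinity>" using P.emeasure_finite[of "space P"] by (auto simp: ennreal_mult_eq_top_iff less_top[symmetric])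
    finally show ?thesis .
  qed
  have sN: "sigma_sets (space N) G = sets N" using G(4) by simp
  from B have "B \<in> sigma_sets (space N) G" using G(4) by simp
  with G(1,3) show ?thesis
  proof (induction rule: sigma_sets_induct_disjoint)
    case (basic A)
    then show ?case by (rule eq)
  next
    case empty
    have "num_points {} \<phi> = 0" for \<phi> :: "'a multiset" by (simp add: num_points_def)
    then show ?case by simp
  next
    case (compl A)
    then have [measurable]: "A \<in> sets N" by (simp add: sN)
    have split: "num_points (space N) \<phi> = num_points A \<phi> + num_points (space N - A) \<phi>" for \<phi>
      using sets.sets_into_space[OF \<open>A \<in> sets N\<close>] by (induction \<phi>) auto
    have "?a A + ?a (space N - A) = ?a (space N)"
      by (subst nn_integral_add[symmetric]) (auto simp: split distrib_right[symmetric])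
    also have "\<dots> = ?b (space N)" by (rule eq[OF G(2)])
    also have "\<dots> = ?b A + ?b (space N - A)"
      by (subst nn_integral_add[symmetric]) (auto intro!: nn_integral_cong simp: indicator_def)
    \<comment> \<open>Cancelling \<open>?a A\<close> requires its finiteness, which the restriction
      to \<open>n\<close> points provides.\<close>
    finally have "?a A + ?a (space N - A) = ?a A + ?b (space N - A)"
      using compl by simp
    then show ?case
      using finite[of A] by (auto simp: ennreal_add_left_cancel)
  next
    case (union A)
    then have [measurable]: "A i \<in> sets N" for i by (auto simp: sN)
    have "?a (\<Union>i. A i) = (\<integral>\<^sup>+\<phi>. (\<Sum>i. of_nat (num_points (A i) \<phi>) * of_bool (size \<phi> = n)) \<partial>P)"
      by (simp add: num_points_sums[OF union(1)])
    also have "\<dots> = (\<Sum>i. ?a (A i))"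
      by (intro nn_integral_suminf) measurable
    also have "\<dots> = (\<Sum>i. ?b (A i))" using union by simp
    also have "\<dots> = (\<integral>\<^sup>+x. (\<Sum>i. f x * indicator (A i) x) \<partial>N)"
      by (intro nn_integral_suminf[symmetric]) measurable
    also have "\<dots> = ?b (\<Union>i. A i)"
      by (simp add: suminf_indicator[OF union(1)])
    finally show ?case .
  qed
qed

context detection_model
begin

lemma weight_slice_measurable:
  assumes "v \<in> borel_measurable (Pi\<^sub>M {..<Suc p} (\<lambda>_. N))" and "w \<in> space (Pi\<^sub>M {..<k} (\<lambda>_. N))"
  shows "(\<lambda>x. weight p (\<lambda>y. v (y(p := x))) k w) \<in> borel_measurable N"
  unfolding assoc_weight_def
  by (intro borel_measurable_sum borel_measurable_times_ennreal borel_measurable_const slice_measurable[OF assms]) auto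

end

section \<open>Disintegration over the measurements\<close>

context measurement_model
begin

abbreviation "J \<equiv> janossy_meas N p_d l_d l_c j"

lemma janossy_meas_eq: "J m z = (\<Sum>n. weight n (\<lambda>x. ennreal (j n x)) m z)"
  by (simp add: janossy_meas_def assoc_weight_def)

lemma Upsilon1_eq:
  "Upsilon1 N p_d l_d l_c j k w x = (\<Sum>p. weight p (\<lambda>y. ennreal (j (Suc p) (y(p := x)))) k w)"
  by (simp add: Upsilon1_def assoc_weight_def mult.commute mult.left_commute)

lemma ennreal_j: "symmetric_on n N (\<lambda>x. ennreal (j n x))"
    "(\<lambda>x. ennreal (j n x)) \<in> borel_measurable (Pi\<^sub>M {..<n} (\<lambda>_. N))"
  using j_symmetric[of n] by (auto simp: symmetric_on_def)

lemma janossy_meas_measurable [measurable]: "J m \<in> borel_measurable (Pi\<^sub>M {..<m} (\<lambda>_. N))"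
proof -
  note [measurable] = weight_measurable[OF ennreal_j(2)]
  show ?thesis unfolding janossy_meas_eq[abs_def] by measurable
qed

lemma janossy_meas_symmetric: "symmetric_on m N (J m)"
  using weight_permute[OF ennreal_j] unfolding symmetric_on_def janossy_meas_eq by simp

text \<open>The joint law summed over the number \<open>n\<close> of hidden points. It identifies
  \<open>J m\<close> with the \<open>m\<close>-th Janossy density of \<Xi> up to the clutter
  normalization.\<close>

lemma measurement_size_law:
  assumes F[measurable]: "F \<in> borel_measurable (conf N)"
  shows "(\<integral>\<^sup>+\<omega>. of_bool (size (\<Xi> \<omega>) = m) * F (\<Xi> \<omega>) \<partial>M) =
    ennreal (exp (- (LINT z|N. l_c z)) / fact m) * (\<integral>\<^sup>+z. F (config_of m z) * J m z \<partial>Pi\<^sub>M {..<m} (\<lambda>_. N))"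
proof -
  let ?c = "ennreal (exp (- (LINT z|N. l_c z)) / fact m)"
  note [measurable] = weight_measurable[OF ennreal_j(2)]
  have 1: "(\<integral>\<^sup>+\<omega>. of_bool (size (\<Phi> \<omega>) = n) * (of_bool (size (\<Xi> \<omega>) = m) * F (\<Xi> \<omega>)) \<partial>M) =
      ?c * (\<integral>\<^sup>+z. F (config_of m z) * weight n (\<lambda>x. ennreal (j n x)) m z \<partial>Pi\<^sub>M {..<m} (\<lambda>_. N))" for n
  proof -
    have "(\<integral>\<^sup>+\<omega>. of_bool (size (\<Phi> \<omega>) = n) \<partial>M) \<le> (\<integral>\<^sup>+\<omega>. 1 \<partial>M)"
      by (intro nn_integral_mono) auto
    then have "(\<integral>\<^sup>+\<omega>. of_bool (size (\<Phi> \<omega>) = n) \<partial>M) < \<infinity>"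
      using M.emeasure_space_1 by (auto intro: le_less_trans)
    then show ?thesis
      using measurement_law[where g = "\<lambda>\<phi>. of_bool (size \<phi> = n)" and n = n and F = F and m = m] by simp
  qed
  have "(\<Sum>n. of_bool (size \<phi> = n) * t) = t" for \<phi> :: "'a multiset" and t :: ennreal
    by (subst suminf_finite[of "{size \<phi>}"]) auto
  then have "(\<integral>\<^sup>+\<omega>. of_bool (size (\<Xi> \<omega>) = m) * F (\<Xi> \<omega>) \<partial>M) =
      (\<integral>\<^sup>+\<omega>. (\<Sum>n. of_bool (size (\<Phi> \<omega>) = n) * (of_bool (size (\<Xi> \<omega>) = m) * F (\<Xi> \<omega>))) \<partial>M)"
    by simp
  also have "\<dots> = (\<Sum>n. \<integral>\<^sup>+\<omega>. of_bool (size (\<Phi> \<omega>) = n) * (of_bool (size (\<Xi> \<omega>) = m) * F (\<Xi> \<omega>)) \<partial>M)"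
    by (intro nn_integral_suminf) measurable
  also have "\<dots> = ?c * (\<Sum>n. \<integral>\<^sup>+z. F (config_of m z) * weight n (\<lambda>x. ennreal (j n x)) m z \<partial>Pi\<^sub>M {..<m} (\<lambda>_. N))"
    unfolding 1 by simp
  also have "(\<Sum>n. \<integral>\<^sup>+z. F (config_of m z) * weight n (\<lambda>x. ennreal (j n x)) m z \<partial>Pi\<^sub>M {..<m} (\<lambda>_. N)) =
      (\<integral>\<^sup>+z. F (config_of m z) * J m z \<partial>Pi\<^sub>M {..<m} (\<lambda>_. N))"
    unfolding janossy_meas_eq by (subst nn_integral_suminf[symmetric]) auto
  finally show ?thesis .
qed

lemma clutter_factor_neq_0: "ennreal (exp (- (LINT z|N. l_c z)) / fact m) \<noteq> 0"
  by (simp add: ennreal_eq_0_iff not_le)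

text \<open>The integral of \<open>J m\<close> is a probability divided by a positive constant.
  Finiteness is needed to divide by \<open>J m z\<close>.\<close>

lemma janossy_meas_finite: "AE z in Pi\<^sub>M {..<m} (\<lambda>_. N). J m z \<noteq> \<infinity>"
proof (rule nn_integral_noteq_infinite)
  have "(\<integral>\<^sup>+\<omega>. of_bool (size (\<Xi> \<omega>) = m) * 1 \<partial>M) \<le> (\<integral>\<^sup>+\<omega>. 1 \<partial>M)"
    by (intro nn_integral_mono) auto
  then have "(\<integral>\<^sup>+\<omega>. of_bool (size (\<Xi> \<omega>) = m) * 1 \<partial>M) < \<infinity>"
    using M.emeasure_space_1 by (auto intro: le_less_trans)
  then show "(\<integral>\<^sup>+z. J m z \<partial>Pi\<^sub>M {..<m} (\<lambda>_. N)) \<noteq> \<infinity>"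
    using measurement_size_law[of "\<lambda>_. 1" m] clutter_factor_neq_0[of m] by (auto simp: ennreal_mult_eq_top_iff)
qed simp

text \<open>Against any function of \<Xi> on the event of \<open>m\<close> measurements, the
  expectation of \<open>g (\<Phi> \<omega>)\<close> is computed once from the joint law and once by
  disintegration along \<open>\<kappa>\<close>. Both resulting densities are symmetric in
  \<open>z\<close>, so they agree almost everywhere.\<close>

lemma conditional_moment:
  assumes \<kappa>: "regular_cond_distr M \<Xi> (conf N) \<Phi> (conf N) \<kappa>"
    and g[measurable]: "g \<in> borel_measurable (conf N)" and supp: "\<And>\<phi>. size \<phi> \<noteq> n \<Longrightarrow> g \<phi> = 0"
    and fin: "(\<integral>\<^sup>+\<omega>. g (\<Phi> \<omega>) \<partial>M) < \<infinity>"
  shows "AE z in Pi\<^sub>M {..<m} (\<lambda>_. N). weight n (\<lambda>x. g (config_of n x) * ennreal (j n x)) m z =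
    (\<integral>\<^sup>+\<phi>. g \<phi> \<partial>\<kappa> (config_of m z)) * J m z"
proof (rule AE_eq_if_symmetric)
  let ?u = "\<lambda>x. g (config_of n x) * ennreal (j n x)"
  let ?c = "ennreal (exp (- (LINT z|N. l_c z)) / fact m)"
  have u: "symmetric_on n N ?u" "?u \<in> borel_measurable (Pi\<^sub>M {..<n} (\<lambda>_. N))"
    using j_symmetric[of n] by (auto simp: symmetric_on_def config_of_permute)
  show "symmetric_on m N (weight n ?u m)" by (rule weight_permute[OF u])
  show "weight n ?u m \<in> borel_measurable (Pi\<^sub>M {..<m} (\<lambda>_. N))" by (rule weight_measurable[OF u(2)])
  have "\<kappa> \<in> conf N \<rightarrow>\<^sub>M prob_algebra (conf N)" using \<kappa> by (simp add: regular_cond_distr_def)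
  then have "\<kappa> \<in> conf N \<rightarrow>\<^sub>M subprob_algebra (conf N)" by (rule measurable_prob_algebraD)
  then have \<kappa>_meas [measurable]: "(\<lambda>\<psi>. \<integral>\<^sup>+\<phi>. g \<phi> \<partial>\<kappa> \<psi>) \<in> borel_measurable (conf N)"
    using g by (intro measurable_compose[OF _ nn_integral_measurable_subprob_algebra])
  show "(\<lambda>z. (\<integral>\<^sup>+\<phi>. g \<phi> \<partial>\<kappa> (config_of m z)) * J m z) \<in> borel_measurable (Pi\<^sub>M {..<m} (\<lambda>_. N))"
    by (intro borel_measurable_times_ennreal measurable_compose[OF config_of_measurable \<kappa>_meas]) simp
  show "symmetric_on m N (\<lambda>z. (\<integral>\<^sup>+\<phi>. g \<phi> \<partial>\<kappa> (config_of m z)) * J m z)"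
    using janossy_meas_symmetric[of m] by (auto simp: symmetric_on_def config_of_permute)
  have eq: "?c * (\<integral>\<^sup>+z. F (config_of m z) * weight n ?u m z \<partial>Pi\<^sub>M {..<m} (\<lambda>_. N)) =
      (\<integral>\<^sup>+\<omega>. (of_bool (size (\<Xi> \<omega>) = m) * F (\<Xi> \<omega>)) * g (\<Phi> \<omega>) \<partial>M)"
    if F: "F \<in> borel_measurable (conf N)" for F
    using measurement_law[where g = g and n = n and F = F and m = m, OF g supp fin F] by (simp add: mult.commute)
  have "(\<integral>\<^sup>+\<omega>. (of_bool (size (\<Xi> \<omega>) = m) * 1) * g (\<Phi> \<omega>) \<partial>M) \<le> (\<integral>\<^sup>+\<omega>. g (\<Phi> \<omega>) \<partial>M)"
    by (intro nn_integral_mono) (auto simp: of_bool_def)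
  with fin show "(\<integral>\<^sup>+z. weight n ?u m z \<partial>Pi\<^sub>M {..<m} (\<lambda>_. N)) < \<infinity>"
    using eq[of "\<lambda>_. 1"] clutter_factor_neq_0[of m] by (auto simp: ennreal_mult_eq_top_iff less_top[symmetric] top_unique)
  fix F :: "'a multiset \<Rightarrow> ennreal" assume F[measurable]: "F \<in> borel_measurable (conf N)"
  have "?c * (\<integral>\<^sup>+z. F (config_of m z) * weight n ?u m z \<partial>Pi\<^sub>M {..<m} (\<lambda>_. N)) =
      (\<integral>\<^sup>+\<omega>. (of_bool (size (\<Xi> \<omega>) = m) * F (\<Xi> \<omega>)) * (\<integral>\<^sup>+\<phi>. g \<phi> \<partial>\<kappa> (\<Xi> \<omega>)) \<partial>M)"
    unfolding eq[OF F] by (rule regular_cond_distr_nn_integral[OF \<kappa>, of "\<lambda>\<psi>. of_bool (size \<psi> = m) * F \<psi>"]) auto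
  also have "\<dots> = (\<integral>\<^sup>+\<omega>. of_bool (size (\<Xi> \<omega>) = m) * (F (\<Xi> \<omega>) * (\<integral>\<^sup>+\<phi>. g \<phi> \<partial>\<kappa> (\<Xi> \<omega>))) \<partial>M)"
    by (simp only: mult.assoc)
  also have "\<dots> = ?c * (\<integral>\<^sup>+z. F (config_of m z) * (\<integral>\<^sup>+\<phi>. g \<phi> \<partial>\<kappa> (config_of m z)) * J m z \<partial>Pi\<^sub>M {..<m} (\<lambda>_. N))"
    by (rule measurement_size_law) measurable
  finally show "(\<integral>\<^sup>+z. F (config_of m z) * weight n ?u m z \<partial>Pi\<^sub>M {..<m} (\<lambda>_. N)) =
      (\<integral>\<^sup>+z. F (config_of m z) * ((\<integral>\<^sup>+\<phi>. g \<phi> \<partial>\<kappa> (config_of m z)) * J m z) \<partial>Pi\<^sub>M {..<m} (\<lambda>_. N))"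
    using clutter_factor_neq_0[of m] by (subst (asm) ennreal_mult_cancel_left) (simp_all add: mult.assoc)
qed

text \<open>The contribution of hidden configurations with \<open>Suc p\<close> points to the
  numerator of the asserted density.\<close>

definition moment_term :: "nat \<Rightarrow> nat \<Rightarrow> (nat \<Rightarrow> 'a) \<Rightarrow> 'a \<Rightarrow> ennreal" where
  "moment_term p m z x = ennreal (1 - p_d) * weight p (\<lambda>y. ennreal (j (Suc p) (y(p := x)))) m z +
     (\<Sum>r<m. kern (z r) x * weight p (\<lambda>y. ennreal (j (Suc p) (y(p := x)))) (m - 1) (omit_entry m r z))"

lemma omit_entry_space:
  assumes "z \<in> space (Pi\<^sub>M {..<m} (\<lambda>_. N))" "r < m"
  shows "omit_entry m r z \<in> space (Pi\<^sub>M {..<m - 1} (\<lambda>_. N))"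
  using assms by (auto simp: space_PiM PiE_iff omit_entry_def)

lemma moment_term_measurable:
  assumes z: "z \<in> space (Pi\<^sub>M {..<m} (\<lambda>_. N))"
  shows "moment_term p m z \<in> borel_measurable N"
proof -
  have "(\<lambda>x. kern (z r) x) \<in> borel_measurable N" if "r < m" for r
    using z that by (intro measurable_compose[OF _ measurable_ennreal]) (auto simp: space_PiM PiE_iff)
  then show ?thesis
    unfolding moment_term_def[abs_def] using z
    by (intro borel_measurable_add borel_measurable_sum borel_measurable_times_ennreal borel_measurable_const
        weight_slice_measurable[OF ennreal_j(2)] omit_entry_space) auto
qed

lemma suminf_moment_term:
  assumes "J m z \<noteq> 0" "J m z \<noteq> \<infinity>"
  shows "(\<Sum>p. moment_term p m z x) / J m z =
    ennreal (1 - p_d) * assoc_missed N p_d l_d l_c j m z x +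
    (\<Sum>r<m. kern (z r) x * assoc_detected N p_d l_d l_c j m z x r)"
proof -
  have "(\<Sum>p. moment_term p m z x) = ennreal (1 - p_d) * Upsilon1 N p_d l_d l_c j m z x +
      (\<Sum>r<m. kern (z r) x * Upsilon1 N p_d l_d l_c j (m - 1) (omit_entry m r z) x)"
    unfolding moment_term_def Upsilon1_eq
    by (subst suminf_add[symmetric]) (auto simp: suminf_sum[OF summableI])
  then show ?thesis
    by (simp add: assoc_missed_def assoc_detected_def add_divide_distrib_ennreal ennreal_times_divide
        divide_ennreal_def sum_distrib_right distrib_right mult.assoc)
qed

text \<open>The exceptional null set covers infinite \<open>J m z\<close> and the countably many
  pairs of a point number and a set of \<open>G\<close>. For every other \<open>z\<close> the
  argument is deterministic: extension from \<open>G\<close> to \<open>sets N\<close>, then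
  summation over the number of hidden points.\<close>

lemma first_moment_density:
  assumes \<kappa>: "regular_cond_distr M \<Xi> (conf N) \<Phi> (conf N) \<kappa>"
    and G: "countable G" "Int_stable G" "space N \<in> G" "G \<subseteq> Pow (space N)" "sets N = sigma_sets (space N) G"
  shows "AE z in Pi\<^sub>M {..<m} (\<lambda>_. N). J m z > 0 \<longrightarrow>
    has_first_moment_density (\<kappa> (config_of m z)) N
      (\<lambda>x. ennreal (1 - p_d) * assoc_missed N p_d l_d l_c j m z x +
           (\<Sum>r<m. kern (z r) x * assoc_detected N p_d l_d l_c j m z x r))"
proof -
  let ?P = "Pi\<^sub>M {..<m} (\<lambda>_. N)"
  let ?g = "\<lambda>B n \<phi>. of_nat (num_points B \<phi>) * of_bool (size \<phi> = n) :: ennreal"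
  have G_sets: "B \<in> sets N" if "B \<in> G" for B
    using that G(5) by auto
  have "AE z in ?P. \<forall>n. \<forall>B\<in>G. weight n (\<lambda>x. ?g B n (config_of n x) * ennreal (j n x)) m z =
      (\<integral>\<^sup>+\<phi>. ?g B n \<phi> \<partial>\<kappa> (config_of m z)) * J m z"
    unfolding AE_all_countable AE_ball_countable[OF G(1)]
  proof (intro allI ballI)
    fix n B assume "B \<in> G"
    then have [measurable]: "B \<in> sets N" by (rule G_sets)
    show "AE z in ?P. weight n (\<lambda>x. ?g B n (config_of n x) * ennreal (j n x)) m z =
      (\<integral>\<^sup>+\<phi>. ?g B n \<phi> \<partial>\<kappa> (config_of m z)) * J m z"
    proof (rule conditional_moment[OF \<kappa>])
      have "(\<integral>\<^sup>+\<omega>. ?g B n (\<Phi> \<omega>) \<partial>M) \<le> (\<integral>\<^sup>+\<omega>. of_nat n \<partial>M)"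
        using num_points_le_size by (intro nn_integral_mono) (auto simp: of_bool_def)
      also have "\<dots> < \<infinity>"
        by (simp add: M.emeasure_space_1 ennreal_of_nat_eq_real_of_nat)
      finally show "(\<integral>\<^sup>+\<omega>. ?g B n (\<Phi> \<omega>) \<partial>M) < \<infinity>" .
    qed auto
  qed
  then show ?thesis
    using janossy_meas_finite[of m] AE_space
  proof eventually_elim
    case (elim z)
    have z: "z \<in> space ?P" by (rule elim)
    let ?\<kappa> = "\<kappa> (config_of m z)"
    have "\<kappa> \<in> conf N \<rightarrow>\<^sub>M prob_algebra (conf N)" using \<kappa> by (simp add: regular_cond_distr_def)
    from measurable_space[OF this measurable_space[OF config_of_measurable z]]
    have \<kappa>z: "prob_space ?\<kappa>" "sets ?\<kappa> = sets (conf N)"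
      by (auto simp: space_prob_algebra)
    note [measurable_cong] = \<kappa>z(2)
    show ?case
    proof
      assume "J m z > 0"
      then have J: "J m z \<noteq> 0" "J m z \<noteq> \<infinity>" using elim by auto
      note [measurable] = moment_term_measurable[OF z]
      \<comment> \<open>Dividing by \<open>J m z\<close>, which is neither 0 nor infinite, turns the
        splitting of the counted point into a density for \<open>Suc p\<close> hidden
        points.\<close>
      have moment: "(\<integral>\<^sup>+\<phi>. ?g B (Suc p) \<phi> \<partial>?\<kappa>) = (\<integral>\<^sup>+x\<in>B. (moment_term p m z x / J m z) \<partial>N)"
        if "B \<in> sets N" for B p
        using that
      proof (rule moment_density_eqI[OF \<kappa>z(2) _ G(2-5), rotated -1])
        show "finite_measure ?\<kappa>" using \<kappa>z(1) by (rule prob_space.finite_measure)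
        fix B assume B: "B \<in> G"
        note [measurable] = G_sets[OF B]
        have "(\<integral>\<^sup>+\<phi>. ?g B (Suc p) \<phi> \<partial>?\<kappa>) * J m z =
            weight (Suc p) (\<lambda>x. of_nat (num_points B (config_of (Suc p) x)) * ennreal (j (Suc p) x)) m z"
          using elim(1) B by (simp del: of_nat_Suc)
        also have "\<dots> = (\<integral>\<^sup>+x\<in>B. moment_term p m z x \<partial>N)"
          unfolding moment_term_def by (rule weight_num_points[OF ennreal_j G_sets[OF B] z])
        finally have "(\<integral>\<^sup>+\<phi>. ?g B (Suc p) \<phi> \<partial>?\<kappa>) * J m z / J m z = (\<integral>\<^sup>+x\<in>B. moment_term p m z x \<partial>N) / J m z"
          by simp
        moreover have "(\<integral>\<^sup>+x\<in>B. (moment_term p m z x / J m z) \<partial>N) = (\<integral>\<^sup>+x\<in>B. moment_term p m z x \<partial>N) / J m z"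
          by (subst nn_integral_divide[symmetric]) (auto simp: divide_ennreal_def ac_simps)
        ultimately show "(\<integral>\<^sup>+\<phi>. ?g B (Suc p) \<phi> \<partial>?\<kappa>) = (\<integral>\<^sup>+x\<in>B. (moment_term p m z x / J m z) \<partial>N)"
          using J by (simp add: ennreal_mult_divide_eq)
      qed simp
      show "has_first_moment_density ?\<kappa> N
        (\<lambda>x. ennreal (1 - p_d) * assoc_missed N p_d l_d l_c j m z x +
           (\<Sum>r<m. kern (z r) x * assoc_detected N p_d l_d l_c j m z x r))"
        unfolding has_first_moment_density_def suminf_moment_term[OF J, symmetric]
      proof (intro conjI ballI)
        show "(\<lambda>x. (\<Sum>p. moment_term p m z x) / J m z) \<in> borel_measurable N" by measurable
        fix B assume [measurable]: "B \<in> sets N"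
        \<comment> \<open>The empty configuration has count 0, so the sizes \<open>Suc p\<close>
          exhaust the moment.\<close>
        have "(\<Sum>p. ?g B (Suc p) \<phi>) = of_nat (num_points B \<phi>)" for \<phi>
        proof (cases "size \<phi>")
          case 0
          then show ?thesis using num_points_le_size[of B \<phi>] by simp
        next
          case (Suc k)
          then show ?thesis by (subst suminf_finite[of "{k}"]) auto
        qed
        then have "(\<integral>\<^sup>+\<phi>. of_nat (num_points B \<phi>) \<partial>?\<kappa>) = (\<integral>\<^sup>+\<phi>. (\<Sum>p. ?g B (Suc p) \<phi>) \<partial>?\<kappa>)"
          by simp
        also have "\<dots> = (\<Sum>p. \<integral>\<^sup>+\<phi>. ?g B (Suc p) \<phi> \<partial>?\<kappa>)"
          by (intro nn_integral_suminf) measurable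
        also have "\<dots> = (\<Sum>p. \<integral>\<^sup>+x\<in>B. (moment_term p m z x / J m z) \<partial>N)"
          by (simp only: moment[OF \<open>B \<in> sets N\<close>])
        also have "\<dots> = (\<integral>\<^sup>+x. (\<Sum>p. moment_term p m z x / J m z * indicator B x) \<partial>N)"
          by (intro nn_integral_suminf[symmetric]) measurable
        also have "\<dots> = (\<integral>\<^sup>+x\<in>B. ((\<Sum>p. moment_term p m z x) / J m z) \<partial>N)"
          by simp
        finally show "(\<integral>\<^sup>+\<phi>. of_nat (num_points B \<phi>) \<partial>?\<kappa>) = (\<integral>\<^sup>+x\<in>B. ((\<Sum>p. moment_term p m z x) / J m z) \<partial>N)" .
      qed
    qed
  qed
qed

end

theorem proposition3p2:
  fixes \<Lambda> :: "'a::euclidean_space set" and \<nu> N :: "'a measure"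
    and M :: "'w measure" and \<Phi> \<Xi> :: "'w \<Rightarrow> 'a multiset"
    and j :: "nat \<Rightarrow> (nat \<Rightarrow> 'a) \<Rightarrow> real"
    and p_d q_d :: real and l_d :: "'a \<Rightarrow> 'a \<Rightarrow> real" and l_c :: "'a \<Rightarrow> real"
    and m :: nat and \<kappa> :: "'a multiset \<Rightarrow> 'a multiset measure"
  assumes "\<Lambda> \<in> sets borel" and "compact (closure \<Lambda>)"
    and "radon_measure \<nu>" and "N = restrict_space \<nu> \<Lambda>"
    and "prob_space M"
    and "simple_point_process M N \<Phi>" and "janossy_densities M N \<Phi> j"
    and "0 < p_d" and "p_d \<le> 1" and "q_d = 1 - p_d"
    and "(\<lambda>(z, x). l_d z x) \<in> borel_measurable (N \<Otimes>\<^sub>M N)"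
    and "\<And>z x. z \<in> \<Lambda> \<Longrightarrow> x \<in> \<Lambda> \<Longrightarrow> 0 \<le> l_d z x"
    and "\<And>x. x \<in> \<Lambda> \<Longrightarrow> (\<integral>\<^sup>+ z. ennreal (l_d z x) \<partial>N) = 1"
    and "\<And>z. z \<in> \<Lambda> \<Longrightarrow> 0 \<le> l_c z" and "integrable N l_c"
    and "measurement_process M N p_d l_d l_c \<Phi> \<Xi>"
    and "regular_cond_distr M \<Xi> (conf N) \<Phi> (conf N) \<kappa>"
  shows "AE z in Pi\<^sub>M {..<m} (\<lambda>_. N).
    janossy_meas N p_d l_d l_c j m z > 0 \<longrightarrow>
    has_first_moment_density (\<kappa> (config_of m z)) N
      (\<lambda>x. ennreal q_d * assoc_missed N p_d l_d l_c j m z x +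
           (\<Sum>r<m. ennreal (p_d * l_d (z r) x) * assoc_detected N p_d l_d l_c j m z x r))"
proof -
  have sets_\<nu>: "sets \<nu> = sets borel" and \<nu>: "\<And>K. compact K \<Longrightarrow> emeasure \<nu> K < \<infinity>"
    using assms(3) by (auto simp: radon_measure_def)
  have space_\<nu>: "space \<nu> = UNIV" using sets_eq_imp_space_eq[OF sets_\<nu>] by simp
  have \<Lambda>: "\<Lambda> \<inter> space \<nu> \<in> sets \<nu>" using assms(1) by (simp add: sets_\<nu> space_\<nu>)
  have space_N: "space N = \<Lambda>" using assms(4) by (simp add: space_restrict_space space_\<nu>)
  \<comment> \<open>Relative compactness of \<Lambda> makes the Radon measure finite on it.\<close>
  have "emeasure N (space N) = emeasure \<nu> \<Lambda>"
    unfolding assms(4) using \<Lambda> by (simp add: emeasure_restrict_space space_restrict_space space_\<nu>)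
  also have "\<dots> \<le> emeasure \<nu> (closure \<Lambda>)"
    by (intro emeasure_mono closure_subset) (simp add: sets_\<nu>)
  also have "\<dots> < \<infinity>" by (rule \<nu>[OF assms(2)])
  finally have "emeasure N (space N) \<noteq> \<infinity>" by simp
  interpret N: finite_measure N by standard fact
  interpret M: prob_space M by fact
  interpret measurement_model N p_d l_d l_c M \<Phi> \<Xi> j
    using assms(7-9,11,13-16) by unfold_locales (simp_all add: space_N)
  obtain G :: "'a set set" where G: "countable G" "Int_stable G" "UNIV \<in> G" "sets borel = sigma_sets UNIV G"
    by (rule countable_Int_stable_generator_borel)
  \<comment> \<open>Traces on \<Lambda> inherit countability and intersection stability, and the
    trace of \<open>UNIV\<close> is the whole window.\<close>
  let ?G = "(\<inter>) \<Lambda> ` G"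
  have "sets N = sigma_sets (space N) ?G"
  proof -
    have "sets N = (\<inter>) \<Lambda> ` sigma_sets UNIV G"
      using G(4) by (simp add: assms(4) sets_restrict_space sets_\<nu>)
    also have "\<dots> = sigma_sets \<Lambda> ?G"
      using assms(1) G(4) by (intro sigma_sets_Int) auto
    finally show ?thesis by (simp add: space_N)
  qed
  moreover have "Int_stable ?G"
  proof (rule Int_stableI)
    fix a b assume "a \<in> ?G" "b \<in> ?G"
    then obtain A B where AB: "A \<in> G" "B \<in> G" "a = \<Lambda> \<inter> A" "b = \<Lambda> \<inter> B" by auto
    with Int_stableD[OF G(2) AB(1,2)] show "a \<inter> b \<in> ?G"
      by (intro image_eqI[of _ _ "A \<inter> B"]) auto
  qed
  moreover have "space N \<in> ?G" using G(3) by (auto simp: space_N)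
  moreover have "?G \<subseteq> Pow (space N)" by (auto simp: space_N)
  moreover have "countable ?G" using G(1) by simp
  ultimately show ?thesis
    using first_moment_density[OF assms(17), of ?G m] by (simp add: assms(10) space_N)
qed

end
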